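(* Let $\mathscr{A},\mathscr{B}\in\mathbb{T}^{n\times n\times p}_{+}$ and let $\mathscr{A}\#\mathscr{B}$ be their geometric mean. Then the canonical T-phase vectors satisfy the (strong) majorization $$\phi(\mathscr{A}\#\mathscr{B})\prec \tfrac12\phi(\mathscr{A})+\tfrac12\phi(\mathscr{B}).$$
   Context: T-product: for a third-order tensor $\mathscr{A}\in\mathbb{C}^{m\times n\times p}$ with frontal slices $A^{(1)},\dots,A^{(p)}$, $\operatorname{bcirc}(\mathscr{A})\in\mathbb{C}^{mp\times np}$ is the block-circulant matrix whose first block column is $A^{(1)},\dots,A^{(p)}$ (top to bottom), $\operatorname{unfold}(\mathscr{A})$ is that first block column, $\operatorname{fold}$ is its inverse, and $\mathscr{A}*\mathscr{B}=\operatorname{fold}(\operatorname{bcirc}(\mathscr{A})\operatorname{unfold}(\mathscr{B}))$. The map $\operatorname{bcirc}$ is linear, injective and multiplicative. The T-inverse satisfies $\operatorname{bcirc}(\mathscr{A}^{-1})=\operatorname{bcirc}(\mathscr{A})^{-1}$. The Frobenius inner product is $\langle\mathscr{A},\mathscr{B}\rangle_F=\sum_{i,j,k}\overline{a_{ijk}}\,b_{ijk}$. Accretive tensors: $\mathbb{T}^{n\times n\times p}_{+}=\{\mathscr{A}\in\mathbb{C}^{n\times n\times p}: \operatorname{Re}\langle\mathscr{X},\mathscr{A}*\mathscr{X}\rangle_F>0\ \text{for all nonzero }\mathscr{X}\in\mathbb{C}^{n\times 1\times p}\}$. Geometric mean: for $\mathscr{A},\mathscr{B}\in\mathbb{T}^{n\times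 n\times p}_{+}$, $\mathscr{A}\#\mathscr{B}$ is defined by $(\mathscr{A}\#\mathscr{B})^{-1}=\frac{2}{\pi}\int_0^\infty (t\mathscr{A}+t^{-1}\mathscr{B})^{-1}\frac{dt}{t}$ (T-inverses); it again lies in $\mathbb{T}^{n\times n\times p}_{+}$. Canonical T-phases: a tensor $\mathscr{A}\in\mathbb{C}^{n\times n\times p}$ is sectorial if $0\notin W(\mathscr{A})=\{\langle\mathscr{X},\mathscr{A}*\mathscr{X}\rangle_F:\mathscr{X}\in\mathbb{C}^{n\times1\times p},\ \|\mathscr{X}\|_F=1\}$ (which equals the numerical range of $\operatorname{bcirc}(\mathscr{A})$). Then $\operatorname{bcirc}(\mathscr{A})=T^HDT$ with $T$ nonsingular and $D$ diagonal unitary; writing the diagonal entries of $D$ as $e^{j\phi_k(\mathscr{A})}$ ($j=\sqrt{-1}$), $\phi_k(\mathscr A)\in(-\pi,\pi]$, ordered $\phi_1(\mathscr{A})\ge\cdots\ge\phi_{np}(\mathscr{A})$ with $\phi_1-\phi_{np}<\pi$, the vector $\phi(\mathscr{A})=(\phi_1(\mathscr{A}),\dots,\phi_{np}(\mathscr{A}))$ is the canonical T-phase vector (independent of the decomposition). Tensors in $\mathbb{T}^{n\times n\times p}_{+}$ are sectorial, with all canonical T-phases in $(-\pi/2,\pi/2)$. $x\prec y$ (strong majorization) means that for each $k$ the sum of the $k$ largest entries of $x$ is at most that of $y$, with equality of the total sums. *)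

theory Defs
  imports
    "HOL-Analysis.Analysis"
    "Jordan_Normal_Form.Matrix"
    "Jordan_Normal_Form.Schur_Decomposition"
begin

text \<open>
  A third-order tensor is the list of its frontal slices: the entry $a_{i+1,j+1,k+1}$ of
  \<open>A\<close> is \<open>(A ! k) $$ (i, j)\<close>.  The first two dimensions are read off the first slice, so all
  notions below are meant for tensors with at least one frontal slice.
\<close>

type_synonym ctensor = "complex mat list"

definition carrier_tensor :: "nat \<Rightarrow> nat \<Rightarrow> nat \<Rightarrow> ctensor set" where
  "carrier_tensor m n p = {A. length A = p \<and> (\<forall>k<p. A ! k \<in> carrier_mat m n)}"

definition t_rows :: "ctensor \<Rightarrow> nat" where
  "t_rows A = dim_row (A ! 0)"

definition t_cols :: "ctensor \<Rightarrow> nat" where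
  "t_cols A = dim_col (A ! 0)"

definition t_zero :: "nat \<Rightarrow> nat \<Rightarrow> nat \<Rightarrow> ctensor" where
  "t_zero m n p = replicate p (0\<^sub>m m n)"

definition t_add :: "ctensor \<Rightarrow> ctensor \<Rightarrow> ctensor" (infixl \<open>+\<^sub>T\<close> 65) where
  "A +\<^sub>T B = map2 (+) A B"

definition t_smult :: "complex \<Rightarrow> ctensor \<Rightarrow> ctensor" (infixl \<open>\<cdot>\<^sub>T\<close> 70) where
  "c \<cdot>\<^sub>T A = map (\<lambda>M. c \<cdot>\<^sub>m M) A"

text \<open>Block \<open>(r, s)\<close> of the block-circulant matrix is the slice with index \<open>r - s\<close> modulo the
  number of slices; adding \<open>p\<close> first avoids truncated subtraction.\<close>

definition bcirc :: "ctensor \<Rightarrow> complex mat" where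
  "bcirc A = (let m = t_rows A; n = t_cols A; p = length A in
     Matrix.mat (m * p) (n * p)
       (\<lambda>(r, c). (A ! ((r div m + p - c div n) mod p)) $$ (r mod m, c mod n)))"

definition t_unfold :: "ctensor \<Rightarrow> complex mat" where
  "t_unfold A = (let m = t_rows A in
     Matrix.mat (m * length A) (t_cols A) (\<lambda>(r, c). (A ! (r div m)) $$ (r mod m, c)))"

definition t_fold :: "nat \<Rightarrow> nat \<Rightarrow> complex mat \<Rightarrow> ctensor" where
  "t_fold m p M =
     map (\<lambda>k. Matrix.mat m (dim_col M) (\<lambda>(i, j). M $$ (k * m + i, j))) [0..<p]"

definition t_prod :: "ctensor \<Rightarrow> ctensor \<Rightarrow> ctensor" (infixl \<open>*\<^sub>T\<close> 70) where
  "A *\<^sub>T B = t_fold (t_rows A) (length A) (bcirc A * t_unfold B)"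

definition t_one :: "nat \<Rightarrow> nat \<Rightarrow> ctensor" where
  "t_one n p = map (\<lambda>k. if k = 0 then 1\<^sub>m n else 0\<^sub>m n n) [0..<p]"

definition is_t_inverse :: "ctensor \<Rightarrow> ctensor \<Rightarrow> bool" where
  "is_t_inverse A B \<longleftrightarrow> (let n = t_rows A; p = length A in
     A \<in> carrier_tensor n n p \<and> B \<in> carrier_tensor n n p \<and>
     A *\<^sub>T B = t_one n p \<and> B *\<^sub>T A = t_one n p)"

definition t_inverse :: "ctensor \<Rightarrow> ctensor" where
  "t_inverse A = (THE B. is_t_inverse A B)"

definition t_inner :: "ctensor \<Rightarrow> ctensor \<Rightarrow> complex" where
  "t_inner A B = (\<Sum>i<t_rows A. \<Sum>j<t_cols A. \<Sum>k<length A.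
     cnj ((A ! k) $$ (i, j)) * (B ! k) $$ (i, j))"

definition t_norm :: "ctensor \<Rightarrow> real" where
  "t_norm A = sqrt (\<Sum>i<t_rows A. \<Sum>j<t_cols A. \<Sum>k<length A. (cmod ((A ! k) $$ (i, j)))\<^sup>2)"

definition accretive :: "nat \<Rightarrow> nat \<Rightarrow> ctensor set" where
  "accretive n p = {A \<in> carrier_tensor n n p.
     \<forall>X \<in> carrier_tensor n 1 p. X \<noteq> t_zero n 1 p \<longrightarrow> Re (t_inner X (A *\<^sub>T X)) > 0}"

text \<open>The integral of a tensor-valued function is taken entrywise, as a Lebesgue integral.\<close>

definition t_integral :: "nat \<Rightarrow> nat \<Rightarrow> nat \<Rightarrow> real set \<Rightarrow> (real \<Rightarrow> ctensor) \<Rightarrow> ctensor" where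
  "t_integral m n p S F =
     map (\<lambda>k. Matrix.mat m n (\<lambda>(i, j). LINT t:S|lborel. (F t ! k) $$ (i, j))) [0..<p]"

definition t_gmean_inverse :: "ctensor \<Rightarrow> ctensor \<Rightarrow> ctensor" where
  "t_gmean_inverse A B = complex_of_real (2 / pi) \<cdot>\<^sub>T
     t_integral (t_rows A) (t_rows A) (length A) {0<..}
       (\<lambda>t. complex_of_real (1 / t) \<cdot>\<^sub>T
          t_inverse (complex_of_real t \<cdot>\<^sub>T A +\<^sub>T complex_of_real (1 / t) \<cdot>\<^sub>T B))"

definition t_gmean :: "ctensor \<Rightarrow> ctensor \<Rightarrow> ctensor" (infixl \<open>#\<^sub>T\<close> 70) where
  "A #\<^sub>T B = (THE G. is_t_inverse G (t_gmean_inverse A B))"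

definition t_numerical_range :: "ctensor \<Rightarrow> complex set" where
  "t_numerical_range A =
     {t_inner X (A *\<^sub>T X) |X. X \<in> carrier_tensor (t_rows A) 1 (length A) \<and> t_norm X = 1}"

definition t_sectorial :: "ctensor \<Rightarrow> bool" where
  "t_sectorial A \<longleftrightarrow> 0 \<notin> t_numerical_range A"

definition is_canonical_t_phases :: "ctensor \<Rightarrow> real vec \<Rightarrow> bool" where
  "is_canonical_t_phases A \<phi> \<longleftrightarrow> (let N = t_rows A * length A in
     t_sectorial A \<and> \<phi> \<in> carrier_vec N \<and>
     (\<forall>k<N. - pi < vec_index \<phi> k \<and> vec_index \<phi> k \<le> pi) \<and>
     (\<forall>k l. k \<le> l \<and> l < N \<longrightarrow> vec_index \<phi> l \<le> vec_index \<phi> k) \<and>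
     vec_index \<phi> 0 - vec_index \<phi> (N - 1) < pi \<and>
     (\<exists>T \<in> carrier_mat N N. invertible_mat T \<and>
        bcirc A = mat_adjoint T * mat_diag N (\<lambda>k. cis (vec_index \<phi> k)) * T))"

text \<open>There is at most one canonical phase vector, since the phases do not depend on the
  decomposition.  For a sectorial tensor whose numerical range meets the negative real axis
  there may be none with all phases in $(-\pi,\pi]$, and the value is then unspecified; accretive
  tensors always have one.\<close>

definition t_phases :: "ctensor \<Rightarrow> real vec" where
  "t_phases A = (THE \<phi>. is_canonical_t_phases A \<phi>)"

definition sum_largest :: "nat \<Rightarrow> real vec \<Rightarrow> real" where
  "sum_largest k x = sum_list (take k (rev (sort (list_of_vec x))))"

definition majorized :: "real vec \<Rightarrow> real vec \<Rightarrow> bool" (infix \<open>\<prec>\<^sub>m\<close> 50) where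
  "x \<prec>\<^sub>m y \<longleftrightarrow> dim_vec x = dim_vec y \<and>
     (\<forall>k\<in>{1..dim_vec x}. sum_largest k x \<le> sum_largest k y) \<and>
     sum_list (list_of_vec x) = sum_list (list_of_vec y)"

end

theory Submission
  imports Defs "Jordan_Normal_Form.Spectral_Radius" "HOL-Probability.Sinc_Integral"
begin

text \<open>
  \<open>bcirc\<close> turns accretive tensors into accretive matrices, so everything happens there.
  Put \<open>G = A # B\<close> and choose coordinates in which \<open>G\<close> is a unitary diagonal matrix \<open>D\<close>.  The
  equation \<open>B = G A\<^sup>-\<^sup>1 G\<close> becomes \<open>B' = D A'\<^sup>-\<^sup>1 D\<close>, and it passes to leading \<open>k \<times> k\<close> blocks.
  Taking arguments of determinants, twice the sum of the first \<open>k\<close> phases of \<open>G\<close> is the sum of the phases of a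
  compression of \<open>B'\<close> minus that of a compression of \<open>A'\<^sup>-\<^sup>1\<close>.  By interlacing (a dimension count
  as for Hermitian matrices) these are bounded by the sums of the \<open>k\<close> largest phases of \<open>B\<close> and of \<open>A\<close>,
  with equality for full blocks.  Ambiguities modulo \<open>2\<pi>\<close> are excluded by homotopies inside the convex
  cone of accretive matrices.

  The equation \<open>B = G A\<^sup>-\<^sup>1 G\<close> says that the integral defining \<open>G\<^sup>-\<^sup>1 A\<close> is an inverse square root of
  \<open>C = A\<^sup>-\<^sup>1 B\<close>.  The square of the integral times \<open>C\<close> is constant along the segment from the identity
  to \<open>C\<close>, because its derivative vanishes after an integration by parts.
\<close>

section \<open>Accretive matrices\<close>

text \<open>Phases are invariant under congruence but not multiplicative, while arguments of
  determinants are multiplicative; determinants of compressions therefore link the three matrices.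
  Compression respects multiplication by \<open>D\<close> on both sides because \<open>D\<close> is
  diagonal, which is why the coordinates are adapted to \<open>G\<close> and not to \<open>A\<close>
  or \<open>B\<close>. The minus sign before the compression of the inverse of \<open>A\<close> is
  turned around by the adjoint: A^-H = A^-H A A^-1 is congruent to \<open>A\<close>, so upper bounds
  by largest phases serve for both terms. Accretivity keeps the phases in (-pi/2, pi/2), where the
  sine comparisons and principal arguments are unambiguous. An accretive matrix need not be normal,
  so no unitary diagonalization is available; the diagonal form under congruence comes from
  eigenvectors of M^-H M and Schur complements. The substitution t = tan \<theta> replaces the
  improper integral by a continuous one over [0, pi/2]; its value pi/2 at the identity explains the
  factor 2/pi in the mean.\<close>

lemma mult_mat_index:
  fixes A B :: "'a :: semiring_0 mat"
  assumes "A \<in> carrier_mat n m" "B \<in> carrier_mat m k" "i < n" "j < k"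
  shows "(A * B) $$ (i, j) = (\<Sum>l<m. A $$ (i, l) * B $$ (l, j))"
  using assms by (auto simp: scalar_prod_def lessThan_atLeast0 intro!: sum.cong)

lemma mat_adjoint_index [simp]:
  fixes A :: "complex mat"
  shows "i < dim_col A \<Longrightarrow> j < dim_row A \<Longrightarrow> mat_adjoint A $$ (i, j) = cnj (A $$ (j, i))"
  by (simp add: mat_adjoint_def mat_of_rows_index)

lemma mat_adjoint_dim [simp]:
  "dim_row (mat_adjoint A) = dim_col A" "dim_col (mat_adjoint A) = dim_row A"
  by (simp_all add: mat_adjoint_def)

lemma mat_adjoint_carrier [simp]:
  "A \<in> carrier_mat n m \<Longrightarrow> mat_adjoint A \<in> carrier_mat m n"
  by (intro carrier_matI) auto

lemma mat_adjoint_adjoint [simp]: "mat_adjoint (mat_adjoint A) = (A :: complex mat)"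
  by (rule eq_matI) auto

lemma mat_adjoint_mult:
  fixes A B :: "complex mat"
  assumes "A \<in> carrier_mat n m" "B \<in> carrier_mat m k"
  shows "mat_adjoint (A * B) = mat_adjoint B * mat_adjoint A"
proof (rule eq_matI)
  fix i j assume "i < dim_row (mat_adjoint B * mat_adjoint A)" "j < dim_col (mat_adjoint B * mat_adjoint A)"
  with assms have ij: "i < k" "j < n" by auto
  have "mat_adjoint (A * B) $$ (i, j) = cnj ((A * B) $$ (j, i))"
    using assms ij by auto
  also have "\<dots> = (\<Sum>l<m. mat_adjoint B $$ (i, l) * mat_adjoint A $$ (l, j))"
    using assms ij by (subst mult_mat_index[OF assms]) (auto intro!: sum.cong simp: mult.commute)
  also have "\<dots> = (mat_adjoint B * mat_adjoint A) $$ (i, j)"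
    using assms ij by (subst mult_mat_index[of _ k m _ n]) auto
  finally show "mat_adjoint (A * B) $$ (i, j) = (mat_adjoint B * mat_adjoint A) $$ (i, j)" .
qed (use assms in auto)

lemma mat_adjoint_one [simp]: "mat_adjoint (1\<^sub>m n) = (1\<^sub>m n :: complex mat)"
  by (rule eq_matI) auto

lemma det_mat_adjoint:
  assumes "A \<in> carrier_mat n n"
  shows "det (mat_adjoint A) = cnj (det A)"
proof -
  have "mat_adjoint A = map_mat cnj (transpose_mat A)"
    by (rule eq_matI) auto
  moreover have "det (map_mat cnj (transpose_mat A)) = cnj (det (transpose_mat A))"
    using assms by (auto simp: det_def sign_def intro!: sum.cong)
  ultimately show ?thesis using det_transpose[OF assms] by simp
qed

text \<open>The adjugate quotient makes each entry a determinant over \<open>det M\<close>, so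
  continuity of inverses in a parameter reduces to that of determinants, and diagonal entries are
  quotients of principal minors.\<close>

definition minv :: "complex mat \<Rightarrow> complex mat" where
  "minv M = (1 / det M) \<cdot>\<^sub>m adj_mat M"

lemma minv:
  assumes "M \<in> carrier_mat n n" "det M \<noteq> 0"
  shows "minv M \<in> carrier_mat n n" "M * minv M = 1\<^sub>m n" "minv M * M = 1\<^sub>m n"
  using adj_mat[OF assms(1)] assms by (auto simp: minv_def mult_smult_distrib[of _ n n] mult_smult_assoc_mat[of _ n n])

lemma minv_unique:
  assumes "M \<in> carrier_mat n n" "X \<in> carrier_mat n n" "M * X = 1\<^sub>m n"
  shows "X = minv M"
proof -
  have "det M * det X = 1" using assms det_mult[of M n X] by simp
  hence d: "det M \<noteq> 0" by auto
  note m = minv[OF assms(1) d]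
  have "X = (minv M * M) * X" using m assms by simp
  also have "\<dots> = minv M" using m assms by (subst assoc_mult_mat[of _ n n _ n _ n]) auto
  finally show ?thesis .
qed

text \<open>Vectors are functions on \<open>nat\<close> of which only the first \<open>k\<close>
  values, one per column of \<open>T\<close>, count; padding and truncation then cost no carrier
  conditions.\<close>

definition mapply :: "nat \<Rightarrow> complex mat \<Rightarrow> (nat \<Rightarrow> complex) \<Rightarrow> nat \<Rightarrow> complex" where
  "mapply k T v i = (\<Sum>j<k. T $$ (i, j) * v j)"

definition hform :: "nat \<Rightarrow> complex mat \<Rightarrow> (nat \<Rightarrow> complex) \<Rightarrow> complex" where
  "hform N M v = (\<Sum>i<N. cnj (v i) * mapply N M v i)"

definition accr :: "nat \<Rightarrow> complex mat \<Rightarrow> bool" where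
  "accr N M \<longleftrightarrow> M \<in> carrier_mat N N \<and> (\<forall>v. (\<exists>i<N. v i \<noteq> 0) \<longrightarrow> 0 < Re (hform N M v))"

lemma accr_carrier: "accr N M \<Longrightarrow> M \<in> carrier_mat N N"
  by (simp add: accr_def)

lemma accrD: "accr N M \<Longrightarrow> i < N \<Longrightarrow> v i \<noteq> 0 \<Longrightarrow> 0 < Re (hform N M v)"
  by (auto simp: accr_def)

lemma mapply_cong: "(\<And>j. j < k \<Longrightarrow> v j = w j) \<Longrightarrow> mapply k T v i = mapply k T w i"
  by (auto simp: mapply_def)

lemma hform_cong: "(\<And>j. j < k \<Longrightarrow> v j = w j) \<Longrightarrow> hform k T v = hform k T w"
  using mapply_cong[of k v w] by (auto simp: hform_def)

lemma mapply_mult: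
  assumes "A \<in> carrier_mat n m" "B \<in> carrier_mat m k" "i < n"
  shows "mapply k (A * B) v i = mapply m A (mapply k B v) i"
proof -
  have "mapply k (A * B) v i = (\<Sum>j<k. \<Sum>l<m. A $$ (i, l) * B $$ (l, j) * v j)"
    unfolding mapply_def using assms
    by (intro sum.cong refl) (simp add: mult_mat_index[of A n m B k] sum_distrib_right del: index_mult_mat(1))
  also have "\<dots> = (\<Sum>l<m. \<Sum>j<k. A $$ (i, l) * B $$ (l, j) * v j)" by (rule sum.swap)
  finally show ?thesis by (simp add: mapply_def sum_distrib_left mult.assoc)
qed

lemma mapply_one: "i < n \<Longrightarrow> mapply n (1\<^sub>m n) v i = v i"
  by (simp add: mapply_def one_mat_def if_distrib[where f="\<lambda>x. x * _"] sum.delta cong: if_cong)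

text \<open>This is the form of \<open>M\<close> at T v. \<open>T\<close> may be rectangular, so
  compressions and changes of coordinates are both covered.\<close>

lemma hform_congruence:
  assumes "T \<in> carrier_mat N k" "M \<in> carrier_mat N N"
  shows "hform k (mat_adjoint T * M * T) v = hform N M (mapply k T v)"
proof -
  let ?w = "mapply k T v"
  have "hform k (mat_adjoint T * M * T) v = (\<Sum>i<k. cnj (v i) * mapply N (mat_adjoint T) (mapply N M ?w) i)"
    unfolding hform_def
  proof (intro sum.cong refl)
    fix i assume "i \<in> {..<k}"
    hence i: "i < k" by simp
    note c = mat_adjoint_carrier[OF assms(1)]
    have "mapply k (mat_adjoint T * M * T) v i = mapply N (mat_adjoint T * M) ?w i"
      by (rule mapply_mult[OF mult_carrier_mat[OF c assms(2)] assms(1) i])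
    also have "\<dots> = mapply N (mat_adjoint T) (mapply N M ?w) i"
      by (rule mapply_mult[OF c assms(2) i])
    finally show "cnj (v i) * mapply k (mat_adjoint T * M * T) v i
        = cnj (v i) * mapply N (mat_adjoint T) (mapply N M ?w) i" by simp
  qed
  also have "\<dots> = (\<Sum>i<k. \<Sum>j<N. cnj (v i) * cnj (T $$ (j, i)) * mapply N M ?w j)"
    unfolding mapply_def[of _ "mat_adjoint T"] using assms
    by (intro sum.cong refl) (auto simp: sum_distrib_left mult.assoc)
  also have "\<dots> = (\<Sum>j<N. \<Sum>i<k. cnj (v i) * cnj (T $$ (j, i)) * mapply N M ?w j)" by (rule sum.swap)
  also have "\<dots> = (\<Sum>j<N. cnj (?w j) * mapply N M ?w j)"
    by (intro sum.cong refl) (simp add: mapply_def[of _ T] sum_distrib_right mult.commute[of "cnj (v _)"])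
  finally show ?thesis by (simp add: hform_def)
qed

lemma accr_congruence:
  assumes "accr N M" "T \<in> carrier_mat N k"
    and inj: "\<And>v. (\<forall>i<N. mapply k T v i = 0) \<Longrightarrow> \<forall>i<k. v i = 0"
  shows "accr k (mat_adjoint T * M * T)"
  unfolding accr_def
proof safe
  show "mat_adjoint T * M * T \<in> carrier_mat k k" using assms accr_carrier by auto
  fix v i assume "i < k" "v i \<noteq> (0::complex)"
  then obtain l where "l < N" "mapply k T v l \<noteq> 0" using inj by metis
  thus "0 < Re (hform k (mat_adjoint T * M * T) v)"
    using accrD[where v="mapply k T v", OF assms(1)] hform_congruence[OF assms(2) accr_carrier[OF assms(1)]] by simp
qed

lemma hform_add:
  assumes "A \<in> carrier_mat N N" "B \<in> carrier_mat N N"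
  shows "hform N (A + B) v = hform N A v + hform N B v"
  using assms by (simp add: hform_def mapply_def algebra_simps sum.distrib)

lemma hform_smult:
  assumes "A \<in> carrier_mat N N"
  shows "hform N (c \<cdot>\<^sub>m A) v = c * hform N A v"
proof -
  have "mapply N (c \<cdot>\<^sub>m A) v i = c * mapply N A v i" if "i < N" for i
    using assms that by (simp add: mapply_def sum_distrib_left mult.assoc)
  thus ?thesis by (simp add: hform_def sum_distrib_left mult.left_commute)
qed

lemma accr_combination:
  assumes "accr N A" "accr N B" "0 \<le> a" "0 \<le> b" "0 < a + b"
  shows "accr N (complex_of_real a \<cdot>\<^sub>m A + complex_of_real b \<cdot>\<^sub>m B)"
  unfolding accr_def
proof safe
  note c = accr_carrier[OF assms(1)] accr_carrier[OF assms(2)]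
  show "complex_of_real a \<cdot>\<^sub>m A + complex_of_real b \<cdot>\<^sub>m B \<in> carrier_mat N N" using c by auto
  fix v i assume i: "i < N" "v i \<noteq> (0::complex)"
  have "0 < a * Re (hform N A v) + b * Re (hform N B v)"
    using accrD[where v=v, OF assms(1) i] accrD[where v=v, OF assms(2) i] assms(3-5)
    by (smt (verit) mult_nonneg_nonneg mult_pos_pos)
  thus "0 < Re (hform N (complex_of_real a \<cdot>\<^sub>m A + complex_of_real b \<cdot>\<^sub>m B) v)"
    using c by (simp add: hform_add hform_smult)
qed

text \<open>A kernel vector would make the quadratic form vanish.\<close>

lemma accr_det_nonzero:
  assumes "accr N M" shows "det M \<noteq> 0"
proof
  assume "det M = 0"
  then obtain v where v: "v \<in> carrier_vec N" "v \<noteq> 0\<^sub>v N" "M *\<^sub>v v = 0\<^sub>v N"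
    using det_0_iff_vec_prod_zero_field[OF accr_carrier[OF assms]] by blast
  have z: "mapply N M (vec_index v) i = 0" if "i < N" for i
  proof -
    have "mapply N M (vec_index v) i = vec_index (M *\<^sub>v v) i"
      using accr_carrier[OF assms] v(1) that
      by (auto simp: mapply_def scalar_prod_def lessThan_atLeast0 intro!: sum.cong)
    thus ?thesis using v(3) that by simp
  qed
  hence "hform N M (vec_index v) = 0" by (simp add: hform_def)
  moreover obtain i where "i < N" "vec_index v i \<noteq> 0"
    using v(1,2) eq_vecI[of v "0\<^sub>v N"] by auto
  ultimately show False using accrD[where v="vec_index v", OF assms] by force
qed

lemma hform_adjoint:
  assumes "M \<in> carrier_mat N N"
  shows "hform N (mat_adjoint M) v = cnj (hform N M v)"
proof -
  have "hform N (mat_adjoint M) v = (\<Sum>i<N. \<Sum>j<N. cnj (v i) * cnj (M $$ (j, i)) * v j)"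
    unfolding hform_def mapply_def using assms
    by (intro sum.cong refl) (auto simp: sum_distrib_left mult.assoc)
  also have "\<dots> = (\<Sum>j<N. \<Sum>i<N. cnj (v i) * cnj (M $$ (j, i)) * v j)" by (rule sum.swap)
  also have "\<dots> = cnj (hform N M v)"
    by (simp add: hform_def mapply_def sum_distrib_left mult_ac)
  finally show ?thesis .
qed

lemma accr_adjoint: "accr N M \<Longrightarrow> accr N (mat_adjoint M)"
  by (auto simp: accr_def hform_adjoint)

lemma mapply_inj_if_left_inverse:
  assumes "T \<in> carrier_mat N k" "S \<in> carrier_mat k N" "S * T = 1\<^sub>m k"
    and "\<forall>i<N. mapply k T v i = 0"
  shows "\<forall>i<k. v i = 0"
proof safe
  fix i assume i: "i < k"
  have "v i = mapply k (S * T) v i" using assms i by (simp add: mapply_one)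
  also have "\<dots> = mapply N S (mapply k T v) i" by (rule mapply_mult[OF assms(2,1) i])
  also have "\<dots> = 0" using assms(4) by (simp add: mapply_def[of _ S])
  finally show "v i = 0" .
qed

lemma accr_congruence':
  assumes "accr N M" "T \<in> carrier_mat N k" "S \<in> carrier_mat k N" "S * T = 1\<^sub>m k"
  shows "accr k (mat_adjoint T * M * T)"
  using accr_congruence[OF assms(1,2)] mapply_inj_if_left_inverse[OF assms(2-4)] by blast

text \<open>M^-1 = M^-H M^H M^-1 is a congruence of the adjoint, whose form is the complex conjugate
  of that of \<open>M\<close>.\<close>

lemma accr_minv:
  assumes "accr N M" shows "accr N (minv M)"
proof -
  note c = accr_carrier[OF assms]
  note m = minv[OF c accr_det_nonzero[OF assms]]
  have "mat_adjoint (minv M) * mat_adjoint M * minv M = mat_adjoint (M * minv M) * minv M"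
    using mat_adjoint_mult[OF c m(1)] by simp
  also have "\<dots> = minv M" using m by simp
  finally show ?thesis
    using accr_congruence'[OF accr_adjoint[OF assms] m(1) c m(2)] by simp
qed

section \<open>Leading principal blocks\<close>

definition lead :: "nat \<Rightarrow> 'a mat \<Rightarrow> 'a mat" where
  "lead k M = Matrix.mat k k (\<lambda>ij. M $$ ij)"

lemma lead_carrier [simp]: "lead k M \<in> carrier_mat k k"
  by (simp add: lead_def)

lemma lead_index [simp]: "i < k \<Longrightarrow> j < k \<Longrightarrow> lead k M $$ (i, j) = M $$ (i, j)"
  by (simp add: lead_def)

lemma lead_lead: "k \<le> l \<Longrightarrow> lead k (lead l M) = lead k M"
  by (rule eq_matI) (auto simp: lead_def)

lemma lead_full: "M \<in> carrier_mat N N \<Longrightarrow> lead N M = M"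
  by (rule eq_matI) (auto simp: lead_def)

lemma hform_lead:
  assumes "k \<le> N"
  shows "hform k (lead k M) v = hform N M (\<lambda>i. if i < k then v i else 0)"
proof -
  let ?w = "\<lambda>i. if i < k then v i else 0"
  have "mapply N M ?w i = mapply k (lead k M) v i" if "i < k" for i
    unfolding mapply_def using assms that
    by (intro sum.mono_neutral_cong_right) auto
  thus ?thesis unfolding hform_def using assms
    by (intro sum.mono_neutral_cong_left) auto
qed

lemma accr_lead:
  assumes "accr N M" "k \<le> N" shows "accr k (lead k M)"
  unfolding accr_def
proof safe
  fix v i assume "i < k" "v i \<noteq> (0::complex)"
  thus "0 < Re (hform k (lead k M) v)"
    using assms accrD[OF assms(1), of i "\<lambda>i. if i < k then v i else 0"]
    by (simp add: hform_lead)
qed simp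

section \<open>A continuous argument of the determinant\<close>

text \<open>Continuity is entrywise; the carrier condition is part of the notion because the matrix
  type leaves the size open.\<close>

definition mcont :: "nat \<Rightarrow> nat \<Rightarrow> 'a::topological_space set \<Rightarrow> ('a \<Rightarrow> complex mat) \<Rightarrow> bool" where
  "mcont n m S F \<longleftrightarrow> (\<forall>x\<in>S. F x \<in> carrier_mat n m) \<and>
     (\<forall>i<n. \<forall>j<m. continuous_on S (\<lambda>x. F x $$ (i, j)))"

lemma mcontI:
  assumes "\<And>x. x \<in> S \<Longrightarrow> F x \<in> carrier_mat n m"
    and "\<And>i j. i < n \<Longrightarrow> j < m \<Longrightarrow> continuous_on S (\<lambda>x. F x $$ (i, j))"
  shows "mcont n m S F"
  using assms by (auto simp: mcont_def)

lemma mcontD: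
  assumes "mcont n m S F"
  shows "\<And>x. x \<in> S \<Longrightarrow> F x \<in> carrier_mat n m"
    and "\<And>i j. i < n \<Longrightarrow> j < m \<Longrightarrow> continuous_on S (\<lambda>x. F x $$ (i, j))"
  using assms by (auto simp: mcont_def)

lemma mcont_const: "A \<in> carrier_mat n m \<Longrightarrow> mcont n m S (\<lambda>_. A)"
  by (auto simp: mcont_def)

lemma mcont_mult:
  assumes "mcont n m S F" "mcont m k S G"
  shows "mcont n k S (\<lambda>x. F x * G x)"
proof (rule mcontI)
  fix i j assume ij: "i < n" "j < k"
  have c: "continuous_on S (\<lambda>x. \<Sum>l<m. F x $$ (i, l) * G x $$ (l, j))"
    using ij mcontD(2)[OF assms(1)] mcontD(2)[OF assms(2)] by (intro continuous_intros) auto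
  have "(F x * G x) $$ (i, j) = (\<Sum>l<m. F x $$ (i, l) * G x $$ (l, j))" if "x \<in> S" for x
    using mult_mat_index[OF mcontD(1)[OF assms(1) that] mcontD(1)[OF assms(2) that] ij] .
  from continuous_on_cong[OF refl this, THEN iffD2, OF _ c]
  show "continuous_on S (\<lambda>x. (F x * G x) $$ (i, j))" by simp
qed (use mult_carrier_mat[OF mcontD(1)[OF assms(1)] mcontD(1)[OF assms(2)]] in auto)

lemma mcont_add:
  assumes "mcont n m S F" "mcont n m S G"
  shows "mcont n m S (\<lambda>x. F x + G x)"
proof (rule mcontI)
  fix i j assume ij: "i < n" "j < m"
  have c: "continuous_on S (\<lambda>x. F x $$ (i, j) + G x $$ (i, j))"
    using ij mcontD(2)[OF assms(1)] mcontD(2)[OF assms(2)] by (intro continuous_intros) auto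
  have "(F x + G x) $$ (i, j) = F x $$ (i, j) + G x $$ (i, j)" if "x \<in> S" for x
    using mcontD(1)[OF assms(1) that] mcontD(1)[OF assms(2) that] ij by simp
  from continuous_on_cong[OF refl this, THEN iffD2, OF _ c]
  show "continuous_on S (\<lambda>x. (F x + G x) $$ (i, j))" by simp
qed (use mcontD(1)[OF assms(1)] mcontD(1)[OF assms(2)] in auto)

lemma mcont_smult:
  assumes "continuous_on S c" "mcont n m S F"
  shows "mcont n m S (\<lambda>x. c x \<cdot>\<^sub>m F x)"
proof (rule mcontI)
  fix i j assume ij: "i < n" "j < m"
  have c: "continuous_on S (\<lambda>x. c x * F x $$ (i, j))"
    using ij mcontD(2)[OF assms(2)] assms(1) by (intro continuous_intros) auto
  have "(c x \<cdot>\<^sub>m F x) $$ (i, j) = c x * F x $$ (i, j)" if "x \<in> S" for x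
    using mcontD(1)[OF assms(2) that] ij by simp
  from continuous_on_cong[OF refl this, THEN iffD2, OF _ c]
  show "continuous_on S (\<lambda>x. (c x \<cdot>\<^sub>m F x) $$ (i, j))" by simp
qed (use mcontD(1)[OF assms(2)] in auto)

lemma mcont_mat_diag:
  assumes "\<And>i. i < n \<Longrightarrow> continuous_on S (\<lambda>x. f x i)"
  shows "mcont n n S (\<lambda>x. mat_diag n (f x))"
proof (rule mcontI)
  fix i j assume ij: "i < n" "j < n"
  show "continuous_on S (\<lambda>x. mat_diag n (f x) $$ (i, j))"
    using ij assms by (cases "i = j") (auto simp: mat_diag_def)
qed auto

lemma continuous_on_det:
  assumes "mcont n n S F"
  shows "continuous_on S (\<lambda>x. det (F x))"
proof -
  have c: "continuous_on S (\<lambda>x. \<Sum>p\<in>{p. p permutes {0..<n}}. signof p * (\<Prod>i = 0..<n. F x $$ (i, p i)))"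
    using mcontD(2)[OF assms] by (intro continuous_intros) (auto simp: permutes_in_image)
  from continuous_on_cong[OF refl det_def'[OF mcontD(1)[OF assms]], THEN iffD2, OF _ c]
  show ?thesis by simp
qed

lemma mcont_lead:
  assumes "mcont n n S F" "k \<le> n"
  shows "mcont k k S (\<lambda>x. lead k (F x))"
  using mcontD[OF assms(1)] assms(2) by (intro mcontI) auto

lemma hform_unit:
  assumes "k < N"
  shows "hform N M (\<lambda>i. if i = k then 1 else 0) = M $$ (k, k)"
proof -
  have "mapply N M (\<lambda>i. if i = k then 1 else 0) i = M $$ (i, k)" for i
    using assms by (simp add: mapply_def if_distrib[where f="\<lambda>x. _ * x"] sum.delta cong: if_cong)
  hence "hform N M (\<lambda>i. if i = k then 1 else 0) = (\<Sum>i<N. if i = k then M $$ (i, k) else 0)"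
    unfolding hform_def by (intro sum.cong) auto
  thus ?thesis using assms by simp
qed

text \<open>The quotient is a Schur complement, i.e. the inverse of the last diagonal entry of \<open>minv M\<close>.\<close>

lemma accr_minor_quotient:
  assumes "accr (Suc k) M"
  shows "0 < Re (det M / det (lead k M))"
proof -
  note c = accr_carrier[OF assms]
  have del: "mat_delete M k k = lead k M"
    using c by (intro eq_matI) (auto simp: mat_delete_def lead_def)
  have "minv M $$ (k, k) = det (lead k M) / det M"
    using c by (simp add: minv_def adj_mat_def cofactor_def del)
  moreover have "0 < Re (minv M $$ (k, k))"
    using accrD[OF accr_minv[OF assms], of k "\<lambda>i. if i = k then 1 else 0"] by (simp add: hform_unit)
  ultimately have "0 < Re (det (lead k M) / det M)" by simp
  \<comment> \<open>Inversion preserves the open right half-plane.\<close>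
  hence "0 < Re (inverse (det (lead k M) / det M))" by (simp add: Re_inverse sum_power2_gt_zero_iff del: inverse_divide)
  thus ?thesis by simp
qed

text \<open>A continuous branch of the argument of the determinant on the accretive matrices.\<close>

definition parg :: "nat \<Rightarrow> complex mat \<Rightarrow> real" where
  "parg N M = (\<Sum>k<N. Arg (det (lead (Suc k) M) / det (lead k M)))"

lemma accr_minor_quotient_lead:
  assumes "accr N M" "k < N"
  shows "0 < Re (det (lead (Suc k) M) / det (lead k M))"
  using accr_minor_quotient[OF accr_lead[OF assms(1)], of k] assms(2) by (simp add: lead_lead)

lemma det_lead_0 [simp]: "det (lead 0 M) = 1"
  by (simp add: lead_def)

text \<open>The quotients of successive leading minors telescope to the determinant;
  \<open>sgn\<close> discards the moduli.\<close>

lemma sgn_det_parg: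
  assumes "accr N M"
  shows "cis (parg N M) = sgn (det M)"
proof -
  have "cis (\<Sum>k<n. Arg (det (lead (Suc k) M) / det (lead k M))) = sgn (det (lead n M))" if "n \<le> N" for n
    using that
  proof (induction n)
    case (Suc n)
    have nz: "det (lead n M) \<noteq> 0" "det (lead (Suc n) M) \<noteq> 0"
      using accr_det_nonzero[OF accr_lead[OF assms]] Suc.prems by auto
    have "cis (\<Sum>k<Suc n. Arg (det (lead (Suc k) M) / det (lead k M)))
        = sgn (det (lead n M)) * sgn (det (lead (Suc n) M) / det (lead n M))"
      using Suc nz by (simp add: cis_mult[symmetric] cis_Arg)
    also have "\<dots> = sgn (det (lead (Suc n) M))" using nz by (simp add: sgn_divide sgn_eq_0_iff)
    finally show ?case .
  qed simp
  from this[of N] show ?thesis using lead_full[OF accr_carrier[OF assms]] by (simp add: parg_def)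
qed

text \<open>The minor quotients stay in the open right half-plane, away from the cut of
  \<open>Arg\<close>.\<close>

lemma continuous_on_parg:
  assumes "mcont N N S F" "\<And>x. x \<in> S \<Longrightarrow> accr N (F x)"
  shows "continuous_on S (\<lambda>x. parg N (F x))"
  unfolding parg_def
proof (intro continuous_on_sum)
  fix k assume "k \<in> {..<N}"
  hence k: "k < N" by simp
  have nz: "det (lead k (F x)) \<noteq> 0" if "x \<in> S" for x
    using accr_det_nonzero[OF accr_lead[OF assms(2)[OF that]]] k by simp
  have c: "continuous_on S (\<lambda>x. det (lead (Suc k) (F x)) / det (lead k (F x)))"
    using nz k by (intro continuous_on_divide continuous_on_det[OF mcont_lead[OF assms(1)]]) auto
  show "continuous_on S (\<lambda>x. Arg (det (lead (Suc k) (F x)) / det (lead k (F x))))"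
    using c
  proof (rule continuous_on_compose2[rotated])
    show "continuous_on {z. 0 < Re z} Arg"
      by (intro continuous_at_imp_continuous_on ballI continuous_at_Arg)
         (auto simp: complex_nonpos_Reals_iff)
  qed (use accr_minor_quotient_lead[OF assms(2) k] in auto)
qed

text \<open>The difference is continuous with values in the multiples of 2 pi, hence constant, and
  it vanishes at 0. This carries identities between arguments from one end of a homotopy to the
  other.\<close>

lemma continuous_cis_lifts_eq:
  fixes f g :: "real \<Rightarrow> real"
  assumes "continuous_on {0..1} f" "continuous_on {0..1} g"
    and eq: "\<And>s. s \<in> {0..1} \<Longrightarrow> cis (f s) = cis (g s)" and "f 0 = g 0"
  shows "f 1 = g 1"
proof -
  have ex: "\<exists>k::int. f s - g s = 2 * pi * k" if "s \<in> {0..1}" for s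
  proof -
    have "cis (f s - g s) = 1" using eq[OF that] by (simp flip: cis_divide)
    thus ?thesis using cos_one_2pi_int[of "f s - g s"] by (auto simp: complex_eq_iff)
  qed
  have "(\<lambda>s. f s - g s) constant_on {0..1}"
  proof (rule continuous_discrete_range_constant)
    fix s :: real assume s: "s \<in> {0..1}"
    show "\<exists>e>0. \<forall>y. y \<in> {0..1} \<and> f y - g y \<noteq> f s - g s \<longrightarrow> e \<le> norm (f y - g y - (f s - g s))"
    proof (intro exI[of _ "2 * pi"] conjI allI impI)
      fix y assume y: "y \<in> {0..1} \<and> f y - g y \<noteq> f s - g s"
      obtain k l :: int where kl: "f y - g y = 2 * pi * k" "f s - g s = 2 * pi * l" using ex s y by blast
      hence "k \<noteq> l" using y by auto
      hence "1 \<le> \<bar>real_of_int (k - l)\<bar>" by linarith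
      hence "2 * pi * 1 \<le> 2 * pi * \<bar>real_of_int (k - l)\<bar>" by (intro mult_left_mono) auto
      also have "\<dots> = \<bar>2 * pi * k - 2 * pi * l\<bar>" by (simp add: abs_mult flip: right_diff_distrib)
      finally show "2 * pi \<le> norm (f y - g y - (f s - g s))" by (simp add: kl)
    qed simp
  qed (use assms in \<open>auto intro!: continuous_intros\<close>)
  hence "f 1 - g 1 = f 0 - g 0" unfolding constant_on_def by (metis atLeastAtMost_iff order_refl zero_le_one)
  thus ?thesis using assms(4) by simp
qed

lemma lead_adjoint:
  fixes M :: "complex mat"
  assumes "M \<in> carrier_mat N N" "k \<le> N"
  shows "lead k (mat_adjoint M) = mat_adjoint (lead k M)"
proof (rule eq_matI)
  fix i j assume "i < dim_row (mat_adjoint (lead k M))" "j < dim_col (mat_adjoint (lead k M))"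
  hence "i < k" "j < k" by (auto simp: lead_def)
  thus "lead k (mat_adjoint M) $$ (i, j) = mat_adjoint (lead k M) $$ (i, j)"
    using assms by (simp add: lead_def)
qed (auto simp: lead_def)

text \<open>Minors of the adjoint are conjugate minors. The value pi of \<open>Arg\<close>, for
  which conjugation would not flip the sign, is excluded by the positive real parts.\<close>

lemma parg_adjoint:
  assumes "accr N M"
  shows "parg N (mat_adjoint M) = - parg N M"
  unfolding parg_def sum_negf[symmetric]
proof (intro sum.cong refl)
  fix k assume "k \<in> {..<N}"
  hence k: "k < N" by simp
  let ?z = "det (lead (Suc k) M) / det (lead k M)"
  have "det (lead (Suc k) (mat_adjoint M)) / det (lead k (mat_adjoint M)) = cnj ?z"
    using k by (simp add: lead_adjoint[OF accr_carrier[OF assms]] det_mat_adjoint[OF lead_carrier])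
  moreover have "Arg (cnj ?z) = - Arg ?z"
    using accr_minor_quotient_lead[OF assms k] by (subst Arg_cnj) (auto simp: complex_is_Real_iff Arg_eq_0)
  ultimately show "Arg (det (lead (Suc k) (mat_adjoint M)) / det (lead k (mat_adjoint M))) = - Arg ?z"
    by simp
qed

section \<open>Determinant arguments of unitary diagonal matrices and their congruences\<close>

lemma one_mult_diag [simp]: "1\<^sub>m N * mat_diag N d = mat_diag N d" for d :: "nat \<Rightarrow> complex"
  by (rule left_mult_one_mat[OF mat_diag_dim])

lemma diag_mult_one [simp]: "mat_diag N d * 1\<^sub>m N = mat_diag N d" for d :: "nat \<Rightarrow> complex"
  by (rule right_mult_one_mat[OF mat_diag_dim])

lemma mapply_diag: "i < N \<Longrightarrow> mapply N (mat_diag N d) v i = d i * v i"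
  by (simp add: mapply_def mat_diag_def if_distrib[where f="\<lambda>x. x * _"] sum.delta cong: if_cong)

lemma hform_diag: "hform N (mat_diag N d) v = (\<Sum>i<N. d i * (cmod (v i))\<^sup>2)"
  unfolding hform_def by (intro sum.cong refl) (simp add: mapply_diag complex_norm_square mult.left_commute mult.commute[of "cnj _"] del: of_real_power)

lemma accr_diag:
  assumes "\<And>i. i < N \<Longrightarrow> 0 < Re (d i)"
  shows "accr N (mat_diag N d)"
  unfolding accr_def
proof safe
  fix v i assume "i < N" "v i \<noteq> (0::complex)"
  hence "0 < (\<Sum>i<N. Re (d i) * (cmod (v i))\<^sup>2)"
    using assms by (intro sum_pos2[of _ i]) (auto intro!: mult_nonneg_nonneg less_imp_le[of 0 "Re _"])
  thus "0 < Re (hform N (mat_diag N d) v)" by (simp add: hform_diag flip: of_real_power)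
qed simp

lemma det_mat_diag: "det (mat_diag N d) = (\<Prod>i<N. d i)" for d :: "nat \<Rightarrow> complex"
proof -
  have "det (mat_diag N d) = prod_list (diag_mat (mat_diag N d))"
    by (rule det_upper_triangular) (auto simp: mat_diag_def)
  also have "\<dots> = (\<Prod>i<N. d i)"
    by (simp add: diag_mat_def mat_diag_def prod.list_conv_set_nth lessThan_atLeast0)
  finally show ?thesis .
qed

lemma det_phase_diag: "det (mat_diag N (\<lambda>k. cis (\<phi> k))) = cis (\<Sum>k<N. \<phi> k)"
  unfolding det_mat_diag by (induction N) (auto simp: cis_mult)

lemma cos_pos_of_abs: "\<bar>x\<bar> < pi / 2 \<Longrightarrow> 0 < cos x"
  by (rule cos_gt_zero_pi) linarith+

lemma accr_phase_congruence:
  assumes T: "T \<in> carrier_mat N N" "det T \<noteq> 0"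
    and \<phi>: "\<And>k. k < N \<Longrightarrow> \<bar>\<phi> k\<bar> < pi / 2"
  shows "accr N (mat_adjoint T * mat_diag N (\<lambda>k. cis (\<phi> k)) * T)"
  using minv[OF T] T \<phi>
  by (intro accr_congruence'[of N _ T N "minv T"] accr_diag) (auto intro!: cos_pos_of_abs)

text \<open>All phases are scaled by \<open>s\<close> from 0 to 1. Along the way the determinant is
  |det T|^2 times a unit number of argument \<open>s\<close> times the phase sum, so only the start
  at 0 remains to be compared.\<close>

lemma parg_phase_congruence:
  assumes T: "T \<in> carrier_mat N N" "det T \<noteq> 0"
    and \<phi>: "\<And>k. k < N \<Longrightarrow> \<bar>\<phi> k\<bar> < pi / 2"
  shows "parg N (mat_adjoint T * mat_diag N (\<lambda>k. cis (\<phi> k)) * T) = (\<Sum>k<N. \<phi> k)"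
proof -
  define F where "F s = mat_adjoint T * mat_diag N (\<lambda>k. cis (s * \<phi> k)) * T" for s :: real
  have acc: "accr N (F s)" if "s \<in> {0..1}" for s
    unfolding F_def
  proof (rule accr_phase_congruence[OF T])
    fix k assume k: "k < N"
    have "\<bar>s * \<phi> k\<bar> \<le> 1 * \<bar>\<phi> k\<bar>" unfolding abs_mult using that by (intro mult_right_mono) auto
    thus "\<bar>s * \<phi> k\<bar> < pi / 2" using \<phi>[OF k] by simp
  qed
  have "parg N (F 1) = 1 * (\<Sum>k<N. \<phi> k)"
  proof (rule continuous_cis_lifts_eq[where f = "\<lambda>s. parg N (F s)" and g = "\<lambda>s. s * (\<Sum>k<N. \<phi> k)"])
    have "mcont N N {0..1} F" unfolding F_def using T
      by (intro mcont_mult[of N N] mcont_const mcont_mat_diag mat_adjoint_carrier)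
         (auto simp: cis_conv_exp intro!: continuous_intros)
    thus "continuous_on {0..1} (\<lambda>s. parg N (F s))" by (rule continuous_on_parg) (rule acc)
    fix s :: real assume s: "s \<in> {0..1}"
    have "det (F s) = cnj (det T) * cis (\<Sum>k<N. s * \<phi> k) * det T"
      unfolding F_def using T
      by (simp add: det_mult[of _ N] mult_carrier_mat[of _ N N _ N] det_mat_adjoint[of _ N] det_phase_diag)
    also have "\<dots> = (cmod (det T))\<^sup>2 * cis (s * (\<Sum>k<N. \<phi> k))"
      by (simp add: complex_norm_square sum_distrib_left mult_ac del: of_real_power)
    finally have "sgn (det (F s)) = cis (s * (\<Sum>k<N. \<phi> k))"
      using T(2) by (simp add: sgn_mult sgn_of_real flip: of_real_power)
    thus "cis (parg N (F s)) = cis (s * (\<Sum>k<N. \<phi> k))" by (simp add: sgn_det_parg[OF acc[OF s]])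
  next
    \<comment> \<open>At 0 the matrix is Hermitian, so \<open>parg_adjoint\<close> forces its
      \<open>parg\<close> to equal its own negative.\<close>
    have F0: "F 0 = mat_adjoint T * T" unfolding F_def using T by simp
    have "mat_adjoint (F 0) = F 0" unfolding F0 using T
      by (subst mat_adjoint_mult[of _ N N _ N]) auto
    thus "parg N (F 0) = 0 * (\<Sum>k<N. \<phi> k)" using parg_adjoint[OF acc[of 0]] by simp
  qed (intro continuous_intros)
  thus ?thesis by (simp add: F_def)
qed

lemma parg_phase_diag:
  assumes "\<And>k. k < N \<Longrightarrow> \<bar>\<phi> k\<bar> < pi / 2"
  shows "parg N (mat_diag N (\<lambda>k. cis (\<phi> k))) = (\<Sum>k<N. \<phi> k)"
  using parg_phase_congruence[of "1\<^sub>m N" N \<phi>] assms by simp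

lemma mult_combination_mult:
  fixes X Y E C :: "complex mat"
  assumes X: "X \<in> carrier_mat N N" and E: "E \<in> carrier_mat N N"
    and C: "C \<in> carrier_mat N N" and Y: "Y \<in> carrier_mat N N"
  shows "X * (a \<cdot>\<^sub>m E + b \<cdot>\<^sub>m C) * Y = a \<cdot>\<^sub>m (X * E * Y) + b \<cdot>\<^sub>m (X * C * Y)"
proof -
  note XE = mult_carrier_mat[OF X E] and XC = mult_carrier_mat[OF X C]
  have "X * (a \<cdot>\<^sub>m E + b \<cdot>\<^sub>m C) = a \<cdot>\<^sub>m (X * E) + b \<cdot>\<^sub>m (X * C)"
    using mult_add_distrib_mat[OF X smult_carrier_mat[OF E] smult_carrier_mat[OF C]]
    by (simp add: mult_smult_distrib[OF X E] mult_smult_distrib[OF X C])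
  thus ?thesis
    using add_mult_distrib_mat[OF smult_carrier_mat[OF XE] smult_carrier_mat[OF XC] Y]
    by (simp add: mult_smult_assoc_mat[OF XE Y] mult_smult_assoc_mat[OF XC Y])
qed

text \<open>Both sides are arguments of the same determinant; that they belong to the same branch is
  seen by moving \<open>C\<close> along a segment to \<open>D\<^sup>-\<^sup>1\<close>, where \<open>D C D\<close> becomes \<open>D\<close>.\<close>

lemma parg_diag_scaling:
  assumes \<theta>: "\<And>k. k < N \<Longrightarrow> \<bar>\<theta> k\<bar> < pi / 2"
    and D: "D = mat_diag N (\<lambda>k. cis (\<theta> k))"
    and acc: "accr N C" "accr N (D * C * D)"
  shows "parg N (D * C * D) = 2 * (\<Sum>k<N. \<theta> k) + parg N C"
proof -
  define E where "E = mat_diag N (\<lambda>k. cis (- \<theta> k))"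
  define F where "F s = complex_of_real (1 - s) \<cdot>\<^sub>m E + complex_of_real s \<cdot>\<^sub>m C" for s :: real
  note C = accr_carrier[OF acc(1)]
  have DE: "D \<in> carrier_mat N N" "E \<in> carrier_mat N N" by (auto simp: D E_def)
  have F: "F s \<in> carrier_mat N N" for s unfolding F_def using C DE by auto
  have "accr N E" "accr N D"
    unfolding D E_def using \<theta> by (auto intro!: accr_diag cos_pos_of_abs)
  note a = accr_combination[OF \<open>accr N E\<close> acc(1)] accr_combination[OF \<open>accr N D\<close> acc(2)]
  have acc1: "accr N (F s)" if "s \<in> {0..1}" for s using a(1)[of "1 - s" s] that by (simp add: F_def)
  \<comment> \<open>\<open>E\<close> is the inverse of \<open>D\<close>; hence the segment from
    \<open>E\<close> to \<open>C\<close> is carried to the segment from \<open>D\<close> to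
    \<open>D * C * D\<close>, and both lie in the accretive cone.\<close>
  have "D * E * D = D" by (simp add: D E_def cis_mult)
  hence DFD: "D * F s * D = complex_of_real (1 - s) \<cdot>\<^sub>m D + complex_of_real s \<cdot>\<^sub>m (D * C * D)" for s
    unfolding F_def using mult_combination_mult[OF DE(1,2) C DE(1)] by simp
  have acc2: "accr N (D * F s * D)" if "s \<in> {0..1}" for s
    unfolding DFD using a(2)[of "1 - s" s] that by simp
  have mF: "mcont N N {0..1} F" unfolding F_def using C DE
    by (intro mcont_add mcont_smult mcont_const continuous_intros) auto
  have "parg N (D * F 1 * D) = 2 * (\<Sum>k<N. \<theta> k) + parg N (F 1)"
  proof (rule continuous_cis_lifts_eq[where f = "\<lambda>s. parg N (D * F s * D)"
        and g = "\<lambda>s. 2 * (\<Sum>k<N. \<theta> k) + parg N (F s)"])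
    show "continuous_on {0..1} (\<lambda>s. parg N (D * F s * D))"
      by (intro continuous_on_parg acc2 mcont_mult[OF mcont_mult[OF mcont_const[OF DE(1)] mF] mcont_const[OF DE(1)]])
    show "continuous_on {0..1} (\<lambda>s. 2 * (\<Sum>k<N. \<theta> k) + parg N (F s))"
      by (intro continuous_intros continuous_on_parg mF acc1)
    fix s :: real assume s: "s \<in> {0..1}"
    have "det D = cis (\<Sum>k<N. \<theta> k)" by (simp add: D det_phase_diag)
    hence "sgn (det (D * F s * D)) = cis (\<Sum>k<N. \<theta> k) * sgn (det (F s)) * cis (\<Sum>k<N. \<theta> k)"
      using DE F[of s] by (simp add: det_mult[of _ N] sgn_mult)
    thus "cis (parg N (D * F s * D)) = cis (2 * (\<Sum>k<N. \<theta> k) + parg N (F s))"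
      by (simp add: sgn_det_parg[OF acc1[OF s]] sgn_det_parg[OF acc2[OF s]] mult_ac flip: cis_mult)
         (simp add: cis_mult flip: mult.assoc)
  next
    \<comment> \<open>At the start the identity reads S = 2 S - S, where S is the sum of the
      \<open>\<theta> k\<close>.\<close>
    have "F 0 = E" unfolding F_def using C DE by (intro eq_matI) auto
    moreover have "parg N E = (\<Sum>k<N. - \<theta> k)" unfolding E_def by (rule parg_phase_diag) (use \<theta> in auto)
    moreover have "parg N D = (\<Sum>k<N. \<theta> k)" unfolding D by (rule parg_phase_diag) (use \<theta> in auto)
    ultimately show "parg N (D * F 0 * D) = 2 * (\<Sum>k<N. \<theta> k) + parg N (F 0)"
      using \<open>D * E * D = D\<close> by (simp add: sum_negf)
  qed
  moreover have "F 1 = C" unfolding F_def using C DE by (intro eq_matI) auto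
  ultimately show ?thesis by simp
qed

section \<open>Canonical phases and interlacing\<close>

lemma congruence_diag_index:
  assumes "T \<in> carrier_mat N k" "i < k" "j < k"
  shows "(mat_adjoint T * mat_diag N d * T) $$ (i, j) = (\<Sum>l<N. cnj (T $$ (l, i)) * d l * T $$ (l, j))"
proof -
  have "(mat_adjoint T * mat_diag N d) = Matrix.mat k N (\<lambda>(i, l). cnj (T $$ (l, i)) * d l)"
    using assms by (subst mat_diag_mult_right[of _ k]) (auto intro!: eq_matI)
  thus ?thesis using assms by (subst mult_mat_index[of _ k N _ k]) auto
qed

lemma congruence_eqI:
  assumes "M \<in> carrier_mat k k" "T \<in> carrier_mat N k"
    and "\<And>i j. i < k \<Longrightarrow> j < k \<Longrightarrow> M $$ (i, j) = (\<Sum>l<N. cnj (T $$ (l, i)) * d l * T $$ (l, j))"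
  shows "M = mat_adjoint T * mat_diag N d * T"
  using assms by (intro eq_matI) (auto simp: congruence_diag_index simp del: index_mult_mat(1))

lemma congruence_congruence:
  fixes T P :: "complex mat"
  assumes "T \<in> carrier_mat N m" "P \<in> carrier_mat m k" "M \<in> carrier_mat N N"
  shows "mat_adjoint P * (mat_adjoint T * M * T) * P = mat_adjoint (T * P) * M * (T * P)"
proof -
  note a = mat_adjoint_carrier[OF assms(1)] mat_adjoint_carrier[OF assms(2)]
  note b = mult_carrier_mat[OF a(1) assms(3)]
  note c = mult_carrier_mat[OF b assms(1)]
  have "mat_adjoint P * (mat_adjoint T * M * T) * P = mat_adjoint P * ((mat_adjoint T * M) * (T * P))"
    by (simp add: assoc_mult_mat[OF a(2) c assms(2)] assoc_mult_mat[OF b assms(1,2)])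
  also have "\<dots> = (mat_adjoint P * (mat_adjoint T * M)) * (T * P)"
    by (rule assoc_mult_mat[OF a(2) b mult_carrier_mat[OF assms(1,2)], symmetric])
  also have "mat_adjoint P * (mat_adjoint T * M) = (mat_adjoint P * mat_adjoint T) * M"
    by (rule assoc_mult_mat[OF a(2) a(1) assms(3), symmetric])
  also have "mat_adjoint P * mat_adjoint T = mat_adjoint (T * P)"
    by (rule mat_adjoint_mult[OF assms(1,2), symmetric])
  finally show ?thesis .
qed

lemma mapply_scale: "mapply n M (\<lambda>i. c * v i) i = c * mapply n M v i"
  by (simp add: mapply_def sum_distrib_left mult_ac)

lemma mapply_unit: "k < n \<Longrightarrow> mapply n M (\<lambda>i. if i = k then 1 else 0) i = M $$ (i, k)"
  by (simp add: mapply_def if_distrib[where f="\<lambda>x. _ * x"] sum.delta cong: if_cong)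

lemma accr_diag_entry: "accr N M \<Longrightarrow> k < N \<Longrightarrow> 0 < Re (M $$ (k, k))"
  using accrD[of N M k "\<lambda>i. if i = k then 1 else 0"] by (simp add: hform_unit)

text \<open>\<open>v\<close> is an eigenvector of M^-H M. In a basis starting with \<open>v\<close>
  the first column of the matrix is \<open>\<mu>\<close> times the conjugate of its first row, which
  allows elimination by a congruence.\<close>

lemma accr_adjoint_eigenvector:
  assumes "accr N M" "0 < N"
  obtains \<mu> v j where "j < N" "v j \<noteq> (0::complex)"
    "\<And>i. i < N \<Longrightarrow> mapply N M v i = \<mu> * mapply N (mat_adjoint M) v i"
proof -
  note c = accr_carrier[OF assms(1)]
  note cH = mat_adjoint_carrier[OF c]
  note m = minv[OF cH accr_det_nonzero[OF accr_adjoint[OF assms(1)]]]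
  define X where "X = minv (mat_adjoint M) * M"
  have X: "X \<in> carrier_mat N N" unfolding X_def by (rule mult_carrier_mat[OF m(1) c])
  have MX: "mat_adjoint M * X = M"
    unfolding X_def using assoc_mult_mat[OF cH m(1) c] m(2) c by simp
  obtain \<mu> where "eigenvalue X \<mu>"
    using spectrum_non_empty[OF X assms(2)] by (auto simp: spectrum_def)
  then obtain w where w: "w \<in> carrier_vec N" "w \<noteq> 0\<^sub>v N" "X *\<^sub>v w = \<mu> \<cdot>\<^sub>v w"
    using X by (auto simp: eigenvalue_def eigenvector_def)
  have Xw: "mapply N X (vec_index w) i = \<mu> * vec_index w i" if "i < N" for i
  proof -
    have "mapply N X (vec_index w) i = vec_index (X *\<^sub>v w) i"
      using X w(1) that by (auto simp: mapply_def scalar_prod_def lessThan_atLeast0 intro!: sum.cong)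
    thus ?thesis using w that by simp
  qed
  obtain j where j: "j < N" "vec_index w j \<noteq> 0" using w(1,2) eq_vecI[of w "0\<^sub>v N"] by auto
  show thesis
  proof (rule that[of j "vec_index w" \<mu>])
    fix i assume "i < N"
    hence "mapply N M (vec_index w) i = mapply N (mat_adjoint M) (mapply N X (vec_index w)) i"
      using mapply_mult[OF cH X, of i "vec_index w"] MX by simp
    also have "\<dots> = mapply N (mat_adjoint M) (\<lambda>i. \<mu> * vec_index w i) i"
      by (rule mapply_cong) (rule Xw)
    finally show "mapply N M (vec_index w) i = \<mu> * mapply N (mat_adjoint M) (vec_index w) i"
      by (simp add: mapply_def sum_distrib_left mult_ac)
  qed (use j in auto)
qed

text \<open>The \<open>j\<close>-th unit vector, at a position where \<open>v\<close> does not
  vanish, is exchanged for \<open>v\<close>; the standard basis remains a basis.\<close>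

lemma completion_matrix:
  assumes "j < Suc N" "v j \<noteq> (0::complex)"
  obtains P where "P \<in> carrier_mat (Suc N) (Suc N)" "\<And>i. i < Suc N \<Longrightarrow> P $$ (i, 0) = v i"
    "\<And>x. (\<forall>i<Suc N. mapply (Suc N) P x i = 0) \<Longrightarrow> \<forall>i<Suc N. x i = 0"
proof -
  \<comment> \<open>\<open>\<sigma>\<close> enumerates the indices other than \<open>j\<close>;
    column 0 of \<open>P\<close> will be \<open>v\<close>, column c + 1 the unit vector with index
    \<open>\<sigma> c\<close>.\<close>
  define \<sigma> where "\<sigma> c = (if c < j then c else Suc c)" for c
  define P where "P = Matrix.mat (Suc N) (Suc N)
    (\<lambda>(i, c). case c of 0 \<Rightarrow> v i | Suc c \<Rightarrow> if i = \<sigma> c then 1 else 0)"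
  have app: "mapply (Suc N) P x i = v i * x 0 + (\<Sum>c<N. if i = \<sigma> c then x (Suc c) else 0)"
    if "i < Suc N" for x i
  proof -
    have "mapply (Suc N) P x i = P $$ (i, 0) * x 0 + (\<Sum>c<N. P $$ (i, Suc c) * x (Suc c))"
      unfolding mapply_def by (rule sum.lessThan_Suc_shift)
    also have "P $$ (i, 0) = v i" using that by (simp add: P_def)
    also have "(\<Sum>c<N. P $$ (i, Suc c) * x (Suc c)) = (\<Sum>c<N. if i = \<sigma> c then x (Suc c) else 0)"
      using that by (intro sum.cong) (auto simp: P_def)
    finally show ?thesis .
  qed
  show thesis
  proof (rule that[of P])
    fix x assume z: "\<forall>i<Suc N. mapply (Suc N) P x i = 0"
    have "(\<Sum>c<N. if j = \<sigma> c then x (Suc c) else 0) = 0"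
      by (intro sum.neutral) (auto simp: \<sigma>_def)
    hence x0: "x 0 = 0" using z app[OF assms(1), of x] assms by simp
    have "x (Suc c) = 0" if c: "c < N" for c
    proof -
      have s: "\<sigma> c < Suc N" using c by (simp add: \<sigma>_def)
      have inj: "\<sigma> c = \<sigma> c' \<longleftrightarrow> c' = c" for c' by (auto simp: \<sigma>_def split: if_splits)
      have "(\<Sum>c'<N. if \<sigma> c = \<sigma> c' then x (Suc c') else 0) = x (Suc c)"
        unfolding inj using c by simp
      thus ?thesis using z app[OF s, of x] s x0 by simp
    qed
    thus "\<forall>i<Suc N. x i = 0" using x0 by (metis less_Suc_eq_0_disj)
  qed (auto simp: P_def)
qed

text \<open>Block elimination as for Hermitian matrices. In general the row and column to be
  eliminated are not adjoint to each other, so one congruence cannot clear both; a basis starting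
  with a vector from \<open>accr_adjoint_eigenvector\<close> makes them adjoint after division by
  the corner entry.\<close>

lemma accr_congruent_diag:
  "accr N M \<Longrightarrow> \<exists>T d. T \<in> carrier_mat N N \<and> M = mat_adjoint T * mat_diag N d * T"
proof (induction N arbitrary: M)
  case 0
  show ?case
    by (rule exI[of _ "1\<^sub>m 0"], rule exI[of _ "\<lambda>_. 0"]) (use accr_carrier[OF 0] in \<open>auto intro!: eq_matI simp: mat_diag_def\<close>)
next
  case (Suc N)
  let ?n = "Suc N"
  note cM = accr_carrier[OF Suc.prems]
  obtain \<mu> v j where v: "j < ?n" "v j \<noteq> 0"
    "\<And>i. i < ?n \<Longrightarrow> mapply ?n M v i = \<mu> * mapply ?n (mat_adjoint M) v i"
    using accr_adjoint_eigenvector[OF Suc.prems zero_less_Suc] by metis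
  obtain P where P: "P \<in> carrier_mat ?n ?n" "\<And>i. i < ?n \<Longrightarrow> P $$ (i, 0) = v i"
    "\<And>x. (\<forall>i<?n. mapply ?n P x i = 0) \<Longrightarrow> \<forall>i<?n. x i = 0"
    using completion_matrix[where v=v, OF v(1,2)] by metis
  define M1 where "M1 = mat_adjoint P * M * P"
  have acc1: "accr ?n M1" unfolding M1_def by (rule accr_congruence[OF Suc.prems P(1,3)])
  note PH = mat_adjoint_carrier[OF P(1)]
  note c1 = accr_carrier[OF acc1]
  have detP: "det P \<noteq> 0"
    using accr_det_nonzero[OF acc1] det_mult[OF mult_carrier_mat[OF PH cM] P(1)] unfolding M1_def by auto
  let ?e = "\<lambda>i. if i = 0 then 1 else 0 :: complex"
  have col0: "(mat_adjoint P * X * P) $$ (i, 0) = mapply ?n (mat_adjoint P) (mapply ?n X v) i"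
    if "i < ?n" "X \<in> carrier_mat ?n ?n" for i X
  proof -
    have "(mat_adjoint P * X * P) $$ (i, 0) = mapply ?n (mat_adjoint P * X * P) ?e i"
      by (rule mapply_unit[symmetric]) simp
    also have "\<dots> = mapply ?n (mat_adjoint P * X) (mapply ?n P ?e) i"
      by (rule mapply_mult[OF mult_carrier_mat[OF PH that(2)] P(1) that(1)])
    also have "\<dots> = mapply ?n (mat_adjoint P * X) v i"
      by (rule mapply_cong) (simp add: mapply_unit P(2))
    also have "\<dots> = mapply ?n (mat_adjoint P) (mapply ?n X v) i"
      by (rule mapply_mult[OF PH that(2,1)])
    finally show ?thesis .
  qed
  have adj1: "mat_adjoint M1 = mat_adjoint P * mat_adjoint M * P"
    unfolding M1_def using mat_adjoint_mult[OF mult_carrier_mat[OF PH cM] P(1)] mat_adjoint_mult[OF PH cM]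
      assoc_mult_mat[OF PH mat_adjoint_carrier[OF cM] P(1)] by simp
  have sym: "M1 $$ (i, 0) = \<mu> * cnj (M1 $$ (0, i))" if i: "i < ?n" for i
  proof -
    have "M1 $$ (i, 0) = mapply ?n (mat_adjoint P) (mapply ?n M v) i"
      unfolding M1_def by (rule col0[OF i cM])
    also have "\<dots> = mapply ?n (mat_adjoint P) (\<lambda>i. \<mu> * mapply ?n (mat_adjoint M) v i) i"
      by (rule mapply_cong) (rule v(3))
    also have "\<dots> = \<mu> * mapply ?n (mat_adjoint P) (mapply ?n (mat_adjoint M) v) i"
      by (rule mapply_scale)
    also have "\<dots> = \<mu> * mat_adjoint M1 $$ (i, 0)"
      unfolding adj1 col0[OF i mat_adjoint_carrier[OF cM]] ..
    finally show ?thesis using c1 i by simp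
  qed
  define a where "a = M1 $$ (0, 0)"
  have a0: "a \<noteq> 0" using accr_diag_entry[OF acc1, of 0] by (auto simp: a_def)
  have amu: "a = \<mu> * cnj a" using sym[of 0] by (simp add: a_def)
  \<comment> \<open>Because \<open>a = \<mu> * cnj a\<close>, the factor \<open>\<mu>\<close>
    cancels: the normalized first column is the conjugate of the normalized first row.\<close>
  have quot: "cnj (M1 $$ (0, i) / a) = M1 $$ (i, 0) / a" if "i < ?n" for i
  proof -
    have "\<mu> \<noteq> 0" using amu a0 by auto
    thus ?thesis using sym[OF that] amu a0
      by (metis complex_cnj_divide mult_divide_mult_cancel_left)
  qed
  define D where "D = Matrix.mat N N
    (\<lambda>(i, j). M1 $$ (Suc i, Suc j) - M1 $$ (Suc i, 0) * M1 $$ (0, Suc j) / a)"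
  have "accr N D"
    unfolding accr_def
  proof safe
    show "D \<in> carrier_mat N N" by (simp add: D_def)
    fix w i assume wi: "i < N" "w i \<noteq> (0::complex)"
    define t where "t = (\<Sum>j<N. M1 $$ (0, Suc j) * w j)"
    \<comment> \<open>The first coordinate is chosen so that the first component of
      \<open>M1\<close> applied to \<open>u\<close> vanishes; the form of \<open>M1\<close> at
      \<open>u\<close> is then the form of the Schur complement \<open>D\<close> at
      \<open>w\<close>.\<close>
    define u where "u i = (case i of 0 \<Rightarrow> - t / a | Suc i \<Rightarrow> w i)" for i
    have app: "mapply ?n M1 u i = M1 $$ (i, 0) * (- t / a) + (\<Sum>j<N. M1 $$ (i, Suc j) * w j)" for i
      unfolding mapply_def by (subst sum.lessThan_Suc_shift) (simp add: u_def)
    have "mapply ?n M1 u 0 = 0" using a0 by (simp add: app a_def[symmetric] t_def[symmetric])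
    moreover have "mapply ?n M1 u (Suc i) = mapply N D w i" if "i < N" for i
      using that unfolding app mapply_def[of N] t_def
      by (simp add: D_def algebra_simps sum_subtractf sum_distrib_left sum_divide_distrib)
    ultimately have "hform ?n M1 u = hform N D w"
      unfolding hform_def by (subst sum.lessThan_Suc_shift) (simp add: u_def)
    thus "0 < Re (hform N D w)" using accrD[OF acc1, of "Suc i" u] wi by (simp add: u_def)
  qed
  from Suc.IH[OF this] obtain T' d' where T': "T' \<in> carrier_mat N N"
    "D = mat_adjoint T' * mat_diag N d' * T'" by auto
  define T1 where "T1 = Matrix.mat ?n ?n (\<lambda>(i, j). case i of 0 \<Rightarrow> M1 $$ (0, j) / a
     | Suc i \<Rightarrow> (case j of 0 \<Rightarrow> 0 | Suc j \<Rightarrow> T' $$ (i, j)))"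
  define d where "d i = (case i of 0 \<Rightarrow> a | Suc i \<Rightarrow> d' i)" for i
  have T1: "T1 \<in> carrier_mat ?n ?n" by (simp add: T1_def)
  have M1: "M1 = mat_adjoint T1 * mat_diag ?n d * T1"
  proof (rule congruence_eqI[OF c1 T1])
    fix i j assume ij: "i < ?n" "j < ?n"
    have "(\<Sum>l<?n. cnj (T1 $$ (l, i)) * d l * T1 $$ (l, j))
       = cnj (T1 $$ (0, i)) * d 0 * T1 $$ (0, j) + (\<Sum>l<N. cnj (T1 $$ (Suc l, i)) * d (Suc l) * T1 $$ (Suc l, j))"
      by (rule sum.lessThan_Suc_shift)
    also have "cnj (T1 $$ (0, i)) * d 0 * T1 $$ (0, j) = M1 $$ (i, 0) * M1 $$ (0, j) / a"
      using ij a0 quot[OF ij(1)] by (simp add: T1_def d_def)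
    also have "(\<Sum>l<N. cnj (T1 $$ (Suc l, i)) * d (Suc l) * T1 $$ (Suc l, j))
       = M1 $$ (i, j) - M1 $$ (i, 0) * M1 $$ (0, j) / a"
    proof (cases "i = 0 \<or> j = 0")
      case True
      hence "(\<Sum>l<N. cnj (T1 $$ (Suc l, i)) * d (Suc l) * T1 $$ (Suc l, j)) = 0"
        using ij by (intro sum.neutral) (auto simp: T1_def)
      thus ?thesis using True a0 by (auto simp: a_def)
    next
      case False
      then obtain i' j' where s: "i = Suc i'" "j = Suc j'" by (meson not0_implies_Suc)
      hence ij': "i' < N" "j' < N" using ij by auto
      have "(\<Sum>l<N. cnj (T1 $$ (Suc l, i)) * d (Suc l) * T1 $$ (Suc l, j))
         = (\<Sum>l<N. cnj (T' $$ (l, i')) * d' l * T' $$ (l, j'))"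
        using ij' unfolding s by (intro sum.cong) (auto simp: T1_def d_def)
      also have "\<dots> = D $$ (i', j')" unfolding T'(2) by (rule congruence_diag_index[OF T'(1) ij', symmetric])
      finally show ?thesis using ij' by (simp add: D_def s)
    qed
    finally show "M1 $$ (i, j) = (\<Sum>l<?n. cnj (T1 $$ (l, i)) * d l * T1 $$ (l, j))" by simp
  qed
  note S = minv[OF P(1) detP]
  have "M = mat_adjoint (P * minv P) * M * (P * minv P)" using S cM by simp
  also have "\<dots> = mat_adjoint (minv P) * M1 * minv P"
    unfolding M1_def by (rule congruence_congruence[OF P(1) S(1) cM, symmetric])
  also have "\<dots> = mat_adjoint (T1 * minv P) * mat_diag ?n d * (T1 * minv P)"
    unfolding M1 by (rule congruence_congruence[OF T1 S(1) mat_diag_dim])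
  finally show ?case using mult_carrier_mat[OF T1 S(1)] by blast
qed

section \<open>Existence, interlacing and uniqueness of canonical phases\<close>

lemma sorting_bijection:
  fixes f :: "nat \<Rightarrow> 'a :: linorder"
  obtains \<pi> where "bij_betw \<pi> {..<N} {..<N}" "\<And>k l. k \<le> l \<Longrightarrow> l < N \<Longrightarrow> f (\<pi> l) \<le> f (\<pi> k)"
proof -
  define xs where "xs = rev (sort_key f [0..<N])"
  have "bij_betw ((!) xs) {..<N} {..<N}"
    by (rule bij_betw_nth) (auto simp: xs_def)
  moreover have "sorted (map f (sort_key f [0..<N]))" by simp
  hence "f (xs ! l) \<le> f (xs ! k)" if "k \<le> l" "l < N" for k l
    using that sorted_nth_mono[of "map f (sort_key f [0..<N])" "N - Suc l" "N - Suc k"]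
    by (simp add: xs_def rev_nth)
  ultimately show thesis using that by blast
qed

text \<open>Phases are confined to (-pi/2, pi/2), the range that belongs to accretive
  \<open>M\<close>; for such \<open>M\<close> the matrix \<open>T\<close> is nonsingular by
  \<open>canonical_phases_det\<close>.\<close>

definition canonical_phases :: "nat \<Rightarrow> complex mat \<Rightarrow> complex mat \<Rightarrow> (nat \<Rightarrow> real) \<Rightarrow> bool" where
  "canonical_phases N M T \<phi> \<longleftrightarrow> T \<in> carrier_mat N N \<and>
     (\<forall>k<N. \<bar>\<phi> k\<bar> < pi / 2) \<and> (\<forall>k l. k \<le> l \<and> l < N \<longrightarrow> \<phi> l \<le> \<phi> k) \<and>
     M = mat_adjoint T * mat_diag N (\<lambda>k. cis (\<phi> k)) * T"

lemma congruence_factor_det: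
  fixes T :: "complex mat"
  assumes "T \<in> carrier_mat N N" "E \<in> carrier_mat N N" "det (mat_adjoint T * E * T) \<noteq> 0"
  shows "det T \<noteq> 0"
  using assms(3) det_mult[OF mult_carrier_mat[OF mat_adjoint_carrier[OF assms(1)] assms(2)] assms(1)]
  by auto

lemma congruence_cancel:
  fixes T S E :: "complex mat"
  assumes "T \<in> carrier_mat N N" "S \<in> carrier_mat N N" "T * S = 1\<^sub>m N" "E \<in> carrier_mat N N"
  shows "mat_adjoint S * (mat_adjoint T * E * T) * S = E"
  using congruence_congruence[OF assms(1,2,4)] assms(3,4) by simp

lemma canonical_phases_exist:
  assumes "accr N M"
  obtains T \<phi> where "canonical_phases N M T \<phi>"
proof -
  obtain T d where T: "T \<in> carrier_mat N N" and M: "M = mat_adjoint T * mat_diag N d * T"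
    using accr_congruent_diag[OF assms] by blast
  have detT: "det T \<noteq> 0"
    using congruence_factor_det[OF T mat_diag_dim] accr_det_nonzero[OF assms] unfolding M by blast
  note S = minv[OF T detT]
  \<comment> \<open>Undoing the congruence shows that the diagonal matrix is itself accretive, so
    its entries lie in the right half-plane.\<close>
  have "accr N (mat_adjoint (minv T) * M * minv T)" by (rule accr_congruence'[OF assms S(1) T S(2)])
  hence "accr N (mat_diag N d)" unfolding M congruence_cancel[OF T S(1,2) mat_diag_dim] .
  from accr_diag_entry[OF this] have d: "0 < Re (d k)" if "k < N" for k
    using that by (simp add: mat_diag_def)
  obtain \<pi> where \<pi>: "bij_betw \<pi> {..<N} {..<N}"
    "\<And>k l. k \<le> l \<Longrightarrow> l < N \<Longrightarrow> Arg (d (\<pi> l)) \<le> Arg (d (\<pi> k))"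
    using sorting_bijection[of N "\<lambda>k. Arg (d k)"] by blast
  have \<pi>N: "\<pi> k < N" if "k < N" for k using bij_betwE[OF \<pi>(1)] that by auto
  \<comment> \<open>Rows are permuted to sort the arguments and scaled by the square roots of the
    moduli, which leaves unit diagonal entries.\<close>
  define T2 where "T2 = Matrix.mat N N (\<lambda>(k, j). complex_of_real (sqrt (cmod (d (\<pi> k)))) * T $$ (\<pi> k, j))"
  define \<phi> where "\<phi> k = Arg (d (\<pi> k))" for k
  have T2: "T2 \<in> carrier_mat N N" by (simp add: T2_def)
  have "M = mat_adjoint T2 * mat_diag N (\<lambda>k. cis (\<phi> k)) * T2"
  proof (rule congruence_eqI[OF accr_carrier[OF assms] T2])
    fix i j assume ij: "i < N" "j < N"
    have "M $$ (i, j) = (\<Sum>l<N. cnj (T $$ (l, i)) * d l * T $$ (l, j))"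
      unfolding M by (rule congruence_diag_index[OF T ij])
    also have "\<dots> = (\<Sum>k<N. cnj (T $$ (\<pi> k, i)) * d (\<pi> k) * T $$ (\<pi> k, j))"
      by (rule sum.reindex_bij_betw[OF \<pi>(1), symmetric])
    also have "\<dots> = (\<Sum>k<N. cnj (T2 $$ (k, i)) * cis (\<phi> k) * T2 $$ (k, j))"
    proof (intro sum.cong refl)
      fix k assume "k \<in> {..<N}"
      hence k: "k < N" by simp
      let ?s = "complex_of_real (sqrt (cmod (d (\<pi> k))))"
      have "d (\<pi> k) = cmod (d (\<pi> k)) * cis (\<phi> k)"
        using Arg_eq[of "d (\<pi> k)"] d[OF \<pi>N[OF k]] by (cases "d (\<pi> k) = 0") (auto simp: \<phi>_def cis_conv_exp)
      also have "complex_of_real (cmod (d (\<pi> k))) = ?s * ?s"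
        by (simp flip: of_real_mult)
      finally have e: "d (\<pi> k) = ?s * ?s * cis (\<phi> k)" .
      show "cnj (T $$ (\<pi> k, i)) * d (\<pi> k) * T $$ (\<pi> k, j) = cnj (T2 $$ (k, i)) * cis (\<phi> k) * T2 $$ (k, j)"
        using k ij by (subst e) (simp add: T2_def mult_ac)
    qed
    finally show "M $$ (i, j) = (\<Sum>k<N. cnj (T2 $$ (k, i)) * cis (\<phi> k) * T2 $$ (k, j))" .
  qed
  moreover have "\<bar>\<phi> k\<bar> < pi / 2" if "k < N" for k
  proof -
    have "d (\<pi> k) \<noteq> 0" "0 < Re (d (\<pi> k))" using d[OF \<pi>N[OF that]] by auto
    thus ?thesis using Re_Ln_pos_lt[of "d (\<pi> k)"] by (simp add: \<phi>_def Arg_eq_Im_Ln)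
  qed
  ultimately have "canonical_phases N M T2 \<phi>"
    using T2 \<pi>(2) by (auto simp: canonical_phases_def \<phi>_def)
  thus thesis by (rule that)
qed

text \<open>There are \<open>i\<close> equations in \<open>i + 1\<close> unknowns; a zero row makes
  the system square and singular.\<close>

lemma underdetermined_kernel:
  fixes W :: "complex mat"
  obtains u j where "u j \<noteq> (0::complex)" "j \<le> i" "\<And>l. i < l \<Longrightarrow> u l = 0"
    "\<And>l. l < i \<Longrightarrow> (\<Sum>j\<le>i. W $$ (l, j) * u j) = 0"
proof -
  define Q where "Q = Matrix.mat (Suc i) (Suc i) (\<lambda>(l, j). if l < i then W $$ (l, j) else 0)"
  have Q: "Q \<in> carrier_mat (Suc i) (Suc i)" by (simp add: Q_def)
  have "det Q = 0"
  proof (rule ccontr)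
    assume "det Q \<noteq> 0"
    note m = minv[OF Q this]
    have "(Q * minv Q) $$ (i, i) = (\<Sum>l<Suc i. Q $$ (i, l) * minv Q $$ (l, i))"
      by (rule mult_mat_index[OF Q m(1)]) auto
    also have "\<dots> = 0" by (intro sum.neutral) (auto simp: Q_def)
    finally show False unfolding m(2) by simp
  qed
  then obtain v where v: "v \<in> carrier_vec (Suc i)" "v \<noteq> 0\<^sub>v (Suc i)" "Q *\<^sub>v v = 0\<^sub>v (Suc i)"
    using det_0_iff_vec_prod_zero_field[OF Q] by blast
  obtain j where j: "j < Suc i" "vec_index v j \<noteq> 0" using v(1,2) eq_vecI[of v "0\<^sub>v (Suc i)"] by auto
  define u where "u l = (if l \<le> i then vec_index v l else 0)" for l
  show thesis
  proof (rule that[of u j])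
    fix l assume l: "l < i"
    have "(\<Sum>j\<le>i. W $$ (l, j) * u j) = vec_index (Q *\<^sub>v v) l"
      using l v(1) by (auto simp: Q_def u_def scalar_prod_def atLeast0LessThan lessThan_Suc_atMost intro!: sum.cong)
    thus "(\<Sum>j\<le>i. W $$ (l, j) * u j) = 0" using v(3) l by simp
  qed (use j in \<open>auto simp: u_def\<close>)
qed

text \<open>Dimension count in the manner of Courant and Fischer, with indices from 0. Suppose
  \<open>\<psi> i\<close> exceeded \<open>\<phi> i\<close>. Some nonzero \<open>u\<close> supported
  on the first \<open>i + 1\<close> diagonal coordinates of the compression has an image
  \<open>w\<close> vanishing in the first \<open>i\<close> diagonal coordinates of \<open>M\<close>.
  The two forms agree at \<open>u\<close> and \<open>w\<close>, yet the imaginary part of their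
  rotated value is positive for one and nonpositive for the other.\<close>

lemma phase_interlacing:
  assumes M: "canonical_phases N M T \<phi>" and Z: "Z \<in> carrier_mat N k"
    and ZMZ: "canonical_phases k (mat_adjoint Z * M * Z) S \<psi>" and det: "det S \<noteq> 0"
    and i: "i < k" "k \<le> N"
  shows "\<psi> i \<le> \<phi> i"
proof (rule ccontr)
  assume "\<not> \<psi> i \<le> \<phi> i"
  hence less: "\<phi> i < \<psi> i" by simp
  have T: "T \<in> carrier_mat N N" and \<phi>: "\<And>k. k < N \<Longrightarrow> \<bar>\<phi> k\<bar> < pi / 2"
    "\<And>k l. k \<le> l \<Longrightarrow> l < N \<Longrightarrow> \<phi> l \<le> \<phi> k"
    and MT: "M = mat_adjoint T * mat_diag N (\<lambda>k. cis (\<phi> k)) * T"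
    using M by (auto simp: canonical_phases_def)
  have S: "S \<in> carrier_mat k k" and \<psi>: "\<And>i. i < k \<Longrightarrow> \<bar>\<psi> i\<bar> < pi / 2"
    "\<And>i l. i \<le> l \<Longrightarrow> l < k \<Longrightarrow> \<psi> l \<le> \<psi> i"
    and MS: "mat_adjoint Z * M * Z = mat_adjoint S * mat_diag k (\<lambda>k. cis (\<psi> k)) * S"
    using ZMZ by (auto simp: canonical_phases_def)
  note R = minv[OF S det]
  define W where "W = T * Z * minv S"
  have W: "W \<in> carrier_mat N k" unfolding W_def using T Z R(1) by auto
  have "mat_diag k (\<lambda>k. cis (\<psi> k)) = mat_adjoint (minv S) * (mat_adjoint Z * M * Z) * minv S"
    unfolding MS by (rule congruence_cancel[OF S R(1,2) mat_diag_dim, symmetric])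
  also have "\<dots> = mat_adjoint W * mat_diag N (\<lambda>k. cis (\<phi> k)) * W"
    unfolding MT W_def congruence_congruence[OF T Z mat_diag_dim]
    by (rule congruence_congruence[OF mult_carrier_mat[OF T Z] R(1) mat_diag_dim])
  finally have diag_eq: "mat_diag k (\<lambda>k. cis (\<psi> k)) = mat_adjoint W * mat_diag N (\<lambda>k. cis (\<phi> k)) * W" .
  obtain u j where u: "u j \<noteq> (0::complex)" "j \<le> i" "\<And>l. i < l \<Longrightarrow> u l = 0"
    "\<And>l. l < i \<Longrightarrow> (\<Sum>j\<le>i. W $$ (l, j) * u j) = 0"
    using underdetermined_kernel[of i W] by metis
  define w where "w = mapply k W u"
  have w0: "w l = 0" if "l < i" for l
  proof -
    have "w l = (\<Sum>j\<le>i. W $$ (l, j) * u j)"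
      unfolding w_def mapply_def using i u(3) by (intro sum.mono_neutral_right) auto
    thus ?thesis using u(4)[OF that] by simp
  qed
  have "hform k (mat_diag k (\<lambda>k. cis (\<psi> k))) u = hform N (mat_diag N (\<lambda>k. cis (\<phi> k))) w"
    unfolding diag_eq w_def by (rule hform_congruence[OF W mat_diag_dim])
  \<comment> \<open>Rotation by \<open>- \<phi> i\<close> places the threshold phase on the positive
    real axis; imaginary parts turn into sums of sines.\<close>
  moreover have "(\<Sum>l<m. cis (\<alpha> l) * (cmod (x l))\<^sup>2) * cis (- \<phi> i) = (\<Sum>l<m. (cmod (x l))\<^sup>2 * cis (\<alpha> l - \<phi> i))"
    for m \<alpha> and x :: "nat \<Rightarrow> complex"
    unfolding sum_distrib_right
  proof (intro sum.cong refl)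
    fix l
    have "cis (\<alpha> l) * (cmod (x l))\<^sup>2 * cis (- \<phi> i) = (cmod (x l))\<^sup>2 * (cis (\<alpha> l) * cis (- \<phi> i))"
      by (simp only: mult_ac)
    thus "cis (\<alpha> l) * (cmod (x l))\<^sup>2 * cis (- \<phi> i) = (cmod (x l))\<^sup>2 * cis (\<alpha> l - \<phi> i)"
      by (simp add: cis_mult)
  qed
  ultimately have "(\<Sum>l<k. (cmod (u l))\<^sup>2 * cis (\<psi> l - \<phi> i)) = (\<Sum>l<N. (cmod (w l))\<^sup>2 * cis (\<phi> l - \<phi> i))"
    unfolding hform_diag by metis
  hence "Im (\<Sum>l<k. (cmod (u l))\<^sup>2 * cis (\<psi> l - \<phi> i)) = Im (\<Sum>l<N. (cmod (w l))\<^sup>2 * cis (\<phi> l - \<phi> i))"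
    by (rule arg_cong)
  hence eq: "(\<Sum>l<k. (cmod (u l))\<^sup>2 * sin (\<psi> l - \<phi> i)) = (\<Sum>l<N. (cmod (w l))\<^sup>2 * sin (\<phi> l - \<phi> i))"
    by (simp flip: of_real_power)
  have "(\<Sum>l<N. (cmod (w l))\<^sup>2 * sin (\<phi> l - \<phi> i)) \<le> 0"
  proof (rule sum_nonpos)
    fix l assume "l \<in> {..<N}"
    hence l: "l < N" by simp
    show "(cmod (w l))\<^sup>2 * sin (\<phi> l - \<phi> i) \<le> 0"
    proof (cases "l < i")
      case False
      have "0 \<le> sin (\<phi> i - \<phi> l)"
        using \<phi>(2)[of i l] \<phi>(1)[of i] \<phi>(1)[OF l] i False l by (intro sin_ge_zero) auto
      hence "sin (\<phi> l - \<phi> i) \<le> 0" using sin_minus[of "\<phi> i - \<phi> l"] by simp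
      thus ?thesis by (simp add: mult_nonneg_nonpos)
    qed (simp add: w0)
  qed
  \<comment> \<open>For \<open>l \<le> i\<close> the difference is at least
    \<open>\<psi> i - \<phi> i\<close>, hence positive, and it is below pi because both phases are
    below pi/2 in modulus.\<close>
  moreover have sp: "0 < sin (\<psi> l - \<phi> i)" if "l \<le> i" for l
    using \<psi>(2)[of l i] \<psi>(1)[of l] \<phi>(1)[of i] i that less by (intro sin_gt_zero) (auto simp: abs_less_iff)
  have "0 < (\<Sum>l<k. (cmod (u l))\<^sup>2 * sin (\<psi> l - \<phi> i))"
  proof (rule sum_pos2[of _ j])
    show "0 < (cmod (u j))\<^sup>2 * sin (\<psi> j - \<phi> i)" using u(1,2) sp by simp
    fix l assume "l \<in> {..<k}"
    show "0 \<le> (cmod (u l))\<^sup>2 * sin (\<psi> l - \<phi> i)"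
      using u(3)[of l] sp[of l] by (cases "l \<le> i") auto
  qed (use u(2) i in auto)
  ultimately show False using eq by simp
qed

lemma canonical_phases_det:
  assumes "accr N M" "canonical_phases N M T \<phi>" shows "det T \<noteq> 0"
  using assms congruence_factor_det[OF _ mat_diag_dim] accr_det_nonzero[OF assms(1)]
  by (auto simp: canonical_phases_def)

text \<open>Compression by the identity makes \<open>phase_interlacing\<close> apply in both
  directions.\<close>

lemma canonical_phases_unique:
  assumes acc: "accr N M" and S: "canonical_phases N M S \<psi>" and T: "canonical_phases N M T \<phi>" and k: "k < N"
  shows "\<psi> k = \<phi> k"
proof -
  have one: "mat_adjoint (1\<^sub>m N) * M * 1\<^sub>m N = M" using accr_carrier[OF acc] by simp
  show ?thesis
    using phase_interlacing[OF T one_carrier_mat, unfolded one, OF S canonical_phases_det[OF acc S] k]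
      phase_interlacing[OF S one_carrier_mat, unfolded one, OF T canonical_phases_det[OF acc T] k] by simp
qed

lemma parg_canonical_phases:
  assumes "accr N M" "canonical_phases N M T \<phi>"
  shows "parg N M = (\<Sum>k<N. \<phi> k)"
  using parg_phase_congruence[OF _ canonical_phases_det[OF assms]] assms(2)
  by (auto simp: canonical_phases_def)

text \<open>The branch \<open>parg\<close> is the sum of the phases of the compression, to which
  interlacing applies termwise.\<close>

lemma parg_compression_le:
  assumes M: "canonical_phases N M T \<phi>" and Z: "Z \<in> carrier_mat N k"
    and acc: "accr k (mat_adjoint Z * M * Z)" and k: "k \<le> N"
  shows "parg k (mat_adjoint Z * M * Z) \<le> (\<Sum>i<k. \<phi> i)"
proof -
  obtain S \<psi> where S: "canonical_phases k (mat_adjoint Z * M * Z) S \<psi>"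
    using canonical_phases_exist[OF acc] .
  have "parg k (mat_adjoint Z * M * Z) = (\<Sum>i<k. \<psi> i)" by (rule parg_canonical_phases[OF acc S])
  also have "\<dots> \<le> (\<Sum>i<k. \<phi> i)"
    using phase_interlacing[OF M Z S canonical_phases_det[OF acc S] _ k] by (intro sum_mono) auto
  finally show ?thesis .
qed

section \<open>Phases of the geometric mean\<close>

text \<open>\<open>Z\<close> is the inclusion of the first \<open>k\<close> coordinates; it brings
  leading blocks within reach of \<open>parg_compression_le\<close>.\<close>

lemma lead_as_congruence:
  fixes M :: "complex mat"
  assumes "M \<in> carrier_mat N N" "k \<le> N"
  defines "Z \<equiv> Matrix.mat N k (\<lambda>(i, j). if i = j then 1 else 0 :: complex)"
  shows "lead k M = mat_adjoint Z * M * Z"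
proof (rule eq_matI)
  have Z: "Z \<in> carrier_mat N k" by (simp add: Z_def)
  note MZ = mult_carrier_mat[OF mat_adjoint_carrier[OF Z] assms(1)]
  fix i j assume "i < dim_row (mat_adjoint Z * M * Z)" "j < dim_col (mat_adjoint Z * M * Z)"
  hence ij: "i < k" "j < k" using Z by auto
  have "(mat_adjoint Z * M * Z) $$ (i, j) = (\<Sum>l<N. (mat_adjoint Z * M) $$ (i, l) * Z $$ (l, j))"
    by (rule mult_mat_index[OF MZ Z ij])
  also have "\<dots> = (\<Sum>l<N. if l = j then (mat_adjoint Z * M) $$ (i, j) else 0)"
    using ij assms(2) by (intro sum.cong) (auto simp: Z_def)
  also have "\<dots> = (mat_adjoint Z * M) $$ (i, j)" using ij assms(2) by simp
  also have "\<dots> = (\<Sum>l<N. mat_adjoint Z $$ (i, l) * M $$ (l, j))"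
    using mult_mat_index[OF mat_adjoint_carrier[OF Z] assms(1)] ij assms(2) by simp
  also have "\<dots> = (\<Sum>l<N. if l = i then M $$ (i, j) else 0)"
    using ij assms(2) by (intro sum.cong) (auto simp: Z_def)
  also have "\<dots> = M $$ (i, j)" using ij assms(2) by simp
  finally show "lead k M $$ (i, j) = (mat_adjoint Z * M * Z) $$ (i, j)" using ij by simp
qed (auto simp: Z_def lead_def)

lemma canonical_phases_congruence:
  assumes "canonical_phases N M T \<phi>" "S \<in> carrier_mat N N"
  shows "canonical_phases N (mat_adjoint S * M * S) (T * S) \<phi>"
  using assms congruence_congruence[of T N N S N] by (auto simp: canonical_phases_def)

lemma parg_lead_le:
  assumes M: "canonical_phases N M T \<phi>" and acc: "accr N M" and k: "k \<le> N"
  shows "parg k (lead k M) \<le> (\<Sum>i<k. \<phi> i)"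
  using parg_compression_le[OF M _ _ k, of "Matrix.mat N k (\<lambda>(i, j). if i = j then 1 else 0)"]
    accr_lead[OF acc k] unfolding lead_as_congruence[OF accr_carrier[OF acc] k] by simp

text \<open>A^-H = A^-H A A^-1 is congruent to \<open>A\<close>. Through it the phases of
  \<open>A\<close>, rather than their negatives, bound the contribution of the inverse of
  \<open>A\<close>.\<close>

lemma canonical_phases_adjoint_minv:
  assumes "canonical_phases N A T \<phi>" "accr N A"
  shows "canonical_phases N (mat_adjoint (minv A)) (T * minv A) \<phi>"
proof -
  note A = accr_carrier[OF assms(2)]
  note m = minv[OF A accr_det_nonzero[OF assms(2)]]
  have "mat_adjoint (minv A) * A * minv A = mat_adjoint (minv A) * (A * minv A)"
    by (rule assoc_mult_mat[OF mat_adjoint_carrier[OF m(1)] A m(1)])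
  also have "\<dots> = mat_adjoint (minv A)" unfolding m(2) by (rule right_mult_one_mat[OF mat_adjoint_carrier[OF m(1)]])
  finally show ?thesis using canonical_phases_congruence[OF assms(1) m(1)] by simp
qed

text \<open>Diagonal factors act entrywise and so survive truncation; this is the reason for
  diagonalizing \<open>G\<close>.\<close>

lemma lead_diag_scaling:
  fixes C :: "complex mat"
  assumes "C \<in> carrier_mat N N" "k \<le> N"
  shows "lead k (mat_diag N d * C * mat_diag N d) = mat_diag k d * lead k C * mat_diag k d"
proof -
  have "mat_diag N d * C * mat_diag N d = Matrix.mat N N (\<lambda>(i, j). d i * C $$ (i, j) * d j)"
    if "C \<in> carrier_mat N N" for N and C :: "complex mat"
    using that by (subst mat_diag_mult_right[of _ N N]) (auto simp: mat_diag_mult_left intro!: eq_matI)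
  thus ?thesis using assms by (auto simp: lead_def intro!: eq_matI)
qed

lemma phase_sums_geometric_mean:
  assumes A: "accr N A" "canonical_phases N A TA \<phi>A"
    and B: "accr N B" "canonical_phases N B TB \<phi>B"
    and G: "accr N G" "canonical_phases N G T \<theta>"
    and eq: "B = G * minv A * G" and k: "k \<le> N"
  shows "2 * (\<Sum>i<k. \<theta> i) \<le> (\<Sum>i<k. \<phi>A i) + (\<Sum>i<k. \<phi>B i)"
    and "k = N \<Longrightarrow> 2 * (\<Sum>i<k. \<theta> i) = (\<Sum>i<k. \<phi>A i) + (\<Sum>i<k. \<phi>B i)"
proof -
  define D where "D = mat_diag N (\<lambda>k. cis (\<theta> k))"
  have T: "T \<in> carrier_mat N N" and GT: "G = mat_adjoint T * D * T"
    and \<theta>: "\<And>k. k < N \<Longrightarrow> \<bar>\<theta> k\<bar> < pi / 2"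
    using G(2) by (auto simp: canonical_phases_def D_def)
  note detT = canonical_phases_det[OF G]
  note S = minv[OF T detT]
  note TH = mat_adjoint_carrier[OF T] and SH = mat_adjoint_carrier[OF S(1)]
  have D: "D \<in> carrier_mat N N" by (simp add: D_def)
  note cA = accr_carrier[OF A(1)]
  note mA = minv[OF cA accr_det_nonzero[OF A(1)]]
  have ST: "mat_adjoint (minv T) * mat_adjoint T = 1\<^sub>m N"
    using mat_adjoint_mult[OF T S(1)] S(2) by simp
  \<comment> \<open>The inverse of \<open>A\<close> is transformed by \<open>T\<close> from the left
    and its adjoint from the right, so that with G = T^H D T the product G A^-1 G becomes T^H (D C
    D) T.\<close>
  define C where "C = T * minv A * mat_adjoint T"
  have C: "C \<in> carrier_mat N N" unfolding C_def using T mA(1) by auto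
  have C_congr: "C = mat_adjoint (mat_adjoint T) * minv A * mat_adjoint T" by (simp add: C_def)
  have accC: "accr N C"
    unfolding C_congr by (rule accr_congruence'[OF accr_minv[OF A(1)] TH SH ST])
  define B' where "B' = mat_adjoint (minv T) * B * minv T"
  have accB': "accr N B'"
    unfolding B'_def by (rule accr_congruence'[OF B(1) S(1) T S(2)])
  have canB': "canonical_phases N B' (TB * minv T) \<phi>B"
    unfolding B'_def by (rule canonical_phases_congruence[OF B(2) S(1)])
  have "G * minv A * G = mat_adjoint T * (D * C * D) * T"
  proof -
    have "mat_adjoint T * (D * C * D) * T = mat_adjoint T * (D * (T * (minv A * (mat_adjoint T * (D * T)))))"
      unfolding C_def using T TH D mA(1) by (simp add: assoc_mult_mat[of _ N N _ N _ N] mult_carrier_mat[of _ N N _ N])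
    also have "\<dots> = G * minv A * G"
      unfolding GT using T TH D mA(1) by (simp add: assoc_mult_mat[of _ N N _ N _ N] mult_carrier_mat[of _ N N _ N])
    finally show ?thesis by simp
  qed
  hence B'_eq: "B' = D * C * D"
    unfolding B'_def eq using congruence_cancel[OF T S(1,2), of "D * C * D"] D C by simp
  \<comment> \<open>The adjoint of \<open>C\<close> is congruent to the adjoint inverse of
    \<open>A\<close> and hence has the phases of \<open>A\<close>.\<close>
  have "mat_adjoint C = mat_adjoint (mat_adjoint T) * mat_adjoint (minv A) * mat_adjoint T"
    unfolding C_congr using mA(1) T
    by (simp add: mat_adjoint_mult[of _ N N _ N] mult_carrier_mat[of _ N N _ N] assoc_mult_mat[of _ N N _ N _ N])
  hence canC: "canonical_phases N (mat_adjoint C) (TA * minv A * mat_adjoint T) \<phi>A"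
    using canonical_phases_congruence[OF canonical_phases_adjoint_minv[OF A(2,1)] TH] by simp
  have "parg k (lead k B') = 2 * (\<Sum>i<k. \<theta> i) + parg k (lead k C)"
  proof -
    have e: "lead k B' = mat_diag k (\<lambda>k. cis (\<theta> k)) * lead k C * mat_diag k (\<lambda>k. cis (\<theta> k))"
      unfolding B'_eq D_def by (rule lead_diag_scaling[OF C k])
    show ?thesis
      unfolding e
      by (rule parg_diag_scaling[OF _ refl accr_lead[OF accC k]])
         (use \<theta> k accr_lead[OF accB' k] e in auto)
  qed
  moreover have "parg k (lead k (mat_adjoint C)) = - parg k (lead k C)"
    unfolding lead_adjoint[OF C k] by (rule parg_adjoint[OF accr_lead[OF accC k]])
  \<comment> \<open>The adjoint has flipped the sign of the argument of \<open>C\<close>, which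
    leaves two terms that both admit upper bounds.\<close>
  ultimately have main: "2 * (\<Sum>i<k. \<theta> i) = parg k (lead k B') + parg k (lead k (mat_adjoint C))" by simp
  show "2 * (\<Sum>i<k. \<theta> i) \<le> (\<Sum>i<k. \<phi>A i) + (\<Sum>i<k. \<phi>B i)"
    using main parg_lead_le[OF canB' accB' k] parg_lead_le[OF canC accr_adjoint[OF accC] k] by simp
  assume "k = N"
  thus "2 * (\<Sum>i<k. \<theta> i) = (\<Sum>i<k. \<phi>A i) + (\<Sum>i<k. \<phi>B i)"
    using main parg_canonical_phases[OF accB' canB'] parg_canonical_phases[OF accr_adjoint[OF accC] canC]
      lead_full[OF accr_carrier[OF accB']] lead_full[OF mat_adjoint_carrier[OF C]] by simp
qed

section \<open>Calculus of matrix-valued functions\<close>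

lemma mcont_minv:
  assumes "mcont n n S F" "\<And>x. x \<in> S \<Longrightarrow> det (F x) \<noteq> 0"
  shows "mcont n n S (\<lambda>x. minv (F x))"
proof (rule mcontI)
  fix x assume "x \<in> S"
  thus "minv (F x) \<in> carrier_mat n n" using minv(1) mcontD(1)[OF assms(1)] assms(2) by blast
next
  fix i j assume ij: "i < n" "j < n"
  have del: "mcont (n - 1) (n - 1) S (\<lambda>x. mat_delete (F x) j i)"
  proof (rule mcontI)
    fix i' j' assume ij': "i' < n - 1" "j' < n - 1"
    let ?i = "if i' < j then i' else Suc i'" and ?j = "if j' < i then j' else Suc j'"
    have e: "mat_delete (F x) j i $$ (i', j') = F x $$ (?i, ?j)" if "x \<in> S" for x
      using mcontD(1)[OF assms(1) that] ij' by (simp add: mat_delete_def)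
    show "continuous_on S (\<lambda>x. mat_delete (F x) j i $$ (i', j'))"
    proof (rule continuous_on_cong[OF refl e, THEN iffD2])
      show "continuous_on S (\<lambda>x. F x $$ (?i, ?j))" by (rule mcontD(2)[OF assms(1)]) (use ij' in auto)
    qed
  qed (use mat_delete_carrier[OF mcontD(1)[OF assms(1)]] in blast)
  have c: "continuous_on S (\<lambda>x. 1 / det (F x) * ((-1) ^ (j + i) * det (mat_delete (F x) j i)))"
    using assms(2) by (intro continuous_intros continuous_on_det[OF assms(1)] continuous_on_det[OF del]) auto
  have e: "minv (F x) $$ (i, j) = 1 / det (F x) * ((-1) ^ (j + i) * det (mat_delete (F x) j i))"
    if "x \<in> S" for x
    using mcontD(1)[OF assms(1) that] ij by (simp add: minv_def adj_mat_def cofactor_def)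
  show "continuous_on S (\<lambda>x. minv (F x) $$ (i, j))"
    using continuous_on_cong[OF refl e, THEN iffD2, OF _ c] by simp
qed

lemma mcont_compose:
  assumes "mcont n m S F" "continuous_on T g" "g ` T \<subseteq> S"
  shows "mcont n m T (\<lambda>x. F (g x))"
  using mcontD[OF assms(1)] assms(2,3)
  by (intro mcontI) (auto intro: continuous_on_compose2[where t = S])

text \<open>Derivatives are entrywise and relative to \<open>S\<close>, so that endpoints of closed
  intervals are included.\<close>

definition mder :: "nat \<Rightarrow> real set \<Rightarrow> real \<Rightarrow> (real \<Rightarrow> complex mat) \<Rightarrow> complex mat \<Rightarrow> bool" where
  "mder n S x F F' \<longleftrightarrow> x \<in> S \<and> (\<forall>y\<in>S. F y \<in> carrier_mat n n) \<and> F' \<in> carrier_mat n n \<and>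
     (\<forall>i<n. \<forall>j<n. ((\<lambda>y. F y $$ (i, j)) has_vector_derivative F' $$ (i, j)) (at x within S))"

lemma mderI:
  assumes "x \<in> S" "\<And>y. y \<in> S \<Longrightarrow> F y \<in> carrier_mat n n" "F' \<in> carrier_mat n n"
    and "\<And>i j. i < n \<Longrightarrow> j < n \<Longrightarrow> ((\<lambda>y. F y $$ (i, j)) has_vector_derivative F' $$ (i, j)) (at x within S)"
  shows "mder n S x F F'"
  using assms by (auto simp: mder_def)

lemma mderD:
  assumes "mder n S x F F'"
  shows "x \<in> S" "\<And>y. y \<in> S \<Longrightarrow> F y \<in> carrier_mat n n" "F' \<in> carrier_mat n n"
    and "\<And>i j. i < n \<Longrightarrow> j < n \<Longrightarrow> ((\<lambda>y. F y $$ (i, j)) has_vector_derivative F' $$ (i, j)) (at x within S)"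
  using assms by (auto simp: mder_def)

lemma mder_mult:
  assumes F: "mder n S x F F'" and G: "mder n S x G G'"
  shows "mder n S x (\<lambda>y. F y * G y) (F' * G x + F x * G')"
proof (rule mderI)
  note x = mderD(1)[OF F]
  note c = mderD(2)[OF F] mderD(2)[OF G] mderD(3)[OF F] mderD(3)[OF G]
  show "x \<in> S" by (rule x)
  show "F y * G y \<in> carrier_mat n n" if "y \<in> S" for y
    by (rule mult_carrier_mat[OF c(1)[OF that] c(2)[OF that]])
  show "F' * G x + F x * G' \<in> carrier_mat n n"
    using mult_carrier_mat[OF c(3) c(2)[OF x]] mult_carrier_mat[OF c(1)[OF x] c(4)] by simp
  fix i j assume ij: "i < n" "j < n"
  have e: "(F y * G y) $$ (i, j) = (\<Sum>l<n. F y $$ (i, l) * G y $$ (l, j))" if "y \<in> S" for y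
    by (rule mult_mat_index[OF c(1)[OF that] c(2)[OF that] ij])
  have e': "(F' * G x + F x * G') $$ (i, j) = (\<Sum>l<n. F x $$ (i, l) * G' $$ (l, j) + F' $$ (i, l) * G x $$ (l, j))"
    using mult_carrier_mat[OF c(3) c(2)[OF x]] mult_carrier_mat[OF c(1)[OF x] c(4)] ij
      mult_mat_index[OF c(3) c(2)[OF x] ij] mult_mat_index[OF c(1)[OF x] c(4) ij]
      carrier_matD[OF c(1)[OF x]] carrier_matD[OF c(4)]
    by (simp add: sum.distrib del: index_mult_mat(1))
  show "((\<lambda>y. (F y * G y) $$ (i, j)) has_vector_derivative (F' * G x + F x * G') $$ (i, j)) (at x within S)"
    unfolding e'
    by (rule has_vector_derivative_transform[OF x e], assumption)
       (intro has_vector_derivative_sum has_vector_derivative_mult mderD(4)[OF F] mderD(4)[OF G]; use ij in simp)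
qed

text \<open>The factor \<open>h y - h x\<close> vanishes at \<open>x\<close>, so continuity of
  \<open>g\<close> at \<open>x\<close> suffices for the product to be differentiable there. It
  serves for inverses, whose differentiability is the goal.\<close>

lemma has_vector_derivative_continuous_mult_diff:
  fixes g h :: "real \<Rightarrow> complex"
  assumes g: "(g \<longlongrightarrow> g x) (at x within S)" and h: "(h has_vector_derivative h') (at x within S)"
  shows "((\<lambda>y. g y * (h y - h x)) has_vector_derivative g x * h') (at x within S)"
proof -
  have h0: "((\<lambda>y. (1 / norm (y - x)) *\<^sub>R (h y - (h x + (y - x) *\<^sub>R h'))) \<longlongrightarrow> 0) (at x within S)"
    using h by (simp add: has_vector_derivative_def has_derivative_within)
  have "((\<lambda>y. g y - g x) \<longlongrightarrow> 0) (at x within S)" using g by (simp add: LIM_zero)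
  hence "((\<lambda>y. norm (g y - g x) * norm h') \<longlongrightarrow> 0) (at x within S)"
    by (intro tendsto_mult_left_zero tendsto_norm_zero)
  hence r0: "((\<lambda>y. (g y - g x) * ((1 / norm (y - x)) *\<^sub>R ((y - x) *\<^sub>R h'))) \<longlongrightarrow> 0) (at x within S)"
  proof (rule Lim_null_comparison[rotated], intro always_eventually allI)
    fix y
    have "\<bar>1 / norm (y - x) * (y - x)\<bar> \<le> 1" by (auto simp: abs_mult)
    hence "norm ((1 / norm (y - x)) *\<^sub>R ((y - x) *\<^sub>R h')) \<le> 1 * norm h'"
      unfolding scaleR_scaleR norm_scaleR by (rule mult_right_mono) simp
    thus "norm ((g y - g x) * ((1 / norm (y - x)) *\<^sub>R ((y - x) *\<^sub>R h'))) \<le> norm (g y - g x) * norm h'"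
      unfolding norm_mult by (intro mult_left_mono) auto
  qed
  have lim: "((\<lambda>y. g y * ((1 / norm (y - x)) *\<^sub>R (h y - (h x + (y - x) *\<^sub>R h')))
      + (g y - g x) * ((1 / norm (y - x)) *\<^sub>R ((y - x) *\<^sub>R h'))) \<longlongrightarrow> g x * 0 + 0) (at x within S)"
    by (intro tendsto_intros g h0 r0)
  have eq: "g y * (r *\<^sub>R (h y - (h x + (y - x) *\<^sub>R h'))) + (g y - g x) * (r *\<^sub>R ((y - x) *\<^sub>R h'))
      = r *\<^sub>R (g y * (h y - h x) - (g x * (h x - h x) + (y - x) *\<^sub>R (g x * h')))" for y r
    by (simp add: scaleR_conv_of_real algebra_simps)
  show ?thesis using lim unfolding eq by (simp add: has_vector_derivative_def has_derivative_within bounded_linear_scaleR_left)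
qed

text \<open>X_y - X_x = - X_y (M_y - M_x) X_x, where continuity of X_y is enough to differentiate at
  x.\<close>

lemma mder_inverse:
  assumes M: "mder n S x M M'" and X: "mcont n n S X"
    and inv: "\<And>y. y \<in> S \<Longrightarrow> M y * X y = 1\<^sub>m n" "\<And>y. y \<in> S \<Longrightarrow> X y * M y = 1\<^sub>m n"
  shows "mder n S x X (- (X x * M' * X x))"
proof (rule mderI)
  note x = mderD(1)[OF M]
  note cM = mderD(2)[OF M] and cX = mcontD(1)[OF X] and M' = mderD(3)[OF M]
  show "x \<in> S" by (rule x)
  show "X y \<in> carrier_mat n n" if "y \<in> S" for y by (rule cX[OF that])
  show c': "- (X x * M' * X x) \<in> carrier_mat n n"
    using cX[OF x] M' by (simp add: mult_carrier_mat[of _ n n _ n])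
  have expand: "(A * B * D) $$ (i, j) = (\<Sum>l<n. \<Sum>k<n. A $$ (i, k) * B $$ (k, l) * D $$ (l, j))"
    if "A \<in> carrier_mat n n" "B \<in> carrier_mat n n" "D \<in> carrier_mat n n" "i < n" "j < n"
    for A B D :: "complex mat" and i j
    using mult_mat_index[OF mult_carrier_mat[OF that(1,2)] that(3-5)] mult_mat_index[OF that(1,2) that(4)]
    by (simp add: sum_distrib_right)
  fix i j assume ij: "i < n" "j < n"
  have e: "X y $$ (i, j) = X x $$ (i, j) + (\<Sum>l<n. \<Sum>k<n. - (X y $$ (i, k) * (M y $$ (k, l) - M x $$ (k, l))) * X x $$ (l, j))"
    if y: "y \<in> S" for y
  proof -
    have "X y * (M y - M x) * X x = (X y * M y - X y * M x) * X x"
      by (simp add: mult_minus_distrib_mat[OF cX[OF y] cM[OF y] cM[OF x]])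
    also have "\<dots> = 1\<^sub>m n * X x - X y * M x * X x"
      unfolding inv(2)[OF y]
      by (rule minus_mult_distrib_mat[OF one_carrier_mat mult_carrier_mat[OF cX[OF y] cM[OF x]] cX[OF x]])
    also have "\<dots> = X x - X y"
      using assoc_mult_mat[OF cX[OF y] cM[OF x] cX[OF x]] inv(1)[OF x] cX[OF x] cX[OF y] by simp
    finally have "(X y * (M y - M x) * X x) $$ (i, j) = (X x - X y) $$ (i, j)" by simp
    hence "(\<Sum>l<n. \<Sum>k<n. X y $$ (i, k) * (M y - M x) $$ (k, l) * X x $$ (l, j)) = X x $$ (i, j) - X y $$ (i, j)"
      using expand[OF cX[OF y] minus_carrier_mat[OF cM[OF x]] cX[OF x] ij] cX[OF x] cX[OF y] ij by simp
    moreover have "(\<Sum>l<n. \<Sum>k<n. X y $$ (i, k) * (M y - M x) $$ (k, l) * X x $$ (l, j))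
      = (\<Sum>l<n. \<Sum>k<n. X y $$ (i, k) * (M y $$ (k, l) - M x $$ (k, l)) * X x $$ (l, j))"
      using cM[OF x] cM[OF y] by (intro sum.cong refl) auto
    ultimately show ?thesis by (simp add: sum_negf)
  qed
  have e': "(- (X x * M' * X x)) $$ (i, j) = 0 + (\<Sum>l<n. \<Sum>k<n. - (X x $$ (i, k) * M' $$ (k, l)) * X x $$ (l, j))"
    using ij expand[OF cX[OF x] M' cX[OF x] ij] carrier_matD[OF cX[OF x]]
    by (simp add: sum_negf del: index_mult_mat(1))
  have lim: "((\<lambda>y. X y $$ (i, k)) \<longlongrightarrow> X x $$ (i, k)) (at x within S)" if "k < n" for k
    using mcontD(2)[OF X ij(1) that] x by (simp add: continuous_on_def)
  show "((\<lambda>y. X y $$ (i, j)) has_vector_derivative (- (X x * M' * X x)) $$ (i, j)) (at x within S)"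
    unfolding e'
    by (rule has_vector_derivative_transform[OF x e], assumption)
       (intro has_vector_derivative_add has_vector_derivative_const has_vector_derivative_sum
          has_vector_derivative_mult_left has_vector_derivative_minus
          has_vector_derivative_continuous_mult_diff lim mderD(4)[OF M]; simp)
qed

section \<open>Entrywise integrals over the compact interval [0, pi/2]\<close>

definition mint :: "nat \<Rightarrow> (real \<Rightarrow> complex mat) \<Rightarrow> complex mat" where
  "mint n F = Matrix.mat n n (\<lambda>(i, j). integral {0..pi/2} (\<lambda>\<theta>. F \<theta> $$ (i, j)))"

lemma mint_carrier [simp]: "mint n F \<in> carrier_mat n n"
  by (simp add: mint_def)

lemma mint_dim [simp]: "dim_row (mint n F) = n" "dim_col (mint n F) = n"
  by (simp_all add: mint_def)

lemma mint_index [simp]: "i < n \<Longrightarrow> j < n \<Longrightarrow> mint n F $$ (i, j) = integral {0..pi/2} (\<lambda>\<theta>. F \<theta> $$ (i, j))"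
  by (simp add: mint_def)

lemma mint_cong: "(\<And>\<theta>. \<theta> \<in> {0..pi/2} \<Longrightarrow> F \<theta> = G \<theta>) \<Longrightarrow> mint n F = mint n G"
  unfolding mint_def by (intro cong_mat refl) (auto intro!: integral_cong)

lemma mcont_integrable:
  assumes "mcont n m {0..pi/2} F" "i < n" "j < m"
  shows "(\<lambda>\<theta>. F \<theta> $$ (i, j)) integrable_on {0..pi/2}"
  using mcontD(2)[OF assms] by (rule integrable_continuous_interval)

lemma mint_mult_left:
  assumes "A \<in> carrier_mat n n" "mcont n n {0..pi/2} F"
  shows "mint n (\<lambda>\<theta>. A * F \<theta>) = A * mint n F"
proof (rule eq_matI)
  fix i j assume "i < dim_row (A * mint n F)" "j < dim_col (A * mint n F)"
  hence ij: "i < n" "j < n" using assms(1) by auto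
  have "mint n (\<lambda>\<theta>. A * F \<theta>) $$ (i, j) = integral {0..pi/2} (\<lambda>\<theta>. \<Sum>l<n. A $$ (i, l) * F \<theta> $$ (l, j))"
    unfolding mint_index[OF ij]
    by (rule integral_cong) (rule mult_mat_index[OF assms(1) mcontD(1)[OF assms(2)] ij])
  also have "\<dots> = (\<Sum>l<n. A $$ (i, l) * mint n F $$ (l, j))"
    using ij by (subst integral_sum) (auto intro!: integrable_on_mult_right mcont_integrable[OF assms(2)])
  also have "\<dots> = (A * mint n F) $$ (i, j)" by (rule mult_mat_index[OF assms(1) mint_carrier ij, symmetric])
  finally show "mint n (\<lambda>\<theta>. A * F \<theta>) $$ (i, j) = (A * mint n F) $$ (i, j)" .
qed (use assms in auto)

lemma mint_mult_right:
  assumes "A \<in> carrier_mat n n" "mcont n n {0..pi/2} F"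
  shows "mint n (\<lambda>\<theta>. F \<theta> * A) = mint n F * A"
proof (rule eq_matI)
  fix i j assume "i < dim_row (mint n F * A)" "j < dim_col (mint n F * A)"
  hence ij: "i < n" "j < n" using assms(1) by auto
  have "mint n (\<lambda>\<theta>. F \<theta> * A) $$ (i, j) = integral {0..pi/2} (\<lambda>\<theta>. \<Sum>l<n. F \<theta> $$ (i, l) * A $$ (l, j))"
    unfolding mint_index[OF ij]
    by (rule integral_cong) (rule mult_mat_index[OF mcontD(1)[OF assms(2)] assms(1) ij])
  also have "\<dots> = (\<Sum>l<n. mint n F $$ (i, l) * A $$ (l, j))"
    using ij by (subst integral_sum) (auto intro!: integrable_on_mult_left mcont_integrable[OF assms(2)])
  also have "\<dots> = (mint n F * A) $$ (i, j)" by (rule mult_mat_index[OF mint_carrier assms(1) ij, symmetric])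
  finally show "mint n (\<lambda>\<theta>. F \<theta> * A) $$ (i, j) = (mint n F * A) $$ (i, j)" .
qed (use assms in auto)

lemma mint_combination:
  assumes "mcont n n {0..pi/2} F" "mcont n n {0..pi/2} G"
  shows "mint n (\<lambda>\<theta>. a \<cdot>\<^sub>m F \<theta> + b \<cdot>\<^sub>m G \<theta>) = a \<cdot>\<^sub>m mint n F + b \<cdot>\<^sub>m mint n G"
proof (rule eq_matI)
  fix i j assume "i < dim_row (a \<cdot>\<^sub>m mint n F + b \<cdot>\<^sub>m mint n G)" "j < dim_col (a \<cdot>\<^sub>m mint n F + b \<cdot>\<^sub>m mint n G)"
  hence ij: "i < n" "j < n" by auto
  have "mint n (\<lambda>\<theta>. a \<cdot>\<^sub>m F \<theta> + b \<cdot>\<^sub>m G \<theta>) $$ (i, j)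
      = integral {0..pi/2} (\<lambda>\<theta>. a * F \<theta> $$ (i, j) + b * G \<theta> $$ (i, j))"
    unfolding mint_index[OF ij]
  proof (rule integral_cong)
    fix \<theta> assume "\<theta> \<in> {0..pi/2}"
    note mcontD(1)[OF assms(1) this] mcontD(1)[OF assms(2) this]
    thus "(a \<cdot>\<^sub>m F \<theta> + b \<cdot>\<^sub>m G \<theta>) $$ (i, j) = a * F \<theta> $$ (i, j) + b * G \<theta> $$ (i, j)" using ij by simp
  qed
  also have "\<dots> = (a \<cdot>\<^sub>m mint n F + b \<cdot>\<^sub>m mint n G) $$ (i, j)"
    using ij mcont_integrable[OF assms(1) ij] mcont_integrable[OF assms(2) ij]
    by (simp add: integral_add integrable_on_mult_right)
  finally show "mint n (\<lambda>\<theta>. a \<cdot>\<^sub>m F \<theta> + b \<cdot>\<^sub>m G \<theta>) $$ (i, j) = (a \<cdot>\<^sub>m mint n F + b \<cdot>\<^sub>m mint n G) $$ (i, j)" .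
qed auto

text \<open>Fundamental theorem for the antiderivative \<open>F\<close> composed with
  \<open>arctan\<close>. It links the Lebesgue integral in the definition of the mean to a
  Henstock-Kurzweil integral over a compact interval.\<close>

lemma LINT_arctan_substitution:
  fixes f :: "real \<Rightarrow> complex"
  assumes f: "continuous_on {0..pi/2} f"
  shows "(LINT t:{0<..}|lborel. f (arctan t) / complex_of_real (1 + t\<^sup>2)) = integral {0..pi/2} f"
proof -
  have einf: "einterval 0 \<infinity> = {0<..}" by (auto simp: einterval_def)
  define F where "F u = integral {0..u} f" for u
  have rng: "arctan t \<in> {0<..<pi/2}" if "0 < t" for t using that arctan_ubound[of t] by (simp add: zero_less_arctan_iff)
  have cF: "continuous_on {0..pi/2} F"
    unfolding F_def by (rule indefinite_integral_continuous_1[OF integrable_continuous_interval[OF f]])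
  have dF: "(F has_vector_derivative f u) (at u)" if "u \<in> {0<..<pi/2}" for u
  proof -
    have "(F has_vector_derivative f u) (at u within {0..pi/2})"
      unfolding F_def by (rule integral_has_vector_derivative[OF f]) (use that in auto)
    thus ?thesis using that at_within_interior[of u "{0..pi/2}"] by (simp add: interior_atLeastAtMost_real)
  qed
  obtain K where "\<forall>z\<in>f ` {0..pi/2}. norm z \<le> K"
    using compact_imp_bounded[OF compact_continuous_image[OF f compact_Icc]] unfolding bounded_iff by blast
  hence K: "norm (f u) \<le> K" if "u \<in> {0..pi/2}" for u using that by blast
  have cf: "isCont (\<lambda>t. f (arctan t) / complex_of_real (1 + t\<^sup>2)) t" if "0 < t" for t
  proof -
    have ne: "complex_of_real (1 + t\<^sup>2) \<noteq> 0"
      unfolding of_real_eq_0_iff by (smt (verit) zero_le_power2)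
    have "isCont f (arctan t)"
      using f rng[OF that] by (intro continuous_on_interior[OF f]) (simp add: interior_atLeastAtMost_real)
    from isCont_o2[OF isCont_arctan this] have "isCont (\<lambda>t. f (arctan t)) t" .
    thus ?thesis using ne by (intro continuous_intros) auto
  qed
  \<comment> \<open>The bound \<open>K\<close> of the continuous \<open>f\<close> gives the
    integrable majorant K / (1 + t^2).\<close>
  have int: "set_integrable lborel {0<..} (\<lambda>t. f (arctan t) / complex_of_real (1 + t\<^sup>2))"
  proof (rule set_integrable_bound)
    have "set_integrable lborel (einterval (-\<infinity>) \<infinity>) (\<lambda>x. inverse (1 + x^2) :: real)"
      by (rule integrable_inverse_1_plus_square)
    hence "set_integrable lborel {0<..} (\<lambda>x. inverse (1 + x^2) :: real)"
      by (rule set_integrable_subset) (auto simp: einterval_def)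
    thus "set_integrable lborel {0<..} (\<lambda>x. K * inverse (1 + x^2))" by simp
    have "continuous_on {0<..} (\<lambda>t. f (arctan t) / complex_of_real (1 + t\<^sup>2))"
      using cf by (intro continuous_at_imp_continuous_on) auto
    thus "set_borel_measurable lborel {0<..} (\<lambda>t. f (arctan t) / complex_of_real (1 + t\<^sup>2))"
      unfolding set_borel_measurable_def by (simp add: borel_measurable_continuous_on_indicator)
    have "norm (f (arctan t) / complex_of_real (1 + t\<^sup>2)) \<le> norm (K * inverse (1 + t\<^sup>2))" if "0 < t" for t
    proof -
      have "norm (f (arctan t) / complex_of_real (1 + t\<^sup>2)) = norm (f (arctan t)) * inverse (1 + t\<^sup>2)"
        unfolding norm_divide norm_of_real by (simp add: divide_inverse)
      also have "\<dots> \<le> K * inverse (1 + t\<^sup>2)" using rng[OF that] by (intro mult_right_mono K) auto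
      finally show ?thesis by simp
    qed
    thus "AE t in lborel. t \<in> {0<..} \<longrightarrow> norm (f (arctan t) / complex_of_real (1 + t\<^sup>2)) \<le> norm (K * inverse (1 + t\<^sup>2))"
      by auto
  qed
  have "(LBINT t=0..\<infinity>. f (arctan t) / complex_of_real (1 + t\<^sup>2)) = F (pi/2) - F 0"
  proof (rule interval_integral_FTC_integrable)
    fix t assume "(0::ereal) < ereal t" "ereal t < \<infinity>"
    hence t: "0 < t" by simp
    have "(F \<circ> arctan has_vector_derivative (inverse (1 + t\<^sup>2)) *\<^sub>R f (arctan t)) (at t)"
      using rng[OF t] DERIV_arctan[of t]
      by (intro vector_diff_chain_at dF) (auto simp: has_real_derivative_iff_has_vector_derivative)
    thus "((F \<circ> arctan) has_vector_derivative f (arctan t) / complex_of_real (1 + t\<^sup>2)) (at t)"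
      by (simp add: scaleR_conv_of_real divide_inverse mult.commute)
    show "isCont (\<lambda>t. f (arctan t) / complex_of_real (1 + t\<^sup>2)) t" by (rule cf[OF t])
  next
    show "set_integrable lborel (einterval 0 \<infinity>) (\<lambda>t. f (arctan t) / complex_of_real (1 + t\<^sup>2))"
      using int by (simp add: einf)
    \<comment> \<open>The boundary values are approached within the closed interval, where
      continuity of \<open>F\<close> up to the ends is known.\<close>
    have "filterlim arctan (at 0 within {0..pi/2}) (at_right 0)"
      unfolding filterlim_at
    proof
      show "(arctan \<longlongrightarrow> 0) (at_right 0)" using tendsto_arctan[OF tendsto_ident_at, of 0 "{0<..}"] by simp
      show "\<forall>\<^sub>F x in at_right 0. arctan x \<in> {0..pi/2} \<and> arctan x \<noteq> 0"
        using eventually_at_right_less[of 0] by eventually_elim (use rng in force)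
    qed
    moreover have "(F \<longlongrightarrow> F 0) (at 0 within {0..pi/2})" using cF by (simp add: continuous_on_def)
    ultimately have "((\<lambda>t. F (arctan t)) \<longlongrightarrow> F 0) (at_right 0)" by (rule filterlim_compose[rotated])
    thus "((F \<circ> arctan \<circ> real_of_ereal) \<longlongrightarrow> F 0) (at_right 0)"
      unfolding zero_ereal_def ereal_tendsto_simps1 by (simp add: o_def)
    have "filterlim arctan (at (pi/2) within {0..pi/2}) at_top"
      unfolding filterlim_at
    proof
      show "(arctan \<longlongrightarrow> pi/2) at_top" by (rule tendsto_arctan_at_top)
      show "\<forall>\<^sub>F x in at_top. arctan x \<in> {0..pi/2} \<and> arctan x \<noteq> pi/2"
        using eventually_gt_at_top[of 0] by eventually_elim (use rng in force)
    qed
    moreover have "(F \<longlongrightarrow> F (pi/2)) (at (pi/2) within {0..pi/2})" using cF by (simp add: continuous_on_def)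
    ultimately have "((\<lambda>t. F (arctan t)) \<longlongrightarrow> F (pi/2)) at_top" by (rule filterlim_compose[rotated])
    thus "((F \<circ> arctan \<circ> real_of_ereal) \<longlongrightarrow> F (pi/2)) (at_left \<infinity>)"
      unfolding ereal_tendsto_simps1 by (simp add: o_def)
  qed simp
  thus ?thesis by (simp add: interval_lebesgue_integral_def einf F_def)
qed

section \<open>An integral for the inverse square root\<close>

lemma mder_constant:
  assumes "convex S" "\<And>x. x \<in> S \<Longrightarrow> mder n S x F (0\<^sub>m n n)" "x \<in> S" "y \<in> S"
  shows "F x = F y"
proof (rule eq_matI)
  note c = mderD(2)[OF assms(2)[OF assms(3)] assms(3)] mderD(2)[OF assms(2)[OF assms(4)] assms(4)]
  fix i j assume "i < dim_row (F y)" "j < dim_col (F y)"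
  hence ij: "i < n" "j < n" using c by auto
  have "((\<lambda>x. F x $$ (i, j)) has_derivative (\<lambda>h. 0)) (at x within S)" if "x \<in> S" for x
    using mderD(4)[OF assms(2)[OF that] ij] ij by (simp add: has_vector_derivative_def)
  from has_derivative_zero_constant[OF assms(1) this] show "F x $$ (i, j) = F y $$ (i, j)"
    using assms(3,4) by metis
next
  show "dim_row (F x) = dim_row (F y)" "dim_col (F x) = dim_col (F y)"
    using mderD(2)[OF assms(2)[OF assms(3)]] assms(3,4) by (metis carrier_matD)+
qed

text \<open>With \<open>Y \<tau> = (1 + \<tau> E)\<^sup>-\<^sup>1\<close> and \<open>R s = \<integral> Y (s cos\<^sup>2 \<theta>) d\<theta>\<close>, integrating the derivative of
  \<open>sin \<theta> cos \<theta> Y (s cos\<^sup>2 \<theta>)\<close> over \<open>[0, \<pi>/2]\<close> gives \<open>2 (1 + s E) R' s = - E R s\<close>, so that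
  \<open>R s\<^sup>2 (1 + s E)\<close> does not depend on \<open>s\<close>.\<close>

lemma inverse_sqrt_integral:
  fixes E :: "complex mat"
  assumes E: "E \<in> carrier_mat n n"
    and det: "\<And>\<tau>. \<tau> \<in> {0..1} \<Longrightarrow> det (1\<^sub>m n + complex_of_real \<tau> \<cdot>\<^sub>m E) \<noteq> 0"
  defines "Y \<equiv> \<lambda>\<tau>. minv (1\<^sub>m n + complex_of_real \<tau> \<cdot>\<^sub>m E)"
  defines "R \<equiv> \<lambda>s. mint n (\<lambda>\<theta>. Y (s * (cos \<theta>)\<^sup>2))"
  shows "R 1 * E = E * R 1" and "R 1 * R 1 * (1\<^sub>m n + E) = complex_of_real (pi\<^sup>2 / 4) \<cdot>\<^sub>m 1\<^sub>m n"
proof -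
  let ?I = "{0..1::real}"
  define M where "M \<tau> = 1\<^sub>m n + complex_of_real \<tau> \<cdot>\<^sub>m E" for \<tau>
  have M: "M \<tau> \<in> carrier_mat n n" for \<tau> unfolding M_def using E by simp
  have Y_M: "Y \<tau> = minv (M \<tau>)" for \<tau> by (simp add: Y_def M_def)
  have detM: "det (M \<tau>) \<noteq> 0" if "\<tau> \<in> ?I" for \<tau> using det[OF that] by (simp add: M_def)
  have Y: "Y \<tau> \<in> carrier_mat n n" "M \<tau> * Y \<tau> = 1\<^sub>m n" "Y \<tau> * M \<tau> = 1\<^sub>m n" if "\<tau> \<in> ?I" for \<tau>
    unfolding Y_M using minv[OF M detM[OF that]] by auto
  have ME: "M \<tau> * E = E * M \<tau>" for \<tau>
    unfolding M_def using E
    by (simp add: add_mult_distrib_mat[of _ n n _ E n] mult_add_distrib_mat[of E n n _ n]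
        mult_smult_assoc_mat[of E n n E n] mult_smult_distrib[of E n n E n])
  have YE: "Y \<tau> * E = E * Y \<tau>" if "\<tau> \<in> ?I" for \<tau>
  proof -
    note y = Y[OF that]
    have "Y \<tau> * E = Y \<tau> * (E * (M \<tau> * Y \<tau>))" using y E by simp
    also have "\<dots> = Y \<tau> * (M \<tau> * (E * Y \<tau>))"
      using ME[of \<tau>] assoc_mult_mat[OF E M y(1), of \<tau>] assoc_mult_mat[OF M E y(1), of \<tau>] by simp
    also have "\<dots> = E * Y \<tau>"
      using assoc_mult_mat[OF y(1) M mult_carrier_mat[OF E y(1)], of \<tau>] y E by simp
    finally show ?thesis .
  qed
  define Z where "Z \<tau> = Y \<tau> * Y \<tau>" for \<tau>
  have Z: "Z \<tau> \<in> carrier_mat n n" if "\<tau> \<in> ?I" for \<tau> using Y(1)[OF that] by (simp add: Z_def)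
  have EZ: "E * Z \<tau> \<in> carrier_mat n n" "E * (E * Z \<tau>) \<in> carrier_mat n n" if "\<tau> \<in> ?I" for \<tau>
    using E Z[OF that] by auto
  \<comment> \<open>Since Y = M Z, the terms below become combinations of Z, E Z and E E Z, and
    identities between them reduce to scalar ones.\<close>
  have YZ: "Y \<tau> = Z \<tau> + complex_of_real \<tau> \<cdot>\<^sub>m (E * Z \<tau>)" if "\<tau> \<in> ?I" for \<tau>
  proof -
    note y = Y[OF that]
    have "Y \<tau> = M \<tau> * Z \<tau>" unfolding Z_def using assoc_mult_mat[OF M y(1) y(1), of \<tau>] y by simp
    also have "\<dots> = Z \<tau> + complex_of_real \<tau> \<cdot>\<^sub>m (E * Z \<tau>)"
      unfolding M_def using add_mult_distrib_mat[OF one_carrier_mat smult_carrier_mat[OF E] Z[OF that]]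
        mult_smult_assoc_mat[OF E Z[OF that]] Z[OF that] by simp
    finally show ?thesis .
  qed
  have EY: "E * Y \<tau> = E * Z \<tau> + complex_of_real \<tau> \<cdot>\<^sub>m (E * (E * Z \<tau>))" if "\<tau> \<in> ?I" for \<tau>
    by (subst YZ[OF that])
       (simp add: mult_add_distrib_mat[OF E Z[OF that] smult_carrier_mat[OF EZ(1)[OF that]]]
          mult_smult_distrib[OF E EZ(1)[OF that]])
  have mM: "mcont n n ?I M" unfolding M_def
    using E by (intro mcont_add mcont_smult mcont_const continuous_intros) auto
  have mY: "mcont n n ?I Y" unfolding Y_M by (rule mcont_minv[OF mM detM])
  have mZ: "mcont n n ?I Z" unfolding Z_def by (rule mcont_mult[OF mY mY])
  have mEZ: "mcont n n ?I (\<lambda>\<tau>. E * Z \<tau>)" by (rule mcont_mult[OF mcont_const[OF E] mZ])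
  have dM: "mder n ?I \<tau> M E" if "\<tau> \<in> ?I" for \<tau>
  proof (rule mderI[OF that M E])
    fix i j assume ij: "i < n" "j < n"
    have "((\<lambda>y. 1\<^sub>m n $$ (i, j) + complex_of_real y * E $$ (i, j)) has_vector_derivative 0 + 1 * E $$ (i, j)) (at \<tau> within ?I)"
      by (intro has_vector_derivative_add has_vector_derivative_const has_vector_derivative_mult_left)
         (auto intro!: derivative_eq_intros)
    moreover have "M y $$ (i, j) = 1\<^sub>m n $$ (i, j) + complex_of_real y * E $$ (i, j)" for y
      unfolding M_def using E ij by simp
    ultimately show "((\<lambda>y. M y $$ (i, j)) has_vector_derivative E $$ (i, j)) (at \<tau> within ?I)" by simp
  qed
  have dY: "mder n ?I \<tau> Y (- (E * Z \<tau>))" if t: "\<tau> \<in> ?I" for \<tau>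
  proof -
    have "Y \<tau> * E * Y \<tau> = E * Z \<tau>"
      unfolding YE[OF t] Z_def by (rule assoc_mult_mat[OF E Y(1)[OF t] Y(1)[OF t]])
    thus ?thesis using mder_inverse[OF dM[OF t] mY Y(2,3)] by simp
  qed
  have st: "s * (cos \<theta>)\<^sup>2 \<in> ?I" if "s \<in> ?I" for s \<theta>
  proof -
    have "(cos \<theta>)\<^sup>2 \<le> 1" by (simp add: abs_square_le_1)
    hence "s * (cos \<theta>)\<^sup>2 \<le> 1 * 1" using that by (intro mult_mono) auto
    thus ?thesis using that by simp
  qed
  have cont_t: "continuous_on T (\<lambda>\<theta>. s * (cos \<theta>)\<^sup>2)" for s and T :: "real set"
    by (intro continuous_intros)
  have mYt: "mcont n n T (\<lambda>\<theta>. Y (s * (cos \<theta>)\<^sup>2))" if "s \<in> ?I" for s and T :: "real set"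
    by (rule mcont_compose[OF mY cont_t]) (use st[OF that] in blast)
  have mEZt: "mcont n n T (\<lambda>\<theta>. E * Z (s * (cos \<theta>)\<^sup>2))" if "s \<in> ?I" for s and T :: "real set"
    by (rule mcont_compose[OF mEZ cont_t]) (use st[OF that] in blast)
  \<comment> \<open>The derivative in \<open>s\<close> of the integrand of \<open>R\<close>: the
    derivative - E Z of \<open>Y\<close>, times the inner derivative cos^2 \<theta>.\<close>
  define F where "F s \<theta> = complex_of_real (- (cos \<theta>)\<^sup>2) \<cdot>\<^sub>m (E * Z (s * (cos \<theta>)\<^sup>2))" for s \<theta>
  have F: "F s \<theta> \<in> carrier_mat n n" if "s \<in> ?I" for s \<theta>
    unfolding F_def by (rule smult_carrier_mat[OF EZ(1)[OF st[OF that]]])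
  have mF: "mcont n n T (F s)" if "s \<in> ?I" for s and T :: "real set"
    unfolding F_def by (intro mcont_smult mEZt[OF that] continuous_intros)
  have dR: "mder n ?I s R (mint n (F s))" if s: "s \<in> ?I" for s
  proof (rule mderI[OF s])
    fix i j assume ij: "i < n" "j < n"
    have "((\<lambda>s. integral (cbox 0 (pi/2)) (\<lambda>\<theta>. Y (s * (cos \<theta>)\<^sup>2) $$ (i, j)))
        has_vector_derivative integral (cbox 0 (pi/2)) (\<lambda>\<theta>. F s \<theta> $$ (i, j))) (at s within ?I)"
    proof (rule leibniz_rule_vector_derivative)
      fix x \<theta> :: real assume x: "x \<in> ?I"
      let ?g = "\<lambda>x::real. x * (cos \<theta>)\<^sup>2"
      have "((\<lambda>\<tau>. Y \<tau> $$ (i, j)) has_vector_derivative (- (E * Z (?g x))) $$ (i, j)) (at (?g x) within ?I)"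
        by (rule mderD(4)[OF dY[OF st[OF x]] ij])
      hence "((\<lambda>\<tau>. Y \<tau> $$ (i, j)) has_vector_derivative (- (E * Z (?g x))) $$ (i, j)) (at (?g x) within ?g ` ?I)"
        by (rule has_vector_derivative_within_subset) (use st in blast)
      moreover have "(?g has_vector_derivative (cos \<theta>)\<^sup>2) (at x within ?I)"
        by (auto intro!: derivative_eq_intros simp: has_real_derivative_iff_has_vector_derivative[symmetric])
      ultimately have "((\<lambda>\<tau>. Y \<tau> $$ (i, j)) \<circ> ?g has_vector_derivative
          (cos \<theta>)\<^sup>2 *\<^sub>R (- (E * Z (?g x))) $$ (i, j)) (at x within ?I)"
        by (rule vector_diff_chain_within[rotated])
      moreover have "(cos \<theta>)\<^sup>2 *\<^sub>R (- (E * Z (?g x))) $$ (i, j) = F x \<theta> $$ (i, j)"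
        unfolding F_def using ij carrier_matD[OF EZ(1)[OF st[OF x, of \<theta>]]]
        by (simp add: scaleR_conv_of_real del: index_mult_mat(1))
      ultimately show "((\<lambda>x. Y (?g x) $$ (i, j)) has_vector_derivative F x \<theta> $$ (i, j)) (at x within ?I)"
        by (simp add: o_def)
    next
      fix x assume "x \<in> ?I"
      thus "(\<lambda>\<theta>. Y (x * (cos \<theta>)\<^sup>2) $$ (i, j)) integrable_on cbox 0 (pi/2)"
        using mcont_integrable[OF mYt ij] by simp
    next
      have "continuous_on (?I \<times> cbox 0 (pi/2)) (\<lambda>x. complex_of_real (- (cos (snd x))\<^sup>2) * (E * Z (fst x * (cos (snd x))\<^sup>2)) $$ (i, j))"
        by (intro continuous_intros continuous_on_compose2[OF mcontD(2)[OF mEZ ij]]) (use st in auto)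
      moreover have "F x \<theta> $$ (i, j) = complex_of_real (- (cos \<theta>)\<^sup>2) * (E * Z (x * (cos \<theta>)\<^sup>2)) $$ (i, j)"
        if "x \<in> ?I" for x \<theta>
        unfolding F_def using ij carrier_matD[OF EZ(1)[OF st[OF that, of \<theta>]]] by (simp del: index_mult_mat(1))
      ultimately show "continuous_on (?I \<times> cbox 0 (pi/2)) (\<lambda>(x, \<theta>). F x \<theta> $$ (i, j))"
        by (subst continuous_on_cong[OF refl]) (auto simp: case_prod_unfold simp del: of_real_minus index_mult_mat(1))
    qed (use s in auto)
    thus "((\<lambda>s. R s $$ (i, j)) has_vector_derivative mint n (F s) $$ (i, j)) (at s within ?I)"
      using ij by (simp add: R_def)
  qed (auto simp: R_def)
  have RE: "R s * E = E * R s" if "s \<in> ?I" for s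
  proof -
    have "R s * E = mint n (\<lambda>\<theta>. Y (s * (cos \<theta>)\<^sup>2) * E)"
      unfolding R_def by (rule mint_mult_right[OF E mYt[OF that], symmetric])
    also have "\<dots> = mint n (\<lambda>\<theta>. E * Y (s * (cos \<theta>)\<^sup>2))"
      by (rule mint_cong) (rule YE[OF st[OF that]])
    also have "\<dots> = E * R s" unfolding R_def by (rule mint_mult_left[OF E mYt[OF that]])
    finally show ?thesis .
  qed
  have ZE: "Z \<tau> * E = E * Z \<tau>" if "\<tau> \<in> ?I" for \<tau>
    using YE[OF that] assoc_mult_mat[OF Y(1)[OF that] Y(1)[OF that] E]
      assoc_mult_mat[OF Y(1)[OF that] E Y(1)[OF that]] assoc_mult_mat[OF E Y(1)[OF that] Y(1)[OF that]]
    unfolding Z_def by metis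
  have FE: "F s \<theta> * E = E * F s \<theta>" if "s \<in> ?I" for s \<theta>
    unfolding F_def
    using mult_smult_assoc_mat[OF EZ(1)[OF st[OF that]] E] mult_smult_distrib[OF E EZ(1)[OF st[OF that]]]
      assoc_mult_mat[OF E Z[OF st[OF that]] E] ZE[OF st[OF that]] by simp
  have R'E: "mint n (F s) * E = E * mint n (F s)" if "s \<in> ?I" for s
  proof -
    have "mint n (F s) * E = mint n (\<lambda>\<theta>. F s \<theta> * E)"
      by (rule mint_mult_right[OF E mF[OF that], symmetric])
    also have "\<dots> = mint n (\<lambda>\<theta>. E * F s \<theta>)" by (rule mint_cong) (rule FE[OF that])
    also have "\<dots> = E * mint n (F s)" by (rule mint_mult_left[OF E mF[OF that]])
    finally show ?thesis .
  qed
  have LR': "2 \<cdot>\<^sub>m (M s * mint n (F s)) + 1 \<cdot>\<^sub>m (E * R s) = 0\<^sub>m n n" if s: "s \<in> ?I" for s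
  proof -
    \<comment> \<open>\<open>W\<close> vanishes at both ends of the interval, so its derivative
      \<open>W'\<close> integrates to zero. The form of \<open>W'\<close> below results from sin^2 =
      1 - cos^2 and Y = Z + t E Z with t = s cos^2 \<theta>.\<close>
    define W where "W \<theta> = complex_of_real (sin \<theta> * cos \<theta>) \<cdot>\<^sub>m Y (s * (cos \<theta>)\<^sup>2)" for \<theta>
    define W' where "W' \<theta> = complex_of_real (2 * (cos \<theta>)\<^sup>2 - 1) \<cdot>\<^sub>m Z (s * (cos \<theta>)\<^sup>2)
       + complex_of_real (s * (cos \<theta>)\<^sup>2) \<cdot>\<^sub>m (E * Z (s * (cos \<theta>)\<^sup>2))" for \<theta>
    have mW': "mcont n n T W'" for T :: "real set"
      unfolding W'_def
      by (intro mcont_add mcont_smult mEZt[OF s] continuous_intros mcont_compose[OF mZ cont_t]) (use st[OF s] in blast)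
    have "mint n W' = 0\<^sub>m n n"
    proof (rule eq_matI)
      fix i j assume "i < dim_row (0\<^sub>m n n :: complex mat)" "j < dim_col (0\<^sub>m n n :: complex mat)"
      hence ij: "i < n" "j < n" by auto
      have dW: "((\<lambda>\<theta>. complex_of_real (sin \<theta> * cos \<theta>) * Y (s * (cos \<theta>)\<^sup>2) $$ (i, j)) has_vector_derivative W' \<theta> $$ (i, j))
          (at \<theta> within {0..pi/2})" for \<theta>
      proof -
        let ?g = "\<lambda>\<theta>::real. s * (cos \<theta>)\<^sup>2" and ?T = "{0..pi/2}"
        have "((\<lambda>\<tau>. Y \<tau> $$ (i, j)) has_vector_derivative (- (E * Z (?g \<theta>))) $$ (i, j)) (at (?g \<theta>) within ?I)"
          by (rule mderD(4)[OF dY[OF st[OF s]] ij])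
        hence "((\<lambda>\<tau>. Y \<tau> $$ (i, j)) has_vector_derivative (- (E * Z (?g \<theta>))) $$ (i, j)) (at (?g \<theta>) within ?g ` ?T)"
          by (rule has_vector_derivative_within_subset) (use st[OF s] in blast)
        moreover have "(?g has_vector_derivative - 2 * s * sin \<theta> * cos \<theta>) (at \<theta> within ?T)"
          by (auto intro!: derivative_eq_intros simp: has_real_derivative_iff_has_vector_derivative[symmetric])
        ultimately have 1: "((\<lambda>\<tau>. Y \<tau> $$ (i, j)) \<circ> ?g has_vector_derivative
            (- 2 * s * sin \<theta> * cos \<theta>) *\<^sub>R (- (E * Z (?g \<theta>))) $$ (i, j)) (at \<theta> within ?T)"
          by (rule vector_diff_chain_within[rotated])
        have 2: "((\<lambda>\<theta>. complex_of_real (sin \<theta> * cos \<theta>)) has_vector_derivative complex_of_real ((cos \<theta>)\<^sup>2 - (sin \<theta>)\<^sup>2)) (at \<theta> within ?T)"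
        proof (rule has_vector_derivative_of_real)
          show "((\<lambda>\<theta>. sin \<theta> * cos \<theta>) has_real_derivative (cos \<theta>)\<^sup>2 - (sin \<theta>)\<^sup>2) (at \<theta> within ?T)"
            by (auto intro!: derivative_eq_intros simp: power2_eq_square)
        qed
        have neg: "(- (E * Z (?g \<theta>))) $$ (i, j) = - ((E * Z (?g \<theta>)) $$ (i, j))"
          using ij carrier_matD[OF EZ(1)[OF st[OF s, of \<theta>]]] by (simp del: index_mult_mat(1))
        have Yij: "Y (?g \<theta>) $$ (i, j) = Z (?g \<theta>) $$ (i, j) + complex_of_real (?g \<theta>) * (E * Z (?g \<theta>)) $$ (i, j)"
          by (subst YZ[OF st[OF s]]) (use ij carrier_matD[OF EZ(1)[OF st[OF s, of \<theta>]]] in \<open>simp del: index_mult_mat(1)\<close>)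
        have W'ij: "W' \<theta> $$ (i, j) = complex_of_real (2 * (cos \<theta>)\<^sup>2 - 1) * Z (?g \<theta>) $$ (i, j)
            + complex_of_real (?g \<theta>) * (E * Z (?g \<theta>)) $$ (i, j)"
          unfolding W'_def using ij carrier_matD[OF EZ(1)[OF st[OF s, of \<theta>]]] carrier_matD[OF Z[OF st[OF s, of \<theta>]]]
          by (simp del: index_mult_mat(1))
        have sc: "complex_of_real (sin \<theta> ^ 2) = 1 - complex_of_real (cos \<theta> ^ 2)" by (simp add: sin_squared_eq)
        have "complex_of_real (sin \<theta> * cos \<theta>) * ((- 2 * s * sin \<theta> * cos \<theta>) *\<^sub>R (- (E * Z (?g \<theta>))) $$ (i, j))
           + complex_of_real ((cos \<theta>)\<^sup>2 - (sin \<theta>)\<^sup>2) * Y (?g \<theta>) $$ (i, j)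
           = 2 * s * complex_of_real (sin \<theta> ^ 2) * complex_of_real (cos \<theta> ^ 2) * (E * Z (?g \<theta>)) $$ (i, j)
             + (complex_of_real (cos \<theta> ^ 2) - complex_of_real (sin \<theta> ^ 2)) * Y (?g \<theta>) $$ (i, j)"
          unfolding neg by (simp add: scaleR_conv_of_real power2_eq_square algebra_simps del: index_mult_mat(1))
        also have "\<dots> = W' \<theta> $$ (i, j)"
          unfolding sc Yij W'ij by (simp add: algebra_simps del: index_mult_mat(1))
        finally show ?thesis
          using has_vector_derivative_mult[OF 2 1] by (simp add: o_def del: index_mult_mat(1))
      qed
      have "integral {0..pi/2} (\<lambda>\<theta>. W' \<theta> $$ (i, j))
          = complex_of_real (sin (pi/2) * cos (pi/2)) * Y (s * (cos (pi/2))\<^sup>2) $$ (i, j)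
            - complex_of_real (sin 0 * cos 0) * Y (s * (cos 0)\<^sup>2) $$ (i, j)"
        by (intro integral_unique fundamental_theorem_of_calculus dW) auto
      thus "mint n W' $$ (i, j) = 0\<^sub>m n n $$ (i, j)" using ij by simp
    qed auto
    hence z: "mint n (\<lambda>\<theta>. E * W' \<theta>) = 0\<^sub>m n n"
      using mint_mult_left[OF E mW'] E by simp
    have "2 \<cdot>\<^sub>m (M s * mint n (F s)) + 1 \<cdot>\<^sub>m (E * R s)
       = 2 \<cdot>\<^sub>m mint n (\<lambda>\<theta>. M s * F s \<theta>) + 1 \<cdot>\<^sub>m mint n (\<lambda>\<theta>. E * Y (s * (cos \<theta>)\<^sup>2))"
      unfolding R_def mint_mult_left[OF M mF[OF s]] mint_mult_left[OF E mYt[OF s]] ..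
    also have "\<dots> = mint n (\<lambda>\<theta>. 2 \<cdot>\<^sub>m (M s * F s \<theta>) + 1 \<cdot>\<^sub>m (E * Y (s * (cos \<theta>)\<^sup>2)))"
      by (rule mint_combination[symmetric]; intro mcont_mult[OF mcont_const mF[OF s]] mcont_mult[OF mcont_const mYt[OF s]] M E)
    \<comment> \<open>The integrand collapses to - E W'; the summand with coefficient 0 gives it the
      shape of \<open>mint_combination\<close>.\<close>
    also have "\<dots> = mint n (\<lambda>\<theta>. (-1) \<cdot>\<^sub>m (E * W' \<theta>) + 0 \<cdot>\<^sub>m (E * W' \<theta>))"
    proof (rule mint_cong)
      fix \<theta> :: real
      let ?t = "s * (cos \<theta>)\<^sup>2"
      let ?A = "E * Z ?t" and ?B = "E * (E * Z ?t)"
      note t = st[OF s, of \<theta>]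
      have EF: "E * F s \<theta> = complex_of_real (- (cos \<theta>)\<^sup>2) \<cdot>\<^sub>m ?B"
        unfolding F_def by (rule mult_smult_distrib[OF E EZ(1)[OF t]])
      have MF: "M s * F s \<theta> = F s \<theta> + complex_of_real s \<cdot>\<^sub>m (E * F s \<theta>)"
        unfolding M_def using add_mult_distrib_mat[OF one_carrier_mat smult_carrier_mat[OF E] F[OF s]]
          mult_smult_assoc_mat[OF E F[OF s]] left_mult_one_mat[OF F[OF s]] by simp
      have EW: "E * W' \<theta> = complex_of_real (2 * (cos \<theta>)\<^sup>2 - 1) \<cdot>\<^sub>m ?A + complex_of_real ?t \<cdot>\<^sub>m ?B"
        unfolding W'_def
        using mult_add_distrib_mat[OF E smult_carrier_mat[OF Z[OF t]] smult_carrier_mat[OF EZ(1)[OF t]]]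
          mult_smult_distrib[OF E Z[OF t]] mult_smult_distrib[OF E EZ(1)[OF t]] by simp
      show "2 \<cdot>\<^sub>m (M s * F s \<theta>) + 1 \<cdot>\<^sub>m (E * Y ?t) = (-1) \<cdot>\<^sub>m (E * W' \<theta>) + 0 \<cdot>\<^sub>m (E * W' \<theta>)"
        unfolding MF EF EW EY[OF t] unfolding F_def
        using EZ[OF t, THEN carrier_matD(1)] EZ[OF t, THEN carrier_matD(2)]
        by (intro eq_matI) (auto simp: algebra_simps simp del: index_mult_mat(1))
    qed
    also have "\<dots> = 0\<^sub>m n n"
      by (subst mint_combination) (auto intro!: mcont_mult[OF mcont_const mW'] E simp: z)
    finally show ?thesis .
  qed
  show "R 1 * E = E * R 1" by (rule RE) simp
  have d\<Phi>: "mder n ?I s (\<lambda>s. R s * R s * M s) (0\<^sub>m n n)" if s: "s \<in> ?I" for s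
  proof -
    let ?R' = "mint n (F s)"
    have cR: "R s \<in> carrier_mat n n" "?R' \<in> carrier_mat n n" by (simp_all add: R_def)
    note c = cR M[of s] E
    have comm: "X * M s = M s * X" if "X \<in> carrier_mat n n" "X * E = E * X" for X
      unfolding M_def using that E
      by (simp add: add_mult_distrib_mat[of _ n n _ X n] mult_add_distrib_mat[of X n n _ n]
        mult_smult_assoc_mat[of E n n X n] mult_smult_distrib[of X n n E n])
    have MR: "M s * ?R' = (-1/2) \<cdot>\<^sub>m (E * R s)"
    proof (rule eq_matI)
      fix i j assume "i < dim_row ((-1/2) \<cdot>\<^sub>m (E * R s))" "j < dim_col ((-1/2) \<cdot>\<^sub>m (E * R s))"
      hence ij: "i < n" "j < n" using c by auto
      have "(2 \<cdot>\<^sub>m (M s * ?R') + 1 \<cdot>\<^sub>m (E * R s)) $$ (i, j) = 0" using LR'[OF s] ij by simp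
      hence "2 * (M s * ?R') $$ (i, j) + (E * R s) $$ (i, j) = 0"
        using ij carrier_matD[OF M[of s]] carrier_matD[OF E] carrier_matD[OF cR(1)]
        by (simp del: index_mult_mat(1))
      hence "(E * R s) $$ (i, j) = - (2 * (M s * ?R') $$ (i, j))" by (simp only: add_eq_0_iff)
      thus "(M s * ?R') $$ (i, j) = ((-1/2) \<cdot>\<^sub>m (E * R s)) $$ (i, j)"
        using ij carrier_matD[OF E] carrier_matD[OF cR(1)] by (simp del: index_mult_mat(1))
    qed (use c in auto)
    have RRE: "R s * R s * E = R s * (E * R s)"
      using assoc_mult_mat[OF cR(1) cR(1) E] RE[OF s] by simp
    have "(?R' * R s) * M s = ?R' * (M s * R s)"
      using assoc_mult_mat[OF cR(2) cR(1) M[of s]] comm[OF cR(1) RE[OF s]] by simp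
    also have "\<dots> = (M s * ?R') * R s"
      using assoc_mult_mat[OF cR(2) M[of s] cR(1)] comm[OF cR(2) R'E[OF s]] by simp
    also have "\<dots> = (-1/2) \<cdot>\<^sub>m (E * R s * R s)"
      unfolding MR by (rule mult_smult_assoc_mat[OF mult_carrier_mat[OF E cR(1)] cR(1)])
    also have "E * R s * R s = R s * R s * E"
      using RE[OF s] RRE assoc_mult_mat[OF cR(1) E cR(1)] by simp
    finally have t1: "(?R' * R s) * M s = (-1/2) \<cdot>\<^sub>m (R s * R s * E)" .
    have "(R s * ?R') * M s = R s * (M s * ?R')"
      using assoc_mult_mat[OF cR(1) cR(2) M[of s]] comm[OF cR(2) R'E[OF s]] by simp
    also have "\<dots> = (-1/2) \<cdot>\<^sub>m (R s * R s * E)"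
      unfolding MR RRE by (rule mult_smult_distrib[OF cR(1) mult_carrier_mat[OF E cR(1)]])
    finally have t2: "(R s * ?R') * M s = (-1/2) \<cdot>\<^sub>m (R s * R s * E)" .
    \<comment> \<open>\<open>R\<close> and its derivative commute with \<open>M s\<close>, so each
      of the two terms with the derivative equals - R R E / 2; together they cancel the term that
      stems from differentiating \<open>M\<close>.\<close>
    have "(?R' * R s + R s * ?R') * M s + R s * R s * E = 0\<^sub>m n n"
    proof -
      have "(?R' * R s + R s * ?R') * M s = (?R' * R s) * M s + (R s * ?R') * M s"
        by (rule add_mult_distrib_mat[OF mult_carrier_mat[OF cR(2) cR(1)] mult_carrier_mat[OF cR(1) cR(2)] M])
      moreover have "R s * R s * E \<in> carrier_mat n n" using c by auto
      moreover have "(-1/2) \<cdot>\<^sub>m X + (-1/2) \<cdot>\<^sub>m X + X = 0\<^sub>m n n" if "X \<in> carrier_mat n n" for X :: "complex mat"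
        using that by (intro eq_matI) auto
      ultimately show ?thesis unfolding t1 t2 by metis
    qed
    thus ?thesis using mder_mult[OF mder_mult[OF dR[OF s] dR[OF s]] dM[OF s]] by simp
  qed
  have "R 1 * R 1 * M 1 = R 0 * R 0 * M 0"
    by (rule mder_constant[OF _ d\<Phi>]) auto
  moreover have "M 0 = 1\<^sub>m n" unfolding M_def using E by (intro eq_matI) auto
  \<comment> \<open>At 0 the integrand is the identity, so pi/2 is the length of the interval; its
    square is the constant in the claim.\<close>
  moreover have "R 0 = complex_of_real (pi/2) \<cdot>\<^sub>m 1\<^sub>m n"
  proof -
    have "Y 0 = 1\<^sub>m n" using Y[of 0] \<open>M 0 = 1\<^sub>m n\<close> by simp
    thus ?thesis unfolding R_def by (intro eq_matI) (auto simp: scaleR_conv_of_real)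
  qed
  moreover have "complex_of_real (pi/2) \<cdot>\<^sub>m 1\<^sub>m n * (complex_of_real (pi/2) \<cdot>\<^sub>m 1\<^sub>m n) * 1\<^sub>m n
      = complex_of_real (pi\<^sup>2 / 4) \<cdot>\<^sub>m 1\<^sub>m n"
    by (simp add: mult_smult_distrib[of _ n n] mult_smult_assoc_mat[of _ n n] power2_eq_square)
       (auto intro!: eq_matI)
  moreover have "M 1 = 1\<^sub>m n + E" unfolding M_def using E by (intro eq_matI) auto
  ultimately show "R 1 * R 1 * (1\<^sub>m n + E) = complex_of_real (pi\<^sup>2 / 4) \<cdot>\<^sub>m 1\<^sub>m n" by simp
qed

section \<open>The geometric mean of accretive matrices\<close>

lemma smult_smult_times: "a \<cdot>\<^sub>m (b \<cdot>\<^sub>m M) = (a * b) \<cdot>\<^sub>m (M :: 'a :: semigroup_mult mat)"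
  by (rule eq_matI) (auto simp: mult.assoc)

lemma one_smult [simp]: "1 \<cdot>\<^sub>m M = (M :: 'a :: monoid_mult mat)"
  by (rule eq_matI) auto

lemma hform_expand: "hform N M v = (\<Sum>i<N. \<Sum>j<N. cnj (v i) * v j * M $$ (i, j))"
  by (simp add: hform_def mapply_def sum_distrib_left mult_ac)

lemma hform_mint:
  assumes "mcont N N {0..pi/2} F"
  shows "hform N (mint N F) v = integral {0..pi/2} (\<lambda>\<theta>. hform N (F \<theta>) v)"
proof -
  have "integral {0..pi/2} (\<lambda>\<theta>. hform N (F \<theta>) v)
      = (\<Sum>i<N. \<Sum>j<N. integral {0..pi/2} (\<lambda>\<theta>. cnj (v i) * v j * F \<theta> $$ (i, j)))"
  proof -
    have int: "(\<lambda>\<theta>. cnj (v i) * v j * F \<theta> $$ (i, j)) integrable_on {0..pi/2}" if "i < N" "j < N" for i j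
      by (intro integrable_on_mult_right mcont_integrable[OF assms that])
    have "integral {0..pi/2} (\<lambda>\<theta>. hform N (F \<theta>) v)
        = (\<Sum>i<N. integral {0..pi/2} (\<lambda>\<theta>. \<Sum>j<N. cnj (v i) * v j * F \<theta> $$ (i, j)))"
      unfolding hform_expand by (rule integral_sum) (auto intro!: integrable_sum int)
    also have "\<dots> = (\<Sum>i<N. \<Sum>j<N. integral {0..pi/2} (\<lambda>\<theta>. cnj (v i) * v j * F \<theta> $$ (i, j)))"
      by (intro sum.cong refl integral_sum) (auto intro!: int)
    finally show ?thesis .
  qed
  thus ?thesis by (simp add: hform_expand)
qed

lemma continuous_on_hform:
  assumes "mcont N N S F"
  shows "continuous_on S (\<lambda>x. hform N (F x) v)"
  unfolding hform_expand by (intro continuous_intros mcontD(2)[OF assms]) auto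

text \<open>The real part of the form is continuous and positive on a compact interval, so its
  positive minimum bounds the integral from below.\<close>

lemma accr_mint:
  assumes m: "mcont N N {0..pi/2} F" and acc: "\<And>\<theta>. \<theta> \<in> {0..pi/2} \<Longrightarrow> accr N (F \<theta>)"
  shows "accr N (mint N F)"
  unfolding accr_def
proof safe
  fix v i assume v: "i < N" "v i \<noteq> (0::complex)"
  let ?h = "\<lambda>\<theta>. Re (hform N (F \<theta>) v)"
  have ch: "continuous_on {0..pi/2} (\<lambda>\<theta>. hform N (F \<theta>) v)" by (rule continuous_on_hform[OF m])
  hence ch': "continuous_on {0..pi/2} ?h" by (intro continuous_intros)
  obtain \<theta>0 where t: "\<theta>0 \<in> {0..pi/2}" "\<And>\<theta>. \<theta> \<in> {0..pi/2} \<Longrightarrow> ?h \<theta>0 \<le> ?h \<theta>"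
    using continuous_attains_inf[OF compact_Icc _ ch'] by auto
  have "0 < ?h \<theta>0" using accrD[OF acc[OF t(1)] v(1), of v] v(2) by simp
  hence "0 < integral {0..pi/2} (\<lambda>\<theta>. ?h \<theta>0)" by simp
  also have "\<dots> \<le> integral {0..pi/2} ?h"
    by (rule integral_le) (use t(2) in \<open>auto intro!: integrable_continuous_interval ch'\<close>)
  also have "\<dots> = Re (integral {0..pi/2} (\<lambda>\<theta>. hform N (F \<theta>) v))"
    using integral_linear[OF integrable_continuous_interval[OF ch] bounded_linear_Re] by (simp add: o_def)
  finally show "0 < Re (hform N (mint N F) v)" unfolding hform_mint[OF m] .
qed simp

text \<open>Under \<open>t = tan \<theta>\<close> the integral in the definition of the geometric mean becomes the integral
  of the inverses of \<open>sin\<^sup>2 \<theta> A + cos\<^sup>2 \<theta> B\<close> over \<open>[0, \<pi>/2]\<close>.\<close>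

definition trig_pencil :: "complex mat \<Rightarrow> complex mat \<Rightarrow> real \<Rightarrow> complex mat" where
  "trig_pencil A B \<theta> = complex_of_real ((sin \<theta>)\<^sup>2) \<cdot>\<^sub>m A + complex_of_real ((cos \<theta>)\<^sup>2) \<cdot>\<^sub>m B"

definition gmean_inv :: "nat \<Rightarrow> complex mat \<Rightarrow> complex mat \<Rightarrow> complex mat" where
  "gmean_inv N A B = complex_of_real (2 / pi) \<cdot>\<^sub>m mint N (\<lambda>\<theta>. minv (trig_pencil A B \<theta>))"

lemma accr_trig_pencil: "accr N A \<Longrightarrow> accr N B \<Longrightarrow> accr N (trig_pencil A B \<theta>)"
  unfolding trig_pencil_def by (rule accr_combination) auto

lemma mcont_trig_pencil:
  assumes "accr N A" "accr N B"
  shows "mcont N N S (\<lambda>\<theta>. minv (trig_pencil A B \<theta>))"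
  unfolding trig_pencil_def
  by (intro mcont_minv mcont_add mcont_smult mcont_const continuous_intros accr_carrier[OF assms(1)]
      accr_carrier[OF assms(2)] accr_det_nonzero[OF accr_trig_pencil[OF assms, unfolded trig_pencil_def]])

lemma accr_smult:
  assumes "accr N A" "0 < a"
  shows "accr N (complex_of_real a \<cdot>\<^sub>m A)"
  using assms by (auto simp: accr_def hform_smult)

lemma accr_gmean_inv:
  assumes "accr N A" "accr N B"
  shows "accr N (gmean_inv N A B)"
  unfolding gmean_inv_def
  by (intro accr_smult accr_mint mcont_trig_pencil accr_minv accr_trig_pencil assms) simp

text \<open>With C = A^-1 B the pencil is \<open>A\<close> times a point of the segment from the
  identity to C, so the integral J equals Q A^-1, where Q commutes with C and Q Q C = 1. Hence J B J
  = A^-1, and cancelling J on both sides gives the claim.\<close>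

lemma gmean_inv_equation:
  assumes A: "accr N A" and B: "accr N B"
  defines "G \<equiv> minv (gmean_inv N A B)"
  shows "B = G * minv A * G"
proof -
  note cA = accr_carrier[OF A] and cB = accr_carrier[OF B]
  note iA = minv[OF cA accr_det_nonzero[OF A]]
  \<comment> \<open>With this \<open>E\<close> the matrices 1 + \<tau> E run along the segment from
    the identity to A^-1 B, as \<open>inverse_sqrt_integral\<close> requires.\<close>
  define E where "E = minv A * B - 1\<^sub>m N"
  have cAB: "minv A * B \<in> carrier_mat N N" by (rule mult_carrier_mat[OF iA(1) cB])
  have E: "E \<in> carrier_mat N N" unfolding E_def by (rule minus_carrier_mat[OF one_carrier_mat])
  have "1\<^sub>m N + (X - 1\<^sub>m N) = X" if "X \<in> carrier_mat N N" for X :: "complex mat"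
    using that by (intro eq_matI) auto
  from this[OF cAB] have E1: "1\<^sub>m N + E = minv A * B" by (simp add: E_def)
  define M where "M \<tau> = 1\<^sub>m N + complex_of_real \<tau> \<cdot>\<^sub>m E" for \<tau>
  have M: "M \<tau> \<in> carrier_mat N N" for \<tau> unfolding M_def using E by simp
  have AM: "A * M \<tau> = complex_of_real (1 - \<tau>) \<cdot>\<^sub>m A + complex_of_real \<tau> \<cdot>\<^sub>m B" for \<tau>
  proof -
    have AE: "A * E = B - A"
      unfolding E_def using mult_minus_distrib_mat[OF cA cAB one_carrier_mat] assoc_mult_mat[OF cA iA(1) cB] iA cA cB
      by simp
    have "A * M \<tau> = A + complex_of_real \<tau> \<cdot>\<^sub>m (B - A)"
      unfolding M_def using mult_add_distrib_mat[OF cA one_carrier_mat smult_carrier_mat[OF E]]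
        mult_smult_distrib[OF cA E] cA AE by simp
    also have "\<dots> = complex_of_real (1 - \<tau>) \<cdot>\<^sub>m A + complex_of_real \<tau> \<cdot>\<^sub>m B"
      using cA cB by (intro eq_matI) (auto simp: algebra_simps)
    finally show ?thesis .
  qed
  have detM: "det (M \<tau>) \<noteq> 0" if "\<tau> \<in> {0..1}" for \<tau>
  proof -
    have "accr N (A * M \<tau>)" unfolding AM by (rule accr_combination[OF A B]) (use that in auto)
    from accr_det_nonzero[OF this] show ?thesis using det_mult[OF cA M] by auto
  qed
  define R where "R = mint N (\<lambda>\<theta>. minv (M (1 * (cos \<theta>)\<^sup>2)))"
  have sqrtR: "R * E = E * R" "R * R * (1\<^sub>m N + E) = complex_of_real (pi\<^sup>2 / 4) \<cdot>\<^sub>m 1\<^sub>m N"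
    unfolding R_def M_def
    by (rule inverse_sqrt_integral[OF E detM[unfolded M_def]]; assumption)+
  have R: "R \<in> carrier_mat N N" by (simp add: R_def)
  have cos01: "(cos \<theta>)\<^sup>2 \<in> {0..1}" for \<theta> :: real by (simp add: abs_square_le_1)
  have pencil: "minv (trig_pencil A B \<theta>) = minv (M (1 * (cos \<theta>)\<^sup>2)) * minv A" for \<theta>
  proof -
    let ?M = "M ((cos \<theta>)\<^sup>2)"
    note iM = minv[OF M detM[OF cos01], of \<theta>]
    have "trig_pencil A B \<theta> = A * ?M"
      unfolding AM trig_pencil_def by (simp add: sin_squared_eq)
    moreover have "A * ?M * (minv ?M * minv A) = A * ((?M * minv ?M) * minv A)"
      using assoc_mult_mat[OF cA M mult_carrier_mat[OF iM(1) iA(1)]] assoc_mult_mat[OF M iM(1) iA(1)] by simp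
    moreover have "A * ((?M * minv ?M) * minv A) = 1\<^sub>m N" using iM(2) iA by simp
    ultimately have "minv ?M * minv A = minv (trig_pencil A B \<theta>)"
      using minv_unique[OF mult_carrier_mat[OF cA M] mult_carrier_mat[OF iM(1) iA(1)]] by metis
    thus ?thesis by simp
  qed
  have mMi: "mcont N N {0..pi/2} (\<lambda>\<theta>. minv (M (1 * (cos \<theta>)\<^sup>2)))"
    unfolding M_def
    by (intro mcont_minv mcont_add mcont_smult mcont_const continuous_intros E one_carrier_mat
        detM[unfolded M_def]) (use cos01 in auto)
  define Q where "Q = complex_of_real (2 / pi) \<cdot>\<^sub>m R"
  define C where "C = minv A * B"
  have Q: "Q \<in> carrier_mat N N" and C: "C \<in> carrier_mat N N" using R cAB by (auto simp: Q_def C_def)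
  define J where "J = gmean_inv N A B"
  have J: "J = Q * minv A"
  proof -
    have "mint N (\<lambda>\<theta>. minv (trig_pencil A B \<theta>)) = R * minv A"
      unfolding pencil R_def by (rule mint_mult_right[OF iA(1) mMi])
    thus ?thesis unfolding J_def gmean_inv_def Q_def using mult_smult_assoc_mat[OF R iA(1)] by simp
  qed
  have "R * C = C * R"
    unfolding C_def E1[symmetric]
    using mult_add_distrib_mat[OF R one_carrier_mat E] add_mult_distrib_mat[OF one_carrier_mat E R] sqrtR(1) R by simp
  hence QC: "Q * C = C * Q"
    unfolding Q_def using mult_smult_assoc_mat[OF R C] mult_smult_distrib[OF C R] by simp
  \<comment> \<open>The square of the factor 2/pi from the definition cancels the constant
    pi^2/4.\<close>
  have QQC: "Q * Q * C = 1\<^sub>m N"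
  proof -
    have "Q * Q * C = (complex_of_real (2/pi) * complex_of_real (2/pi)) \<cdot>\<^sub>m (R * R * C)"
      unfolding Q_def using mult_smult_assoc_mat[OF R smult_carrier_mat[OF R]] mult_smult_distrib[OF R R]
        mult_smult_assoc_mat[OF mult_carrier_mat[OF R R] C]
        mult_smult_assoc_mat[OF smult_carrier_mat[OF mult_carrier_mat[OF R R]] C]
      by (simp add: smult_smult_times)
    also have "R * R * C = complex_of_real (pi\<^sup>2 / 4) \<cdot>\<^sub>m 1\<^sub>m N" using sqrtR(2) by (simp add: E1 C_def)
    finally show ?thesis by (simp add: smult_smult_times power2_eq_square)
  qed
  have cJ: "J \<in> carrier_mat N N" unfolding J by (rule mult_carrier_mat[OF Q iA(1)])
  have "accr N J" unfolding J_def by (rule accr_gmean_inv[OF A B])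
  note iJ = minv[OF cJ accr_det_nonzero[OF this]]
  have "J * B * J = Q * C * (Q * minv A)"
    unfolding J C_def using assoc_mult_mat[OF Q iA(1) cB] by simp
  also have "\<dots> = Q * C * Q * minv A"
    by (rule assoc_mult_mat[OF mult_carrier_mat[OF Q C] Q iA(1), symmetric])
  also have "Q * C * Q = Q * Q * C"
    using assoc_mult_mat[OF Q C Q] assoc_mult_mat[OF Q Q C] QC by simp
  finally have JBJ: "J * B * J = minv A" using QQC iA(1) by simp
  have "G * minv A * G = (G * J) * B * (J * G)"
    unfolding JBJ[symmetric] G_def J_def[symmetric] using iJ(1) cJ cB
    by (simp add: assoc_mult_mat[of _ N N _ N _ N] mult_carrier_mat[of _ N N _ N])
  also have "\<dots> = B" unfolding G_def J_def[symmetric] using iJ cB by simp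
  finally show ?thesis by simp
qed

lemma minv_smult:
  assumes "M \<in> carrier_mat n n" "det M \<noteq> 0" "c \<noteq> 0"
  shows "minv (c \<cdot>\<^sub>m M) = (1 / c) \<cdot>\<^sub>m minv M"
proof (rule minv_unique[symmetric, where n = n])
  note m = minv[OF assms(1,2)]
  show "c \<cdot>\<^sub>m M * ((1 / c) \<cdot>\<^sub>m minv M) = 1\<^sub>m n"
    using mult_smult_assoc_mat[OF assms(1) smult_carrier_mat[OF m(1)]] mult_smult_distrib[OF assms(1) m(1)] m(2) assms(3)
    by (simp add: smult_smult_times)
qed (use assms minv[OF assms(1,2)] in auto)

lemma gmean_inv_entry:
  assumes A: "accr N A" and B: "accr N B" and ij: "i < N" "j < N"
  shows "(LINT t:{0<..}|lborel. complex_of_real (1 / t) *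
      minv (complex_of_real t \<cdot>\<^sub>m A + complex_of_real (1 / t) \<cdot>\<^sub>m B) $$ (i, j))
    = mint N (\<lambda>\<theta>. minv (trig_pencil A B \<theta>)) $$ (i, j)"
proof -
  have "complex_of_real (1 / t) * minv (complex_of_real t \<cdot>\<^sub>m A + complex_of_real (1 / t) \<cdot>\<^sub>m B) $$ (i, j)
      = minv (trig_pencil A B (arctan t)) $$ (i, j) / complex_of_real (1 + t\<^sup>2)" if t: "0 < t" for t
  proof -
    let ?K = "complex_of_real t \<cdot>\<^sub>m A + complex_of_real (1 / t) \<cdot>\<^sub>m B"
    \<comment> \<open>This is sin \<theta> cos \<theta> at \<theta> = arctan t; it turns t A + B / t
      into sin^2 \<theta> A + cos^2 \<theta> B. Taking inverses, it combines with 1 / t to the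
      density 1 / (1 + t^2) of d\<theta>.\<close>
    let ?c = "complex_of_real (t / (1 + t\<^sup>2))"
    have pos: "0 < 1 + t\<^sup>2" by (simp add: add_pos_nonneg)
    have K: "accr N ?K" by (rule accr_combination[OF A B]) (use t in \<open>auto simp: add_pos_pos\<close>)
    have s: "(sin (arctan t))\<^sup>2 = t / (1 + t\<^sup>2) * t" "(cos (arctan t))\<^sup>2 = t / (1 + t\<^sup>2) * (1 / t)"
      using t pos by (simp_all add: sin_arctan cos_arctan power_divide power2_eq_square)
    have "trig_pencil A B (arctan t) = ?c \<cdot>\<^sub>m ?K"
      unfolding trig_pencil_def s using accr_carrier[OF A] accr_carrier[OF B]
      by (intro eq_matI) (auto simp: distrib_left mult.assoc)
    hence "minv (trig_pencil A B (arctan t)) = (1 / ?c) \<cdot>\<^sub>m minv ?K"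
      using minv_smult[OF accr_carrier[OF K] accr_det_nonzero[OF K], of ?c] t pos
      by (simp only:) (metis divide_eq_0_iff less_irrefl of_real_eq_0_iff)
    hence "minv (trig_pencil A B (arctan t)) $$ (i, j) = (1 / ?c) * minv ?K $$ (i, j)"
      using minv(1)[OF accr_carrier[OF K] accr_det_nonzero[OF K]] ij by simp
    moreover have "(1 / ?c) / complex_of_real (1 + t\<^sup>2) = complex_of_real (1 / t)"
    proof -
      have "1 / (t / (1 + t\<^sup>2)) / (1 + t\<^sup>2) = 1 / t" using t pos by simp
      hence "complex_of_real (1 / (t / (1 + t\<^sup>2)) / (1 + t\<^sup>2)) = complex_of_real (1 / t)" by (rule arg_cong)
      thus ?thesis by (simp only: of_real_divide of_real_1)
    qed
    ultimately show ?thesis by (metis times_divide_eq_left)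
  qed
  hence "(LINT t:{0<..}|lborel. complex_of_real (1 / t) *
      minv (complex_of_real t \<cdot>\<^sub>m A + complex_of_real (1 / t) \<cdot>\<^sub>m B) $$ (i, j))
    = (LINT t:{0<..}|lborel. minv (trig_pencil A B (arctan t)) $$ (i, j) / complex_of_real (1 + t\<^sup>2))"
    by (intro set_lebesgue_integral_cong) auto
  also have "\<dots> = integral {0..pi/2} (\<lambda>\<theta>. minv (trig_pencil A B \<theta>) $$ (i, j))"
    by (rule LINT_arctan_substitution) (rule mcontD(2)[OF mcont_trig_pencil[OF A B] ij])
  finally show ?thesis using ij by simp
qed

section \<open>Tensors and block-circulant matrices\<close>

lemma carrier_tensorD:
  assumes "A \<in> carrier_tensor m n p" "0 < p"
  shows "length A = p" "t_rows A = m" "t_cols A = n" "k < p \<Longrightarrow> A ! k \<in> carrier_mat m n"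
  using assms by (auto simp: carrier_tensor_def t_rows_def t_cols_def)

lemma bcirc_carrier:
  assumes "A \<in> carrier_tensor n n p" "0 < p"
  shows "bcirc A \<in> carrier_mat (n * p) (n * p)"
  using carrier_tensorD[OF assms] by (simp add: bcirc_def Let_def)

lemma bcirc_index:
  assumes "A \<in> carrier_tensor n n p" "0 < p" "r < n * p" "c < n * p"
  shows "bcirc A $$ (r, c) = (A ! ((r div n + p - c div n) mod p)) $$ (r mod n, c mod n)"
  using carrier_tensorD[OF assms(1,2)] assms(3,4) by (simp add: bcirc_def Let_def)

text \<open>The block-circulant matrices are exactly the ones invariant under simultaneous shifts of
  row and column indices.\<close>

definition block_shift :: "nat \<Rightarrow> nat \<Rightarrow> nat \<Rightarrow> nat" where
  "block_shift n p r = (r + n) mod (n * p)"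

definition circulant :: "nat \<Rightarrow> nat \<Rightarrow> complex mat \<Rightarrow> bool" where
  "circulant n p M \<longleftrightarrow> M \<in> carrier_mat (n * p) (n * p) \<and>
     (\<forall>r<n * p. \<forall>c<n * p. M $$ (block_shift n p r, block_shift n p c) = M $$ (r, c))"

lemma block_shift_eq:
  assumes "0 < n"
  shows "block_shift n p r = n * (Suc (r div n) mod p) + r mod n"
  using assms by (simp add: block_shift_def mod_mult2_eq)

lemma block_index_less: "a < p \<Longrightarrow> i < n \<Longrightarrow> n * a + i < n * (p::nat)"
  by (metis mult.commute mult_le_mono2 add.commute Suc_leI mult_Suc_right add_less_le_mono order_less_le_trans add_strict_left_mono)

lemma block_shift_bij:
  assumes "0 < n" "0 < p"
  shows "bij_betw (block_shift n p) {..<n * p} {..<n * p}"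
proof -
  have "inj_on (block_shift n p) {..<n * p}"
  proof (rule inj_onI)
    fix x y assume xy: "x \<in> {..<n * p}" "y \<in> {..<n * p}" "block_shift n p x = block_shift n p y"
    have "block_shift n p z mod n = z mod n" "block_shift n p z div n = Suc (z div n) mod p" for z
      using assms by (simp_all add: block_shift_eq)
    hence e: "x mod n = y mod n" "Suc (x div n) mod p = Suc (y div n) mod p" using xy(3) by metis+
    have d: "x div n < p" "y div n < p"
      using xy by (simp_all add: less_mult_imp_div_less mult.commute)
    hence "x div n = y div n" using e(2) by (auto simp: mod_Suc split: if_splits)
    thus "x = y" using e(1) by (metis div_mult_mod_eq)
  qed
  moreover have "block_shift n p ` {..<n * p} \<subseteq> {..<n * p}"
    using assms by (auto simp: block_shift_def)
  ultimately show ?thesis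
    by (simp add: bij_betw_def endo_inj_surj)
qed

lemma block_shift_less: "0 < n \<Longrightarrow> 0 < p \<Longrightarrow> block_shift n p r < n * p"
  by (simp add: block_shift_def)

lemma circulant_bcirc:
  assumes A: "A \<in> carrier_tensor n n p" and n: "0 < n" and p: "0 < p"
  shows "circulant n p (bcirc A)"
  unfolding circulant_def
proof safe
  show "bcirc A \<in> carrier_mat (n * p) (n * p)" by (rule bcirc_carrier[OF A p])
  fix r c assume rc: "r < n * p" "c < n * p"
  have d: "r div n < p" "c div n < p" using rc by (simp_all add: less_mult_imp_div_less mult.commute)
  \<comment> \<open>Both block indices advance by one modulo \<open>p\<close>; a wrap of either
    changes the difference by a multiple of \<open>p\<close> only.\<close>
  have "(Suc a mod p + p - Suc b mod p) mod p = (a + p - b) mod p" if "a < p" "b < p" for a b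
  proof (cases "Suc a = p"; cases "Suc b = p")
    assume "Suc a = p" "Suc b \<noteq> p"
    thus ?thesis using that by (auto simp: mod_if)
  next
    assume *: "Suc a \<noteq> p" "Suc b = p"
    hence "Suc a mod p = Suc a" "Suc b mod p = 0" "a + p - b = Suc a" using that by auto
    hence "(Suc a mod p + p - Suc b mod p) mod p = (Suc a + p) mod p" by simp
    also have "\<dots> = (a + p - b) mod p" unfolding mod_add_self2 \<open>a + p - b = Suc a\<close> ..
    finally show ?thesis .
  qed (use that in auto)
  with d show "bcirc A $$ (block_shift n p r, block_shift n p c) = bcirc A $$ (r, c)"
    using block_shift_less[OF n p] rc n by (simp add: bcirc_index[OF A p] block_shift_eq)
qed

text \<open>Shift invariance moves any column block back to block 0 one step at a time, so the first
  block column determines the matrix. Products and the unit tensor are identified through it slice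
  by slice.\<close>

lemma circulant_eq_bcirc:
  assumes M: "circulant n p M" and n: "0 < n" and p: "0 < p"
    and A: "A \<in> carrier_tensor n n p"
    and eq: "\<And>k i j. k < p \<Longrightarrow> i < n \<Longrightarrow> j < n \<Longrightarrow> (A ! k) $$ (i, j) = M $$ (n * k + i, j)"
  shows "bcirc A = M"
proof -
  have block: "M $$ (n * a + i, n * b + j) = M $$ (n * ((a + p - b) mod p) + i, j)"
    if "b < p" "a < p" "i < n" "j < n" for a b i j
    using that
  proof (induction b arbitrary: a)
    case (Suc b)
    \<comment> \<open>The cyclic predecessor of \<open>a\<close>; adding \<open>p\<close> first
      makes 0 wrap to p - 1.\<close>
    define a' where "a' = (a + p - 1) mod p"
    have a': "a' < p" "Suc a' mod p = a" using p Suc.prems by (auto simp: a'_def mod_Suc_eq)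
    have "block_shift n p (n * a' + i) = n * a + i" "block_shift n p (n * b + j) = n * Suc b + j"
      using n a' Suc.prems by (simp_all add: block_shift_eq)
    hence "M $$ (n * a + i, n * Suc b + j) = M $$ (n * a' + i, n * b + j)"
      using M block_index_less[OF a'(1), of i n] block_index_less[of b p j n] Suc.prems
      by (metis circulant_def Suc_lessD)
    also have "\<dots> = M $$ (n * ((a' + p - b) mod p) + i, j)" using Suc a' by simp
    also have "(a' + p - b) mod p = (a + p - Suc b) mod p"
    proof -
      have "(a' + p - b) mod p = (a' + (p - b)) mod p" using Suc.prems by simp
      also have "\<dots> = (a + p - 1 + (p - b)) mod p" by (simp add: a'_def mod_add_left_eq)
      also have "a + p - 1 + (p - b) = (a + p - Suc b) + p" using Suc.prems by simp
      finally show ?thesis by simp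
    qed
    finally show ?case .
  qed simp
  show ?thesis
  proof (rule eq_matI)
    fix r c assume "r < dim_row M" "c < dim_col M"
    hence rc: "r < n * p" "c < n * p" using M by (auto simp: circulant_def)
    have d: "r div n < p" "c div n < p" using rc by (simp_all add: less_mult_imp_div_less mult.commute)
    have "bcirc A $$ (r, c) = M $$ (n * ((r div n + p - c div n) mod p) + r mod n, c mod n)"
      using n p by (simp add: bcirc_index[OF A p rc] eq)
    also have "\<dots> = M $$ (n * (r div n) + r mod n, n * (c div n) + c mod n)"
      by (rule block[symmetric]) (use d n in auto)
    finally show "bcirc A $$ (r, c) = M $$ (r, c)" by simp
  qed (use M bcirc_carrier[OF A p] in \<open>auto simp: circulant_def\<close>)
qed

lemma bcirc_first_column:
  assumes "A \<in> carrier_tensor n n p" "k < p" "i < n" "j < n"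
  shows "bcirc A $$ (n * k + i, j) = (A ! k) $$ (i, j)"
proof -
  have "j < n * p" using assms by (metis less_le_trans mult_le_mono2 mult_1_right Suc_leI less_zeroE neq0_conv One_nat_def)
  thus ?thesis using assms block_index_less[of k p i n] by (simp add: bcirc_index)
qed

lemma bcirc_inject:
  assumes A: "A \<in> carrier_tensor n n p" and B: "B \<in> carrier_tensor n n p" and p: "0 < p"
    and eq: "bcirc A = bcirc B"
  shows "A = B"
proof (rule nth_equalityI)
  show "length A = length B" using carrier_tensorD[OF A p] carrier_tensorD[OF B p] by simp
  fix k assume "k < length A"
  hence k: "k < p" using carrier_tensorD[OF A p] by simp
  show "A ! k = B ! k"
    using carrier_tensorD(4)[OF A p k] carrier_tensorD(4)[OF B p k]
      bcirc_first_column[OF A k] bcirc_first_column[OF B k] eq by (intro eq_matI) auto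
qed

definition tensor_of :: "nat \<Rightarrow> nat \<Rightarrow> complex mat \<Rightarrow> ctensor" where
  "tensor_of n p M = map (\<lambda>k. Matrix.mat n n (\<lambda>(i, j). M $$ (n * k + i, j))) [0..<p]"

lemma tensor_of_carrier: "tensor_of n p M \<in> carrier_tensor n n p"
  by (simp add: tensor_of_def carrier_tensor_def)

lemma bcirc_tensor_of:
  assumes "circulant n p M" "0 < n" "0 < p"
  shows "bcirc (tensor_of n p M) = M"
  by (rule circulant_eq_bcirc[OF assms tensor_of_carrier]) (simp add: tensor_of_def)

lemma circulant_mult:
  assumes A: "circulant n p A" and B: "circulant n p B" and n: "0 < n" and p: "0 < p"
  shows "circulant n p (A * B)"
  unfolding circulant_def
proof safe
  let ?s = "block_shift n p"
  have cA: "A \<in> carrier_mat (n * p) (n * p)" and cB: "B \<in> carrier_mat (n * p) (n * p)"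
    using A B by (auto simp: circulant_def)
  show "A * B \<in> carrier_mat (n * p) (n * p)" by (rule mult_carrier_mat[OF cA cB])
  fix r c assume rc: "r < n * p" "c < n * p"
  note s = block_shift_less[OF n p]
  have "(A * B) $$ (?s r, ?s c) = (\<Sum>l<n * p. A $$ (?s r, l) * B $$ (l, ?s c))"
    by (rule mult_mat_index[OF cA cB s s])
  also have "\<dots> = (\<Sum>l<n * p. A $$ (?s r, ?s l) * B $$ (?s l, ?s c))"
    by (rule sum.reindex_bij_betw[OF block_shift_bij[OF n p], symmetric])
  also have "\<dots> = (\<Sum>l<n * p. A $$ (r, l) * B $$ (l, c))"
    using A B rc by (intro sum.cong) (auto simp: circulant_def)
  also have "\<dots> = (A * B) $$ (r, c)" by (rule mult_mat_index[OF cA cB rc, symmetric])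
  finally show "(A * B) $$ (?s r, ?s c) = (A * B) $$ (r, c)" .
qed

lemma circulant_one:
  assumes "0 < n" "0 < p" shows "circulant n p (1\<^sub>m (n * p))"
  using assms bij_betw_imp_inj_on[OF block_shift_bij[OF assms]] block_shift_less[OF assms]
  by (auto simp: circulant_def inj_on_eq_iff)

text \<open>The shifted inverse is again a right inverse of \<open>M\<close>, because
  \<open>M\<close> is shift invariant; uniqueness identifies the two.\<close>

lemma circulant_minv:
  assumes M: "circulant n p M" and det: "det M \<noteq> 0" and n: "0 < n" and p: "0 < p"
  shows "circulant n p (minv M)"
proof -
  let ?s = "block_shift n p" and ?N = "n * p"
  have cM: "M \<in> carrier_mat ?N ?N" using M by (simp add: circulant_def)
  note m = minv[OF cM det] and s = block_shift_less[OF n p]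
  define X where "X = Matrix.mat ?N ?N (\<lambda>(r, c). minv M $$ (?s r, ?s c))"
  have X: "X \<in> carrier_mat ?N ?N" by (simp add: X_def)
  have "M * X = 1\<^sub>m ?N"
  proof (rule eq_matI)
    fix r c assume "r < dim_row (1\<^sub>m ?N :: complex mat)" "c < dim_col (1\<^sub>m ?N :: complex mat)"
    hence rc: "r < ?N" "c < ?N" by auto
    have "(M * X) $$ (r, c) = (\<Sum>l<?N. M $$ (r, l) * X $$ (l, c))" by (rule mult_mat_index[OF cM X rc])
    also have "\<dots> = (\<Sum>l<?N. M $$ (?s r, ?s l) * minv M $$ (?s l, ?s c))"
      using M rc by (intro sum.cong) (auto simp: circulant_def X_def)
    also have "\<dots> = (\<Sum>l<?N. M $$ (?s r, l) * minv M $$ (l, ?s c))"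
      by (rule sum.reindex_bij_betw[OF block_shift_bij[OF n p]])
    also have "\<dots> = (M * minv M) $$ (?s r, ?s c)" by (rule mult_mat_index[OF cM m(1) s s, symmetric])
    also have "\<dots> = 1\<^sub>m ?N $$ (r, c)"
      using circulant_one[OF n p] rc unfolding m(2) circulant_def by blast
    finally show "(M * X) $$ (r, c) = 1\<^sub>m ?N $$ (r, c)" .
  qed (use cM X in auto)
  hence eq: "X = minv M" by (rule minv_unique[OF cM X])
  show ?thesis
    unfolding circulant_def
  proof safe
    fix r c assume "r < ?N" "c < ?N"
    thus "minv M $$ (?s r, ?s c) = minv M $$ (r, c)"
      by (subst (2) eq[symmetric]) (simp add: X_def)
  qed (rule m(1))
qed

section \<open>The T-product and T-inverse through block-circulant matrices\<close>

lemma t_prod_index: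
  assumes A: "A \<in> carrier_tensor n n p" and B: "B \<in> carrier_tensor n m p" and p: "0 < p"
    and k: "k < p" "i < n" "j < m"
  shows "((A *\<^sub>T B) ! k) $$ (i, j) = (\<Sum>l<n * p. bcirc A $$ (n * k + i, l) * (B ! (l div n)) $$ (l mod n, j))"
proof -
  note a = carrier_tensorD[OF A p] and b = carrier_tensorD[OF B p]
  have U: "t_unfold B \<in> carrier_mat (n * p) m" using b by (simp add: t_unfold_def Let_def)
  have "((A *\<^sub>T B) ! k) $$ (i, j) = (bcirc A * t_unfold B) $$ (n * k + i, j)"
    using k a U by (simp add: t_prod_def t_fold_def mult.commute del: index_mult_mat(1))
  also have "\<dots> = (\<Sum>l<n * p. bcirc A $$ (n * k + i, l) * t_unfold B $$ (l, j))"
    by (rule mult_mat_index[OF bcirc_carrier[OF A p] U block_index_less[OF k(1,2)] k(3)])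
  also have "\<dots> = (\<Sum>l<n * p. bcirc A $$ (n * k + i, l) * (B ! (l div n)) $$ (l mod n, j))"
    using b k by (intro sum.cong) (auto simp: t_unfold_def Let_def)
  finally show ?thesis .
qed

lemma t_prod_carrier:
  assumes A: "A \<in> carrier_tensor n n p" and B: "B \<in> carrier_tensor n m p" and p: "0 < p"
  shows "A *\<^sub>T B \<in> carrier_tensor n m p"
  using carrier_tensorD[OF A p] carrier_tensorD[OF B p]
  by (simp add: t_prod_def t_fold_def carrier_tensor_def t_unfold_def Let_def)

text \<open>The unfolding of \<open>B\<close> is the first block column of \<open>bcirc B\<close>,
  so the T-product supplies the first block column of the matrix product, which is
  circulant.\<close>

lemma bcirc_t_prod:
  assumes A: "A \<in> carrier_tensor n n p" and B: "B \<in> carrier_tensor n n p" and n: "0 < n" and p: "0 < p"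
  shows "bcirc (A *\<^sub>T B) = bcirc A * bcirc B"
proof (rule circulant_eq_bcirc[OF circulant_mult[OF circulant_bcirc[OF A n p] circulant_bcirc[OF B n p] n p] n p
      t_prod_carrier[OF A B p]])
  fix k i j assume k: "k < p" "i < n" "j < n"
  have j: "j < n * p" using k(3) p by (metis less_le_trans mult_le_mono2 mult_1_right Suc_leI One_nat_def)
  have "((A *\<^sub>T B) ! k) $$ (i, j) = (\<Sum>l<n * p. bcirc A $$ (n * k + i, l) * bcirc B $$ (l, j))"
    unfolding t_prod_index[OF A B p k]
    using k j by (intro sum.cong) (auto simp: bcirc_index[OF B p] less_mult_imp_div_less mult.commute)
  also have "\<dots> = (bcirc A * bcirc B) $$ (n * k + i, j)"
    by (rule mult_mat_index[OF bcirc_carrier[OF A p] bcirc_carrier[OF B p] block_index_less[OF k(1,2)] j, symmetric])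
  finally show "((A *\<^sub>T B) ! k) $$ (i, j) = (bcirc A * bcirc B) $$ (n * k + i, j)" .
qed

lemma t_one_carrier: "t_one n p \<in> carrier_tensor n n p"
  by (simp add: t_one_def carrier_tensor_def)

lemma bcirc_t_one:
  assumes n: "0 < n" and p: "0 < p"
  shows "bcirc (t_one n p) = 1\<^sub>m (n * p)"
proof (rule circulant_eq_bcirc[OF circulant_one[OF n p] n p t_one_carrier])
  fix k i j assume k: "k < p" "i < n" "j < n"
  have j: "j < n * p" using k(3) p by (metis less_le_trans mult_le_mono2 mult_1_right Suc_leI One_nat_def)
  have "n * k + i = j \<longleftrightarrow> k = 0 \<and> i = j"
  proof
    assume e: "n * k + i = j"
    have "k = 0" using e k(3) by (cases k) auto
    thus "k = 0 \<and> i = j" using e by simp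
  qed simp
  thus "(t_one n p ! k) $$ (i, j) = 1\<^sub>m (n * p) $$ (n * k + i, j)"
    using k j block_index_less[OF k(1,2)] by (auto simp: t_one_def)
qed

lemma is_t_inverse_iff:
  assumes A: "A \<in> carrier_tensor n n p" and n: "0 < n" and p: "0 < p"
  shows "is_t_inverse A B \<longleftrightarrow> B \<in> carrier_tensor n n p \<and>
    bcirc A * bcirc B = 1\<^sub>m (n * p) \<and> bcirc B * bcirc A = 1\<^sub>m (n * p)"
proof -
  have "X *\<^sub>T Y = t_one n p \<longleftrightarrow> bcirc X * bcirc Y = 1\<^sub>m (n * p)"
    if "X \<in> carrier_tensor n n p" "Y \<in> carrier_tensor n n p" for X Y
    using bcirc_inject[OF t_prod_carrier[OF that p] t_one_carrier p] bcirc_t_prod[OF that n p] bcirc_t_one[OF n p]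
    by metis
  thus ?thesis using A carrier_tensorD[OF A p] by (auto simp: is_t_inverse_def Let_def)
qed

text \<open>The inverse matrix is circulant, hence \<open>bcirc\<close> of a tensor; injectivity of
  \<open>bcirc\<close> makes that tensor the only candidate.\<close>

lemma t_inverse_bcirc:
  assumes A: "A \<in> carrier_tensor n n p" and n: "0 < n" and p: "0 < p" and det: "det (bcirc A) \<noteq> 0"
  shows "t_inverse A \<in> carrier_tensor n n p" "bcirc (t_inverse A) = minv (bcirc A)"
proof -
  note c = bcirc_carrier[OF A p]
  note m = minv[OF c det]
  let ?B = "tensor_of n p (minv (bcirc A))"
  have B: "bcirc ?B = minv (bcirc A)"
    by (rule bcirc_tensor_of[OF circulant_minv[OF circulant_bcirc[OF A n p] det n p] n p])
  have "is_t_inverse A ?B"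
    unfolding is_t_inverse_iff[OF A n p] B using m tensor_of_carrier by simp
  moreover have "X = ?B" if "is_t_inverse A X" for X
  proof -
    have X: "X \<in> carrier_tensor n n p" "bcirc A * bcirc X = 1\<^sub>m (n * p)"
      using that is_t_inverse_iff[OF A n p] by auto
    have "bcirc X = bcirc ?B" unfolding B by (rule minv_unique[OF c bcirc_carrier[OF X(1) p] X(2)])
    thus ?thesis by (rule bcirc_inject[OF X(1) tensor_of_carrier p])
  qed
  ultimately have "t_inverse A = ?B" unfolding t_inverse_def by (rule the_equality)
  thus "t_inverse A \<in> carrier_tensor n n p" "bcirc (t_inverse A) = minv (bcirc A)"
    using B tensor_of_carrier by auto
qed

lemma t_combination:
  assumes A: "A \<in> carrier_tensor n n p" and B: "B \<in> carrier_tensor n n p" and p: "0 < p"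
  shows "a \<cdot>\<^sub>T A +\<^sub>T b \<cdot>\<^sub>T B \<in> carrier_tensor n n p"
    and "bcirc (a \<cdot>\<^sub>T A +\<^sub>T b \<cdot>\<^sub>T B) = a \<cdot>\<^sub>m bcirc A + b \<cdot>\<^sub>m bcirc B"
proof -
  note a = carrier_tensorD[OF A p] and b = carrier_tensorD[OF B p]
  show C: "a \<cdot>\<^sub>T A +\<^sub>T b \<cdot>\<^sub>T B \<in> carrier_tensor n n p"
    using a b by (simp add: carrier_tensor_def t_add_def t_smult_def)
  show "bcirc (a \<cdot>\<^sub>T A +\<^sub>T b \<cdot>\<^sub>T B) = a \<cdot>\<^sub>m bcirc A + b \<cdot>\<^sub>m bcirc B"
  proof (rule eq_matI)
    fix r c assume "r < dim_row (a \<cdot>\<^sub>m bcirc A + b \<cdot>\<^sub>m bcirc B)" "c < dim_col (a \<cdot>\<^sub>m bcirc A + b \<cdot>\<^sub>m bcirc B)"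
    hence rc: "r < n * p" "c < n * p" using bcirc_carrier[OF B p] by auto
    hence n: "0 < n" by (cases n) auto
    have k: "(r div n + p - c div n) mod p < p" using p by simp
    show "bcirc (a \<cdot>\<^sub>T A +\<^sub>T b \<cdot>\<^sub>T B) $$ (r, c) = (a \<cdot>\<^sub>m bcirc A + b \<cdot>\<^sub>m bcirc B) $$ (r, c)"
      using rc n a(1) b(1) k a(4)[OF k] b(4)[OF k] bcirc_carrier[OF A p] bcirc_carrier[OF B p]
        bcirc_index[OF A p rc] bcirc_index[OF B p rc]
      unfolding bcirc_index[OF C p rc] by (simp add: t_add_def t_smult_def)
  qed (use bcirc_carrier[OF A p] bcirc_carrier[OF B p] bcirc_carrier[OF C p] in auto)
qed

section \<open>Accretivity of tensors through the quadratic form of \<open>bcirc\<close>\<close>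

definition unfold_vec :: "nat \<Rightarrow> ctensor \<Rightarrow> nat \<Rightarrow> complex" where
  "unfold_vec n X r = (X ! (r div n)) $$ (r mod n, 0)"

text \<open>The order of the two sums follows \<open>t_inner\<close>, where the slice index is
  innermost.\<close>

lemma sum_blocks:
  fixes f :: "nat \<Rightarrow> 'a::comm_monoid_add"
  shows "(\<Sum>r<n * p. f r) = (\<Sum>i<n. \<Sum>k<p. f (n * k + i))"
proof -
  have "(\<Sum>r<n * p. f r) = (\<Sum>k<p. sum f {k * n..<k * n + n})"
    using sum.nat_group[of f n p] by (simp add: mult.commute)
  also have "\<dots> = (\<Sum>k<p. \<Sum>i<n. f (n * k + i))"
  proof (rule sum.cong[OF refl])
    fix k
    show "sum f {k * n..<k * n + n} = (\<Sum>i<n. f (n * k + i))"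
      using sum.shift_bounds_nat_ivl[of f 0 "k * n" n] by (simp add: lessThan_atLeast0 add.commute mult.commute)
  qed
  also have "\<dots> = (\<Sum>i<n. \<Sum>k<p. f (n * k + i))" by (rule sum.swap)
  finally show ?thesis .
qed

lemma t_inner_hform:
  assumes A: "A \<in> carrier_tensor n n p" and X: "X \<in> carrier_tensor n 1 p" and p: "0 < p"
  shows "t_inner X (A *\<^sub>T X) = hform (n * p) (bcirc A) (unfold_vec n X)"
proof -
  note x = carrier_tensorD[OF X p]
  have "hform (n * p) (bcirc A) (unfold_vec n X)
      = (\<Sum>i<n. \<Sum>k<p. cnj (unfold_vec n X (n * k + i)) * mapply (n * p) (bcirc A) (unfold_vec n X) (n * k + i))"
    unfolding hform_def by (rule sum_blocks)
  also have "\<dots> = (\<Sum>i<n. \<Sum>k<p. cnj ((X ! k) $$ (i, 0)) * ((A *\<^sub>T X) ! k) $$ (i, 0))"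
    by (intro sum.cong refl) (simp add: t_prod_index[OF A X p] unfold_vec_def mapply_def)
  also have "\<dots> = t_inner X (A *\<^sub>T X)" using x by (simp add: t_inner_def)
  finally show ?thesis by simp
qed

text \<open>Vectors of length \<open>n * p\<close> and n x 1 x p tensors correspond by unfolding,
  under which the two quadratic forms agree.\<close>

lemma accretive_iff:
  assumes n: "0 < n" and p: "0 < p"
  shows "A \<in> accretive n p \<longleftrightarrow> A \<in> carrier_tensor n n p \<and> accr (n * p) (bcirc A)"
proof safe
  assume acc: "A \<in> accretive n p"
  show A: "A \<in> carrier_tensor n n p" using acc by (simp add: accretive_def)
  show "accr (n * p) (bcirc A)"
    unfolding accr_def
  proof safe
    show "bcirc A \<in> carrier_mat (n * p) (n * p)" by (rule bcirc_carrier[OF A p])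
    fix v r assume r: "r < n * p" "v r \<noteq> (0::complex)"
    define X where "X = map (\<lambda>k. Matrix.mat n 1 (\<lambda>(i, j). v (n * k + i))) [0..<p]"
    have X: "X \<in> carrier_tensor n 1 p" by (simp add: X_def carrier_tensor_def)
    have d: "l div n < p" if "l < n * p" for l using that by (simp add: less_mult_imp_div_less mult.commute)
    have u: "unfold_vec n X l = v l" if "l < n * p" for l
      using n d[OF that] by (simp add: unfold_vec_def X_def)
    have "X \<noteq> t_zero n 1 p"
    proof
      assume "X = t_zero n 1 p"
      hence "unfold_vec n X r = 0" using n d[OF r(1)] by (simp add: unfold_vec_def t_zero_def)
      thus False using u[OF r(1)] r(2) by simp
    qed
    hence "0 < Re (t_inner X (A *\<^sub>T X))" using acc X by (simp add: accretive_def)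
    also have "t_inner X (A *\<^sub>T X) = hform (n * p) (bcirc A) v"
      unfolding t_inner_hform[OF A X p] by (rule hform_cong) (rule u)
    finally show "0 < Re (hform (n * p) (bcirc A) v)" .
  qed
next
  assume A: "A \<in> carrier_tensor n n p" "accr (n * p) (bcirc A)"
  show "A \<in> accretive n p"
    unfolding accretive_def
  proof safe
    fix X assume X: "X \<in> carrier_tensor n 1 p" "X \<noteq> t_zero n 1 p"
    note x = carrier_tensorD[OF X(1) p]
    have "\<exists>k<p. X ! k \<noteq> 0\<^sub>m n 1"
      using X(2) x(1) by (metis length_replicate nth_equalityI nth_replicate t_zero_def)
    then obtain k where k: "k < p" "X ! k \<noteq> 0\<^sub>m n 1" by blast
    then obtain i where i: "i < n" "(X ! k) $$ (i, 0) \<noteq> 0" using x(4)[OF k(1)] eq_matI[of "X ! k" "0\<^sub>m n 1"] by auto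
    have "0 < Re (hform (n * p) (bcirc A) (unfold_vec n X))"
      by (rule accrD[OF A(2) block_index_less[OF k(1) i(1)]]) (use i in \<open>simp add: unfold_vec_def\<close>)
    thus "0 < Re (t_inner X (A *\<^sub>T X))" unfolding t_inner_hform[OF A(1) X(1) p] .
  qed (rule A(1))
qed

lemma accretive_sectorial:
  assumes "A \<in> accretive n p" "0 < n" "0 < p"
  shows "t_sectorial A"
proof -
  have A: "A \<in> carrier_tensor n n p" using assms(1) by (simp add: accretive_def)
  note a = carrier_tensorD[OF A assms(3)]
  have "t_norm (t_zero n 1 p) = 0"
    using assms(3) by (simp add: t_norm_def t_zero_def t_rows_def t_cols_def)
  hence "t_inner X (A *\<^sub>T X) \<noteq> 0" if "X \<in> carrier_tensor n 1 p" "t_norm X = 1" for X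
    using that assms(1) by (force simp: accretive_def)
  thus ?thesis using a by (auto simp: t_sectorial_def t_numerical_range_def)
qed

section \<open>Majorization\<close>

lemma abs_less_pi_half_of_cos_pos:
  assumes "0 < cos x" "- pi < x" "x \<le> pi"
  shows "\<bar>x\<bar> < pi / 2"
proof (rule ccontr)
  assume "\<not> \<bar>x\<bar> < pi / 2"
  hence "cos \<bar>x\<bar> \<le> cos (pi / 2)" using assms by (intro cos_monotone_0_pi_le) auto
  thus False using assms(1) by simp
qed

text \<open>The definition admits phases in (-pi, pi]. In any admissible decomposition the diagonal
  factor is congruent to an accretive matrix, so all cosines are positive and the phases fall into
  the range of \<open>canonical_phases\<close>, where they are unique.\<close>

lemma t_phases_eq:
  assumes A: "A \<in> accretive n p" and n: "0 < n" and p: "0 < p"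
    and can: "canonical_phases (n * p) (bcirc A) T \<phi>"
  shows "t_phases A = Matrix.vec (n * p) \<phi>"
proof -
  let ?N = "n * p"
  have cA: "A \<in> carrier_tensor n n p" and acc: "accr ?N (bcirc A)"
    using A accretive_iff[OF n p] by auto
  have N: "t_rows A * length A = ?N" "0 < ?N" using carrier_tensorD[OF cA p] n p by auto
  have T: "T \<in> carrier_mat ?N ?N" and \<phi>: "\<And>k. k < ?N \<Longrightarrow> \<bar>\<phi> k\<bar> < pi / 2"
    "\<And>k l. k \<le> l \<Longrightarrow> l < ?N \<Longrightarrow> \<phi> l \<le> \<phi> k"
    and AT: "bcirc A = mat_adjoint T * mat_diag ?N (\<lambda>k. cis (\<phi> k)) * T"
    using can by (auto simp: canonical_phases_def)
  note iT = minv[OF T canonical_phases_det[OF acc can]]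
  have diag_cong: "mat_diag ?N (\<lambda>k. cis (vec_index \<psi> k)) = mat_diag ?N (\<lambda>k. cis (\<psi>' k))"
    if "\<And>k. k < ?N \<Longrightarrow> vec_index \<psi> k = \<psi>' k" for \<psi> \<psi>'
    using that by (intro eq_matI) (auto simp: mat_diag_def)
  have "is_canonical_t_phases A (Matrix.vec ?N \<phi>)"
    unfolding is_canonical_t_phases_def Let_def N
  proof (intro conjI allI impI bexI[of _ T])
    show "t_sectorial A" by (rule accretive_sectorial[OF A n p])
    show "invertible_mat T"
      unfolding invertible_mat_def inverts_mat_def using T iT by (auto intro!: exI[of _ "minv T"])
    show "bcirc A = mat_adjoint T * mat_diag ?N (\<lambda>k. cis (vec_index (Matrix.vec ?N \<phi>) k)) * T"
      unfolding AT by (subst diag_cong[of "Matrix.vec ?N \<phi>" \<phi>]) auto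
    have "\<bar>\<phi> 0\<bar> < pi / 2" "\<bar>\<phi> (?N - 1)\<bar> < pi / 2" using N(2) \<phi>(1)[of 0] \<phi>(1)[of "?N - 1"] by auto
    thus "vec_index (Matrix.vec ?N \<phi>) 0 - vec_index (Matrix.vec ?N \<phi>) (?N - 1) < pi"
      using N(2) by (simp add: abs_less_iff)
    fix k
    {
      assume "k < ?N"
      with \<phi>(1)[OF this] show "- pi < vec_index (Matrix.vec ?N \<phi>) k" "vec_index (Matrix.vec ?N \<phi>) k \<le> pi"
        by (auto simp: abs_less_iff)
    }
    fix l assume "k \<le> l \<and> l < ?N"
    thus "vec_index (Matrix.vec ?N \<phi>) l \<le> vec_index (Matrix.vec ?N \<phi>) k" using \<phi>(2) by simp
  qed (use T in auto)
  moreover have "\<psi> = Matrix.vec ?N \<phi>" if "is_canonical_t_phases A \<psi>" for \<psi>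
  proof -
    let ?D = "mat_diag ?N (\<lambda>k. cis (vec_index \<psi> k))"
    have \<psi>: "\<psi> \<in> carrier_vec ?N" "\<And>k. k < ?N \<Longrightarrow> - pi < vec_index \<psi> k \<and> vec_index \<psi> k \<le> pi"
      "\<And>k l. k \<le> l \<Longrightarrow> l < ?N \<Longrightarrow> vec_index \<psi> l \<le> vec_index \<psi> k"
      using that unfolding is_canonical_t_phases_def Let_def N by auto
    have "\<exists>S\<in>carrier_mat ?N ?N. invertible_mat S \<and> bcirc A = mat_adjoint S * ?D * S"
      using that unfolding is_canonical_t_phases_def Let_def N by (elim conjE)
    then obtain S where S: "S \<in> carrier_mat ?N ?N" and S2: "invertible_mat S \<and> bcirc A = mat_adjoint S * ?D * S"
      by (rule bexE)
    from S2 have AS: "bcirc A = mat_adjoint S * ?D * S" by (rule conjunct2)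
    have "det S \<noteq> 0"
      using congruence_factor_det[OF S mat_diag_dim] accr_det_nonzero[OF acc] unfolding AS by blast
    note iS = minv[OF S this]
    have "accr ?N (mat_adjoint (minv S) * bcirc A * minv S)"
      by (rule accr_congruence'[OF acc iS(1) S iS(2)])
    hence "accr ?N ?D" unfolding AS congruence_cancel[OF S iS(1,2) mat_diag_dim] .
    from accr_diag_entry[OF this] have "0 < cos (vec_index \<psi> k)" if "k < ?N" for k
      using that by (simp add: mat_diag_def)
    hence "canonical_phases ?N (bcirc A) S (vec_index \<psi>)"
      using S AS \<psi> abs_less_pi_half_of_cos_pos by (auto simp: canonical_phases_def)
    from canonical_phases_unique[OF acc this can] show ?thesis using \<psi>(1) by (intro eq_vecI) auto
  qed
  ultimately show ?thesis unfolding t_phases_def by (rule the_equality)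
qed

text \<open>Every entry of \<open>bcirc\<close> is an entry of a single slice, so the entrywise
  integral passes through \<open>bcirc\<close>.\<close>

lemma bcirc_t_gmean_inverse:
  assumes A: "A \<in> accretive n p" and B: "B \<in> accretive n p" and n: "0 < n" and p: "0 < p"
  shows "t_gmean_inverse A B \<in> carrier_tensor n n p"
    and "bcirc (t_gmean_inverse A B) = gmean_inv (n * p) (bcirc A) (bcirc B)"
proof -
  let ?N = "n * p"
  have cA: "A \<in> carrier_tensor n n p" and accA: "accr ?N (bcirc A)"
    and cB: "B \<in> carrier_tensor n n p" and accB: "accr ?N (bcirc B)"
    using A B accretive_iff[OF n p] by auto
  note a = carrier_tensorD[OF cA p]
  define K where "K t = complex_of_real t \<cdot>\<^sub>T A +\<^sub>T complex_of_real (1 / t) \<cdot>\<^sub>T B" for t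
  define I where "I = t_integral n n p {0<..} (\<lambda>t. complex_of_real (1 / t) \<cdot>\<^sub>T t_inverse (K t))"
  have H: "t_gmean_inverse A B = complex_of_real (2 / pi) \<cdot>\<^sub>T I"
    unfolding t_gmean_inverse_def I_def K_def using a by simp
  have I: "length I = p" "\<And>k. k < p \<Longrightarrow> I ! k \<in> carrier_mat n n"
    by (auto simp: I_def t_integral_def)
  show cH: "t_gmean_inverse A B \<in> carrier_tensor n n p"
    unfolding H using I by (simp add: carrier_tensor_def t_smult_def)
  have K: "K t \<in> carrier_tensor n n p"
    "bcirc (K t) = complex_of_real t \<cdot>\<^sub>m bcirc A + complex_of_real (1 / t) \<cdot>\<^sub>m bcirc B" for t
    unfolding K_def using t_combination[OF cA cB p] by auto
  have Kinv: "t_inverse (K t) \<in> carrier_tensor n n p" "bcirc (t_inverse (K t)) = minv (bcirc (K t))"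
    if "0 < t" for t
  proof -
    have "accr ?N (bcirc (K t))"
      unfolding K(2) by (rule accr_combination[OF accA accB]) (use that in \<open>auto simp: add_pos_pos\<close>)
    from t_inverse_bcirc[OF K(1) n p accr_det_nonzero[OF this]]
    show "t_inverse (K t) \<in> carrier_tensor n n p" "bcirc (t_inverse (K t)) = minv (bcirc (K t))" .
  qed
  show "bcirc (t_gmean_inverse A B) = gmean_inv ?N (bcirc A) (bcirc B)"
  proof (rule eq_matI)
    fix r c assume "r < dim_row (gmean_inv ?N (bcirc A) (bcirc B))" "c < dim_col (gmean_inv ?N (bcirc A) (bcirc B))"
    hence rc: "r < ?N" "c < ?N" by (auto simp: gmean_inv_def)
    define k where "k = (r div n + p - c div n) mod p"
    have k: "k < p" "r mod n < n" "c mod n < n" using n p by (auto simp: k_def)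
    have "bcirc (t_gmean_inverse A B) $$ (r, c) = (t_gmean_inverse A B ! k) $$ (r mod n, c mod n)"
      unfolding k_def by (rule bcirc_index[OF cH p rc])
    also have "\<dots> = complex_of_real (2 / pi) * (I ! k) $$ (r mod n, c mod n)"
      unfolding H using I(1) I(2)[OF k(1)] k by (simp add: t_smult_def)
    also have "(I ! k) $$ (r mod n, c mod n)
       = (LINT t:{0<..}|lborel. ((complex_of_real (1 / t) \<cdot>\<^sub>T t_inverse (K t)) ! k) $$ (r mod n, c mod n))"
      using k by (simp add: I_def t_integral_def)
    also have "\<dots> = (LINT t:{0<..}|lborel. complex_of_real (1 / t) *
        minv (complex_of_real t \<cdot>\<^sub>m bcirc A + complex_of_real (1 / t) \<cdot>\<^sub>m bcirc B) $$ (r, c))"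
    proof (rule set_lebesgue_integral_cong)
      show "\<forall>t. t \<in> {0<..} \<longrightarrow> ((complex_of_real (1 / t) \<cdot>\<^sub>T t_inverse (K t)) ! k) $$ (r mod n, c mod n)
        = complex_of_real (1 / t) * minv (complex_of_real t \<cdot>\<^sub>m bcirc A + complex_of_real (1 / t) \<cdot>\<^sub>m bcirc B) $$ (r, c)"
      proof (intro allI impI)
        fix t :: real assume "t \<in> {0<..}"
        hence t: "0 < t" by simp
        note ki = Kinv[OF t]
        have "((complex_of_real (1 / t) \<cdot>\<^sub>T t_inverse (K t)) ! k) $$ (r mod n, c mod n)
            = complex_of_real (1 / t) * (t_inverse (K t) ! k) $$ (r mod n, c mod n)"
          using carrier_tensorD(1)[OF ki(1) p] carrier_tensorD(4)[OF ki(1) p k(1)] k by (simp add: t_smult_def)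
        also have "(t_inverse (K t) ! k) $$ (r mod n, c mod n) = minv (bcirc (K t)) $$ (r, c)"
          unfolding k_def ki(2)[symmetric] by (rule bcirc_index[OF ki(1) p rc, symmetric])
        finally show "((complex_of_real (1 / t) \<cdot>\<^sub>T t_inverse (K t)) ! k) $$ (r mod n, c mod n)
          = complex_of_real (1 / t) * minv (complex_of_real t \<cdot>\<^sub>m bcirc A + complex_of_real (1 / t) \<cdot>\<^sub>m bcirc B) $$ (r, c)"
          unfolding K(2) .
      qed
    qed simp
    also have "\<dots> = mint ?N (\<lambda>\<theta>. minv (trig_pencil (bcirc A) (bcirc B) \<theta>)) $$ (r, c)"
      by (rule gmean_inv_entry[OF accA accB rc])
    finally show "bcirc (t_gmean_inverse A B) $$ (r, c) = gmean_inv ?N (bcirc A) (bcirc B) $$ (r, c)"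
      using rc by (simp add: gmean_inv_def)
  qed (use bcirc_carrier[OF cH p] in \<open>auto simp: gmean_inv_def\<close>)
qed

lemma bcirc_t_gmean:
  assumes A: "A \<in> accretive n p" and B: "B \<in> accretive n p" and n: "0 < n" and p: "0 < p"
  shows "A #\<^sub>T B \<in> accretive n p"
    and "bcirc (A #\<^sub>T B) = minv (gmean_inv (n * p) (bcirc A) (bcirc B))"
proof -
  let ?N = "n * p"
  let ?H = "t_gmean_inverse A B" and ?J = "gmean_inv (n * p) (bcirc A) (bcirc B)"
  note H = bcirc_t_gmean_inverse[OF A B n p]
  have accJ: "accr ?N ?J" using A B accretive_iff[OF n p] by (auto intro: accr_gmean_inv)
  note cJ = accr_carrier[OF accJ] and detJ = accr_det_nonzero[OF accJ]
  have detH: "det (bcirc ?H) \<noteq> 0" using detJ H(2) by simp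
  note G = t_inverse_bcirc[OF H(1) n p detH]
  note m = minv[OF cJ detJ]
  have "is_t_inverse (t_inverse ?H) ?H"
    unfolding is_t_inverse_iff[OF G(1) n p] G(2) H(2) using m H(1) by simp
  moreover have "X = t_inverse ?H" if inv: "is_t_inverse X ?H" for X
  proof -
    \<comment> \<open>\<open>is_t_inverse\<close> reads the dimensions off its first argument, here
      the unknown \<open>X\<close>; they are recovered from those of the second.\<close>
    have "X \<in> carrier_tensor (t_rows X) (t_rows X) (length X)" "?H \<in> carrier_tensor (t_rows X) (t_rows X) (length X)"
      using inv by (auto simp: is_t_inverse_def Let_def)
    moreover from this(2) have "length X = p" using H(1) by (simp add: carrier_tensor_def)
    moreover from calculation(2) this have "t_rows X = n"
      using carrier_tensorD(2)[OF H(1) p] carrier_tensorD(2)[of ?H _ _ p] p by metis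
    ultimately have X: "X \<in> carrier_tensor n n p" by simp
    have "?J * bcirc X = 1\<^sub>m ?N" using inv unfolding is_t_inverse_iff[OF X n p] H(2) by simp
    hence "bcirc X = bcirc (t_inverse ?H)"
      unfolding G(2) H(2) by (rule minv_unique[OF cJ bcirc_carrier[OF X p]])
    thus ?thesis by (rule bcirc_inject[OF X G(1) p])
  qed
  ultimately have eq: "A #\<^sub>T B = t_inverse ?H" unfolding t_gmean_def by (rule the_equality)
  show "bcirc (A #\<^sub>T B) = minv ?J" unfolding eq G(2) H(2) ..
  thus "A #\<^sub>T B \<in> accretive n p"
    unfolding accretive_iff[OF n p] using accr_minv[OF accJ] G(1) by (simp add: eq)
qed

lemma sum_largest_vec:
  assumes "\<And>k l. k \<le> l \<Longrightarrow> l < N \<Longrightarrow> f l \<le> f k" "k \<le> N"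
  shows "sum_largest k (Matrix.vec N f) = (\<Sum>i<k. f i)"
proof -
  have l: "list_of_vec (Matrix.vec N f) = map f [0..<N]"
    by (rule nth_equalityI) (auto simp: list_of_vec_index)
  have "sorted (rev (map f [0..<N]))"
    unfolding sorted_rev_iff_nth_mono using assms(1) by auto
  hence "sort (map f [0..<N]) = rev (map f [0..<N])"
    by (intro properties_for_sort) auto
  hence "sum_largest k (Matrix.vec N f) = sum_list (map f [0..<k])"
    unfolding sum_largest_def l using assms(2) by (simp add: take_map take_upt)
  also have "\<dots> = (\<Sum>i<k. f i)" by (simp add: interv_sum_list_conv_sum_set_nat lessThan_atLeast0)
  finally show ?thesis .
qed

theorem theorem3p9:
  fixes A B :: ctensor and n p :: nat
  assumes "n \<ge> 1" and "p \<ge> 1"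
    and "A \<in> accretive n p" and "B \<in> accretive n p"
  shows "t_phases (A #\<^sub>T B) \<prec>\<^sub>m (1 / 2) \<cdot>\<^sub>v t_phases A + (1 / 2) \<cdot>\<^sub>v t_phases B"
proof -
  let ?N = "n * p" and ?A = "bcirc A" and ?B = "bcirc B" and ?G = "bcirc (A #\<^sub>T B)"
  have n: "0 < n" and p: "0 < p" using assms by auto
  note G = bcirc_t_gmean[OF assms(3,4) n p]
  have acc: "accr ?N ?A" "accr ?N ?B" "accr ?N ?G"
    using assms(3,4) G(1) accretive_iff[OF n p] by auto
  have eq: "?B = ?G * minv ?A * ?G" unfolding G(2) by (rule gmean_inv_equation[OF acc(1,2)])
  obtain TA \<alpha> where \<alpha>: "canonical_phases ?N ?A TA \<alpha>" using canonical_phases_exist[OF acc(1)] .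
  obtain TB \<beta> where \<beta>: "canonical_phases ?N ?B TB \<beta>" using canonical_phases_exist[OF acc(2)] .
  obtain TG \<gamma> where \<gamma>: "canonical_phases ?N ?G TG \<gamma>" using canonical_phases_exist[OF acc(3)] .
  note sums = phase_sums_geometric_mean[OF acc(1) \<alpha> acc(2) \<beta> acc(3) \<gamma> eq]
  have desc: "\<alpha> l \<le> \<alpha> k" "\<beta> l \<le> \<beta> k" "\<gamma> l \<le> \<gamma> k" if "k \<le> l" "l < ?N" for k l
    using \<alpha> \<beta> \<gamma> that by (auto simp: canonical_phases_def)
  \<comment> \<open>An average of two decreasing sequences is decreasing, so its \<open>k\<close>
    largest entries are the first \<open>k\<close>.\<close>
  define \<delta> where "\<delta> k = (\<alpha> k + \<beta> k) / 2" for k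
  have desc': "\<delta> l \<le> \<delta> k" if "k \<le> l" "l < ?N" for k l
    using desc(1,2)[OF that] by (simp add: \<delta>_def)
  have rhs: "(1 / 2) \<cdot>\<^sub>v t_phases A + (1 / 2) \<cdot>\<^sub>v t_phases B = Matrix.vec ?N \<delta>"
    unfolding t_phases_eq[OF assms(3) n p \<alpha>] t_phases_eq[OF assms(4) n p \<beta>]
    by (intro eq_vecI) (auto simp: \<delta>_def field_simps)
  have lhs: "t_phases (A #\<^sub>T B) = Matrix.vec ?N \<gamma>" by (rule t_phases_eq[OF G(1) n p \<gamma>])
  have sum_\<delta>: "(\<Sum>i<k. \<delta> i) = ((\<Sum>i<k. \<alpha> i) + (\<Sum>i<k. \<beta> i)) / 2" for k
    by (simp add: \<delta>_def sum.distrib flip: sum_divide_distrib)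
  \<comment> \<open>Equality of the totals thus becomes the case of full length among the sums of
    largest entries.\<close>
  have total: "sum_list (list_of_vec x) = sum_largest (dim_vec x) x" for x :: "real vec"
  proof -
    have "sum_largest (dim_vec x) x = sum_list (rev (sort (list_of_vec x)))"
      unfolding sum_largest_def by simp
    also have "\<dots> = sum_list (list_of_vec x)"
      by (metis mset_rev mset_sort sum_mset_sum_list)
    finally show ?thesis ..
  qed
  show ?thesis
    unfolding majorized_def total lhs rhs
    using sums sum_largest_vec[of ?N \<gamma>, OF desc(3)] sum_largest_vec[of ?N \<delta>, OF desc'] sum_\<delta> by fastforce
qed

end
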